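(* Assume that the ergodic degree $d$ exists and is finite. For $d>0$ and fixed $a\ge d$ there is a constant $D>0$ such that $$|\hat\mu(f\cdot g\circ T^n)-\hat\mu(f)\hat\mu(g)|\le D\,\|f\|_a\|g\|_a\,n^{-(d-\epsilon)}$$ for all $n>0$, $\epsilon>0$ and $f,g\in\mathcal H_a$.
   Context: Shift and potential. $\Omega=\{0,1\}^{\{0,1,2,\dots\}}$, $T$ is the left shift, $0^\infty=(000\dots)$, $\tau(\omega)=1+\inf\{i\ge 0:\omega_i=1\}$ (with $\inf\emptyset=\infty$), $A_k=\{\omega:\tau(\omega)=k\}$ for $k\ge1$. Let $\Omega_*$ be the set of $\omega\in\Omega$ with infinitely many $1$'s. For $\omega\in\Omega_*$ the times between passages are $\sigma_k(\omega)=\tau\big((T^\tau)^k\omega\big)$, $k\ge 0$, where $T^\tau\omega=T^{\tau(\omega)}\omega$. A potential $V:\Omega\to\mathbb R$ is given, with induced version $W(\omega)=\sum_{k=0}^{\tau(\omega)-1}V(T^k\omega)$, satisfying: (1) $V$ is continuous, $-C_1\le V\le 0$ for some constant $C_1>0$, and $V(0^\infty)=0$; (2) $\sum_{n\ge1}\exp(\sup_{A_n}W)<C_2$ for some constant $C_2$; (3) for some $0<\theta<1$ and $C_3>0$, for all $n\ge1$, $\mathrm{Var}_nW\le C_3\theta^n$, where $\mathrm{Var}_nW=\sup\{|W(\omega)-W(\omega')|:\inf\{k\ge0:\sigma_k(\omega)\ne\sigma_k(\omega')\}=n\}$; (4) the limit $\lim_n\frac1n\log\sum_{\omega_0,\dots,\omega_{n-1}}\exp\big(\sup_{\omega'\in\Omega}\sum_{i=0}^{n-1}V(\omega_i\dots\omega_{n-1}\omega')\big)$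 exists and equals $0$. Induced operator and measures. Put $\varphi=e^V$, $\psi=e^W$. $\mathcal F_\theta$ is the Banach space of bounded complex functions on $\Omega_*$ which are Lipschitz for $d_\theta(\omega,\omega')=\theta^{\inf\{j\ge0:\sigma_j(\omega)\neq\sigma_j(\omega')\}}$, normed by sup norm plus least Lipschitz constant. The operator $(\mathcal Mf)(\omega)=\sum_{n\ge1}\psi(0^{n-1}1\omega)f(0^{n-1}1\omega)$ on $\mathcal F_\theta$ has a unique positive $h\in\mathcal F_\theta$ and Borel probability measure $\nu$ on $\Omega_*$ with $\mathcal Mh=h$, $\mathcal M^*\nu=\nu$, $\int h\,d\nu=1$. Let $\rho=h\cdot\nu$. With $(\mathcal L_0f)(\omega)=\varphi(0\omega)f(0\omega)$, put $e=\sum_{k\ge0}\mathcal L_0^kh$ and $\mu=e\cdot\nu$, a $\sigma$-finite $T$-invariant measure. Measures are extended to $\Omega$ by giving mass $0$ to $\Omega\setminus\Omega_*$. Moments and ergodic degree. $M_\gamma=\sum_{k\ge1}k^\gamma\rho(A_k)$ for $\gamma\ge0$; $\mu(\Omega)=M_1$. The ergodic degree is the real number $d$ with $M_{d+1}=\infty$ but $M_{d+1-\epsilon}<\infty$ for all $\epsilon>0$. If $d>0$ then $M_1<\infty$ and $\hat\mu=\mu/M_1$ is a $T$-invariant probability; $\hat\mu(f)=\int f\,d\hat\mu$. Functions of polynomial variation. $\mathrm{var}_nf=\sup\{|f(\omega)-f(\omega')|:\inf\{k\ge0:\omega_k\ne\omega'_k\}=n\}$. For $a>0$, $\mathcal H_a=\mathcal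 H_a(\Omega)$ is the space of $f\in C(\Omega)$ for which there is $C$ with $\mathrm{var}_nf\le Cn^{-a}$ for all $n>0$, with norm $\|f\|_a=|f|_\infty+\sup_{n>0}\{n^a\,\mathrm{var}_nf\}$.
   Formalization: The constant D may depend on ε (but not on n, f, g): for each ε>0 there is such a D. A D independent of ε would give the rate n^{-d}, which fails, e.g. for renewal potentials with ρ(A_k) proportional to k^{-(d+2)} log(k+K), where the correlation is of order n^{-d} log n. *)

theory Defs
  imports "HOL-Probability.Probability_Measure" "HOL-Library.Omega_Words_Fun"
begin

text \<open>
  The space \<Omega> is the whole type \<open>nat \<Rightarrow> bool\<close> with the product topology, where \<open>False\<close> and
  \<open>True\<close> stand for the symbols 0 and 1. The iterate \<open>T\<^sup>n\<close> of the left shift is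
  \<^term>\<open>suffix n\<close>, and \<^term>\<open>conc w \<omega>\<close> puts the finite word \<open>w\<close> in front of \<open>\<omega>\<close>.
\<close>

type_synonym seq = "nat \<Rightarrow> bool"

definition zero_seq :: seq where
  "zero_seq = (\<lambda>_. False)"

text \<open>The infimum is \<open>\<infinity>\<close> for equal sequences.\<close>

definition first_diff :: "(nat \<Rightarrow> 'a) \<Rightarrow> (nat \<Rightarrow> 'a) \<Rightarrow> enat" where
  "first_diff x y = (INF k\<in>{k. x k \<noteq> y k}. enat k)"

definition tau :: "seq \<Rightarrow> enat" where
  "tau \<omega> = 1 + (INF i\<in>{i. \<omega> i}. enat i)"

definition A_set :: "nat \<Rightarrow> seq set" where
  "A_set k = {\<omega>. tau \<omega> = enat k}"

definition Omega_star :: "seq set" where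
  "Omega_star = {\<omega>. infinite {i. \<omega> i}}"

text \<open>Only meaningful where \<^const>\<open>tau\<close> is finite; it is used on \<^const>\<open>Omega_star\<close>, which it
  maps to itself.\<close>

definition T_tau :: "seq \<Rightarrow> seq" where
  "T_tau \<omega> = suffix (the_enat (tau \<omega>)) \<omega>"

definition passage :: "seq \<Rightarrow> nat \<Rightarrow> enat" where
  "passage \<omega> k = tau ((T_tau ^^ k) \<omega>)"

text \<open>At the zero sequence the index set is infinite and the sum is 0 by convention, which is
  the right value when \<open>V\<close> vanishes there.\<close>

definition induced :: "(seq \<Rightarrow> real) \<Rightarrow> seq \<Rightarrow> real" where
  "induced V \<omega> = (\<Sum>k | enat k < tau \<omega>. V (suffix k \<omega>))"

text \<open>Extended values, because the differences are not known to be bounded beforehand.\<close>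

definition Var :: "nat \<Rightarrow> (seq \<Rightarrow> real) \<Rightarrow> ennreal" where
  "Var n W =
     (SUP (\<omega>, \<omega>') \<in> {(\<omega>, \<omega>'). \<omega> \<in> Omega_star \<and> \<omega>' \<in> Omega_star \<and>
                        first_diff (passage \<omega>) (passage \<omega>') = enat n}.
        ennreal \<bar>W \<omega> - W \<omega>'\<bar>)"

definition admissible_potential :: "(seq \<Rightarrow> real) \<Rightarrow> real \<Rightarrow> bool" where
  "admissible_potential V \<theta> \<longleftrightarrow>
     (continuous_on UNIV V \<and> (\<exists>C1>0. \<forall>\<omega>. - C1 \<le> V \<omega> \<and> V \<omega> \<le> 0) \<and> V zero_seq = 0) \<and>
     (\<exists>C2::real. (\<Sum>n. ennreal (exp (SUP \<omega>\<in>A_set (Suc n). induced V \<omega>))) < ennreal C2) \<and>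
     (0 < \<theta> \<and> \<theta> < 1 \<and> (\<exists>C3>0. \<forall>n\<ge>1. Var n (induced V) \<le> ennreal (C3 * \<theta> ^ n))) \<and>
     (\<lambda>n. 1 / real n * ln (\<Sum>w | length w = n.
          exp (SUP \<omega>'. \<Sum>i<n. V (conc (drop i w) \<omega>')))) \<longlonglongrightarrow> 0"

definition d_theta :: "real \<Rightarrow> seq \<Rightarrow> seq \<Rightarrow> real" where
  "d_theta \<theta> \<omega> \<omega>' =
     (case first_diff (passage \<omega>) (passage \<omega>') of enat n \<Rightarrow> \<theta> ^ n | \<infinity> \<Rightarrow> 0)"

text \<open>Functions on \<^const>\<open>Omega_star\<close> are represented by total functions whose values outside
  \<^const>\<open>Omega_star\<close> are irrelevant.\<close>

definition F_theta :: "real \<Rightarrow> (seq \<Rightarrow> complex) set" where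
  "F_theta \<theta> = {f. bounded (f ` Omega_star) \<and>
     (\<exists>L. \<forall>\<omega>\<in>Omega_star. \<forall>\<omega>'\<in>Omega_star. cmod (f \<omega> - f \<omega>') \<le> L * d_theta \<theta> \<omega> \<omega>')}"

definition M_op :: "(seq \<Rightarrow> real) \<Rightarrow> (seq \<Rightarrow> complex) \<Rightarrow> seq \<Rightarrow> complex" where
  "M_op V f \<omega> = (\<Sum>\<^sub>\<infinity>n\<in>{1..}.
     let \<omega>' = conc (replicate (n - 1) False @ [True]) \<omega>
     in complex_of_real (exp (induced V \<omega>')) * f \<omega>')"

text \<open>
  A Borel measure on \<^const>\<open>Omega_star\<close> is represented by its extension by 0 to \<Omega>.
  Integrals are set integrals over \<^const>\<open>Omega_star\<close>, as \<open>h\<close> and the test functions need not be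
  measurable outside. The equation for \<open>\<nu>\<close> is \<open>\<M>\<^sup>*\<nu> = \<nu>\<close>, tested on all of the function space
  on which the operator acts.
\<close>

definition induced_eigenpair ::
    "(seq \<Rightarrow> real) \<Rightarrow> real \<Rightarrow> (seq \<Rightarrow> real) \<Rightarrow> seq measure \<Rightarrow> bool" where
  "induced_eigenpair V \<theta> h \<nu> \<longleftrightarrow>
     (\<lambda>\<omega>. complex_of_real (h \<omega>)) \<in> F_theta \<theta> \<and>
     (\<forall>\<omega>\<in>Omega_star. h \<omega> > 0) \<and>
     (\<forall>\<omega>\<in>Omega_star. M_op V (\<lambda>\<omega>. complex_of_real (h \<omega>)) \<omega> = complex_of_real (h \<omega>)) \<and>
     prob_space \<nu> \<and> sets \<nu> = sets borel \<and> emeasure \<nu> (- Omega_star) = 0 \<and>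
     (\<forall>f\<in>F_theta \<theta>. (LINT \<omega>:Omega_star|\<nu>. M_op V f \<omega>) = (LINT \<omega>:Omega_star|\<nu>. f \<omega>)) \<and>
     (LINT \<omega>:Omega_star|\<nu>. h \<omega>) = 1"

definition rho :: "(seq \<Rightarrow> real) \<Rightarrow> seq measure \<Rightarrow> seq measure" where
  "rho h \<nu> = density \<nu> (\<lambda>\<omega>. indicator Omega_star \<omega> * ennreal (h \<omega>))"

definition L0 :: "(seq \<Rightarrow> real) \<Rightarrow> (seq \<Rightarrow> real) \<Rightarrow> seq \<Rightarrow> real" where
  "L0 V f \<omega> = exp (V (conc [False] \<omega>)) * f (conc [False] \<omega>)"

definition e_density :: "(seq \<Rightarrow> real) \<Rightarrow> (seq \<Rightarrow> real) \<Rightarrow> seq \<Rightarrow> ennreal" where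
  "e_density V h \<omega> = (\<Sum>k. ennreal ((L0 V ^^ k) h \<omega>))"

definition mu :: "(seq \<Rightarrow> real) \<Rightarrow> (seq \<Rightarrow> real) \<Rightarrow> seq measure \<Rightarrow> seq measure" where
  "mu V h \<nu> = density \<nu> (\<lambda>\<omega>. indicator Omega_star \<omega> * e_density V h \<omega>)"

definition moment :: "seq measure \<Rightarrow> real \<Rightarrow> ennreal" where
  "moment \<rho> \<gamma> = (\<Sum>k. ennreal (real (Suc k) powr \<gamma>) * emeasure \<rho> (A_set (Suc k)))"

text \<open>For a probability measure, moments of negative order are finite, so it makes no difference
  that \<open>\<epsilon>\<close> is not restricted to \<open>\<epsilon> \<le> d + 1\<close>.\<close>

definition has_ergodic_degree :: "seq measure \<Rightarrow> real \<Rightarrow> bool" where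
  "has_ergodic_degree \<rho> d \<longleftrightarrow>
     moment \<rho> (d + 1) = \<infinity> \<and> (\<forall>\<epsilon>>0. moment \<rho> (d + 1 - \<epsilon>) < \<infinity>)"

definition mu_hat :: "(seq \<Rightarrow> real) \<Rightarrow> (seq \<Rightarrow> real) \<Rightarrow> seq measure \<Rightarrow> seq measure" where
  "mu_hat V h \<nu> = scale_measure (inverse (moment (rho h \<nu>) 1)) (mu V h \<nu>)"

text \<open>The real suprema below are taken over nonempty bounded sets: continuous functions on the
  compact space \<Omega> are bounded, and the last one is bounded for functions in \<open>H_space\<close>.\<close>

definition var :: "nat \<Rightarrow> (seq \<Rightarrow> complex) \<Rightarrow> real" where
  "var n f = (SUP (\<omega>, \<omega>') \<in> {(\<omega>, \<omega>'). first_diff \<omega> \<omega>' = enat n}. cmod (f \<omega> - f \<omega>'))"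

definition H_space :: "real \<Rightarrow> (seq \<Rightarrow> complex) set" where
  "H_space a = {f. continuous_on UNIV f \<and> (\<exists>C. \<forall>n>0. var n f \<le> C * real n powr (- a))}"

definition H_norm :: "real \<Rightarrow> (seq \<Rightarrow> complex) \<Rightarrow> real" where
  "H_norm a f = (SUP \<omega>. cmod (f \<omega>)) + (SUP n\<in>{0<..}. real n powr a * var n f)"

end

theory Submission
  imports Defs
begin

text \<open>
  The correlation is controlled by a coupling. Prepending symbols to a sequence according to the
  normalised transfer operator is a renewal chain: blocks \<open>0\<^sup>m1\<close> are chosen with probabilities
  \<open>p m x = \<psi>(0\<^sup>m1x) h(0\<^sup>m1x) / h(x)\<close>, which depend on the past only up to a factor
  \<open>exp (C \<theta>\<^sup>j)\<close> once \<open>j\<close> blocks agree, and which are dominated by a sequence with finite moments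
  of order \<open>1 + \<gamma>\<close> for every \<open>\<gamma> < d\<close>. Two copies of the chain meet at a renewal with probability
  bounded below, and after a meeting they choose equal blocks forever with positive probability;
  the weight \<open>(1 + n/R) powr \<gamma>\<close>, which is submultiplicative and close to 1 for large \<open>R\<close>, turns
  this into the decay rate \<open>n powr (- \<gamma>)\<close> by induction on the remaining time. The dual operator
  transports the correlation integral to such a chain started from \<open>\<mu>\<close>, for which the residual time
  to the next renewal still has a finite moment of order \<open>\<gamma>\<close>.
\<close>

text \<open>The obstacle is that \<open>f\<close> and \<open>g\<close> need not be Lipschitz for
  \<open>d_theta\<close>: their variation decays polynomially in coordinates, while distortion
  decays exponentially in blocks. So the comparison of the two copies uses of \<open>f\<close> only
  that equal initial coordinates give close values. After a choice of unequal blocks the copies are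
  out of phase. The bound \<open>K * wt R \<gamma> r\<close> is therefore claimed for copies with
  \<open>r\<close> and \<open>r + s\<close> steps left, uniformly in the lag \<open>s\<close> and in
  both starting points; this uniformity lets the induction on \<open>r\<close> close. The price is
  the overshoot when the copy with more time left jumps past the other; summed over all lags it
  costs one extra power of the block length, which is why moments of order
  \<open>1 + \<gamma>\<close> are needed for the rate \<open>\<gamma>\<close>. The constants are
  chosen in this order: the gain of one attempt to couple, then \<open>R\<close> so large that the
  weights eat up at most half of it, then \<open>K\<close> so large that the other half absorbs the
  oscillation \<open>H\<close> of \<open>f\<close>. In the correlation itself a constant is
  subtracted from the chain values and cancels, so their limit never has to be identified.\<close>

declare build_cons [simp del]

section \<open>Blocks and passage times\<close>

text \<open>The index \<open>m\<close> counts the zeros, so the block has length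
  \<open>m + 1\<close>, and \<open>blk m x\<close> lies in \<open>A_set (Suc m)\<close>. This shift
  by one recurs in all sums over blocks.\<close>

definition blk :: "nat \<Rightarrow> seq \<Rightarrow> seq" where
  "blk m x = conc (replicate m False @ [True]) x"

definition zeros :: "nat \<Rightarrow> seq \<Rightarrow> seq" where
  "zeros k x = conc (replicate k False) x"

text \<open>The combinatorial form of closeness: for \<open>0 < \<theta> < 1\<close> it amounts to
  \<open>d_theta \<theta> x y \<le> \<theta> ^ j\<close>.\<close>

definition agree :: "nat \<Rightarrow> seq \<Rightarrow> seq \<Rightarrow> bool" where
  "agree j x y \<longleftrightarrow> (\<forall>i<j. passage x i = passage y i)"

lemma agree_0 [simp]: "agree 0 x y"
  by (simp add: agree_def)

lemma blk_nth: "blk m x i = (if i < m then False else if i = m then True else x (i - Suc m))"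
  by (auto simp: blk_def conc_def nth_append)

lemma zeros_nth: "zeros k x i = (if i < k then False else x (i - k))"
  by (auto simp: zeros_def conc_def)

lemma zeros_0 [simp]: "zeros 0 x = x"
  by (simp add: zeros_def)

lemma zeros_Suc: "zeros (Suc k) x = zeros k (conc [False] x)"
  by (rule ext) (auto simp: zeros_nth conc_def)

lemma blk_zeros: "blk m x = zeros m (conc [True] x)"
  by (rule ext) (auto simp: zeros_nth blk_nth conc_def)

lemma conc_True_eq_blk: "conc [True] x = blk 0 x"
  by (rule ext) (auto simp: blk_nth conc_def)

lemma suffix_blk: "suffix i (blk m x) = (if i \<le> m then blk (m - i) x else suffix (i - Suc m) x)"
proof (rule ext)
  fix k
  show "suffix i (blk m x) k = (if i \<le> m then blk (m - i) x else suffix (i - Suc m) x) k"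
    by (cases "i \<le> m") (auto simp: blk_nth intro!: arg_cong[where f = x])
qed

lemma infinite_shift_iff:
  fixes P :: "nat \<Rightarrow> bool"
  shows "infinite {i. P (i + k)} \<longleftrightarrow> infinite {i. P i}"
  using infinite_nat_iff_unbounded frequently_cofinite[of P] frequently_cofinite[of "\<lambda>i. P (i + k)"]
  by (metis (no_types, lifting) Inf_many_def MOST_SucD MOST_nat_le add_leE cofinite_eq_sequentially eventually_sequentially_seg frequently_def)

lemma Omega_star_suffix: "suffix k x \<in> Omega_star \<longleftrightarrow> x \<in> Omega_star"
  using infinite_shift_iff[of x k] by (simp add: Omega_star_def add.commute suffix_def)

lemma Omega_star_conc: "conc w x \<in> Omega_star \<longleftrightarrow> x \<in> Omega_star"
proof -
  have "suffix (length w) (conc w x) = x"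
    by (auto simp: fun_eq_iff)
  then show ?thesis
    using Omega_star_suffix[of "length w" "conc w x"] by (simp only:)
qed

lemma Omega_star_blk [simp]: "blk m x \<in> Omega_star \<longleftrightarrow> x \<in> Omega_star"
  unfolding blk_def by (rule Omega_star_conc)

lemma Omega_star_zeros [simp]: "zeros m x \<in> Omega_star \<longleftrightarrow> x \<in> Omega_star"
  unfolding zeros_def by (rule Omega_star_conc)

lemma tau_blk [simp]: "tau (blk m x) = enat (Suc m)"
proof -
  have "(INF i\<in>{i. blk m x i}. enat i) = enat m"
    by (rule antisym) (auto intro!: INF_lower2[of m] INF_greatest simp: blk_nth split: if_splits)
  then show ?thesis
    by (simp add: tau_def eSuc_enat[symmetric] plus_1_eSuc)
qed

lemma T_tau_blk [simp]: "T_tau (blk m x) = x"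
  by (simp add: T_tau_def suffix_blk)

lemma passage_blk_0 [simp]: "passage (blk m x) 0 = enat (Suc m)"
  by (simp add: passage_def)

lemma passage_blk_Suc [simp]: "passage (blk m x) (Suc k) = passage x k"
  by (simp add: passage_def funpow_Suc_right del: funpow.simps)

lemma agree_blk: "agree (Suc j) (blk m x) (blk n y) \<longleftrightarrow> m = n \<and> agree j x y"
  by (auto simp: agree_def All_less_Suc2)

lemma Omega_star_cases:
  assumes "x \<in> Omega_star"
  obtains m y where "x = blk m y" "y \<in> Omega_star"
proof -
  have "\<exists>i. x i"
    using assms not_finite_existsD by (auto simp: Omega_star_def)
  define m where "m = (LEAST i. x i)"
  have m: "x m" "\<And>i. i < m \<Longrightarrow> \<not> x i"
    using \<open>\<exists>i. x i\<close> LeastI_ex not_less_Least unfolding m_def by metis+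
  have "x = blk m (suffix (Suc m) x)"
    using m by (auto simp: fun_eq_iff blk_nth)
  with that assms show thesis
    by (metis Omega_star_blk)
qed

text \<open>Every block has length at least one, so \<open>j\<close> equal passage times determine
  at least \<open>j\<close> coordinates.\<close>

lemma agree_imp_eq:
  "x \<in> Omega_star \<Longrightarrow> y \<in> Omega_star \<Longrightarrow> agree j x y \<Longrightarrow> i < j \<Longrightarrow> x i = y i"
proof (induction j arbitrary: x y i)
  case (Suc j)
  obtain m x' where x: "x = blk m x'" "x' \<in> Omega_star"
    using Omega_star_cases[OF Suc.prems(1)] by blast
  obtain n y' where y: "y = blk n y'" "y' \<in> Omega_star"
    using Omega_star_cases[OF Suc.prems(2)] by blast
  have "m = n" "agree j x' y'"
    using Suc.prems(3) by (auto simp: x y agree_blk)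
  with Suc.IH[OF x(2) y(2), of "i - Suc m"] Suc.prems(4) show ?case
    by (auto simp: x y blk_nth)
qed simp

text \<open>The total length of the first \<open>j\<close> blocks of \<open>x\<close> serves as
  \<open>l\<close>. It depends on \<open>x\<close>, as blocks can be arbitrarily long, but it is
  enough for continuity at each point.\<close>

lemma cylinder_agree:
  "x \<in> Omega_star \<Longrightarrow> \<exists>l. \<forall>y\<in>Omega_star. (\<forall>i<l. y i = x i) \<longrightarrow> agree j y x"
proof (induction j arbitrary: x)
  case (Suc j)
  obtain m x' where x: "x = blk m x'" "x' \<in> Omega_star"
    using Omega_star_cases[OF Suc.prems(1)] by blast
  obtain l where l: "\<forall>y\<in>Omega_star. (\<forall>i<l. y i = x' i) \<longrightarrow> agree j y x'"
    using Suc.IH[OF x(2)] by blast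
  show ?case
  proof (intro exI[of _ "Suc m + l"] ballI impI)
    fix y assume y: "y \<in> Omega_star" "\<forall>i<Suc m + l. y i = x i"
    define y' where "y' = suffix (Suc m) y"
    have yb: "y = blk m y'"
      using y(2) by (auto simp: fun_eq_iff blk_nth y'_def x)
    have "\<forall>i<l. y' i = x' i"
      using y(2) by (auto simp: y'_def x blk_nth)
    then have "agree j y' x'"
      using l y(1) yb by auto
    then show "agree (Suc j) y x"
      by (simp add: yb x agree_blk)
  qed
qed simp

lemma first_diff_ge_iff: "enat n \<le> first_diff x y \<longleftrightarrow> (\<forall>i<n. x i = y i)"
  unfolding first_diff_def le_INF_iff by (auto simp: not_less[symmetric])

lemma first_diff_eq_infinity_iff: "first_diff x y = \<infinity> \<longleftrightarrow> x = y"
proof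
  assume "first_diff x y = \<infinity>"
  then have "enat (Suc i) \<le> first_diff x y" for i
    by simp
  then show "x = y"
    unfolding first_diff_ge_iff by auto
qed (simp add: first_diff_def top_enat_def)

lemma agree_iff: "agree j x y \<longleftrightarrow> enat j \<le> first_diff (passage x) (passage y)"
  by (simp add: agree_def first_diff_ge_iff)

lemma passage_inject:
  assumes "x \<in> Omega_star" "y \<in> Omega_star" "passage x = passage y"
  shows "x = y"
  using agree_imp_eq[OF assms(1,2)] assms(3) by (auto simp: agree_def fun_eq_iff)

lemma d_theta_le:
  assumes "0 < \<theta>" "\<theta> < 1" "agree j x y"
  shows "d_theta \<theta> x y \<le> \<theta> ^ j"
  using assms by (auto simp: d_theta_def agree_iff split: enat.split intro!: power_decreasing)

lemma d_theta_ge: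
  assumes "0 < \<theta>" "\<theta> < 1" "\<not> agree j x y"
  shows "\<theta> ^ j \<le> d_theta \<theta> x y"
  using assms by (auto simp: d_theta_def agree_iff not_le split: enat.split intro!: power_decreasing)

lemma d_theta_nonneg: "0 < \<theta> \<Longrightarrow> 0 \<le> d_theta \<theta> x y"
  by (auto simp: d_theta_def split: enat.split)

section \<open>Weights\<close>

definition wt :: "real \<Rightarrow> real \<Rightarrow> nat \<Rightarrow> real" where
  "wt R \<gamma> r = (1 + real r / R) powr (- \<gamma>)"

definition gw :: "real \<Rightarrow> real \<Rightarrow> nat \<Rightarrow> real" where
  "gw R \<gamma> k = (1 + real k / R) powr \<gamma>"

context
  fixes R \<gamma> :: real
  assumes R: "1 \<le> R" and g: "0 < \<gamma>"
begin

lemma wt_pos: "0 < wt R \<gamma> r"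
  using R unfolding wt_def by (smt (verit) divide_nonneg_nonneg of_nat_0_le_iff powr_gt_zero)

lemma wt_0 [simp]: "wt R \<gamma> 0 = 1"
  by (simp add: wt_def)

lemma gw_ge_1: "1 \<le> gw R \<gamma> k"
  using R g by (auto simp: gw_def intro!: ge_one_powr_ge_zero)

lemma gw_mono: "k \<le> l \<Longrightarrow> gw R \<gamma> k \<le> gw R \<gamma> l"
  using R g by (auto simp: gw_def intro!: powr_mono2 divide_right_mono)

lemma gw_max: "gw R \<gamma> (max k l) \<le> gw R \<gamma> k + gw R \<gamma> l - 1"
  using gw_ge_1[of k] gw_ge_1[of l] by (auto simp: max_def)

text \<open>Submultiplicativity: \<open>1 + (n + k) / R\<close> is at most
  \<open>(1 + n / R) * (1 + k / R)\<close>. Using up \<open>k\<close> steps of the remaining time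
  thus costs at most the factor \<open>gw R \<gamma> k\<close>.\<close>

lemma wt_shift: "wt R \<gamma> n \<le> gw R \<gamma> k * wt R \<gamma> (n + k)"
proof -
  have pos: "0 < 1 + real i / R" for i
    using R by (auto intro!: add_pos_nonneg)
  have "1 + real (n + k) / R \<le> (1 + real n / R) * (1 + real k / R)"
    using R by (simp add: field_simps)
  then have "(1 + real (n + k) / R) powr \<gamma> \<le> (1 + real n / R) powr \<gamma> * (1 + real k / R) powr \<gamma>"
    using pos[of "n + k"] pos[of n] pos[of k] g
    by (subst powr_mult[symmetric]) (auto intro!: powr_mono2 simp: less_imp_le)
  then show ?thesis
    using pos[of "n + k"] pos[of n] unfolding wt_def gw_def powr_minus
    by (simp add: divide_simps mult.commute)
qed

text \<open>Subtraction truncates, so for \<open>k > n\<close> the left side is 1; there the factor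
  \<open>gw R \<gamma> n\<close> already compensates \<open>wt R \<gamma> n\<close>.\<close>

lemma wt_diff: "wt R \<gamma> (n - k) \<le> gw R \<gamma> k * wt R \<gamma> n"
proof (cases "k \<le> n")
  case True
  then show ?thesis
    using wt_shift[of "n - k" k] by simp
next
  case False
  have "1 \<le> gw R \<gamma> n * wt R \<gamma> n"
    using wt_shift[of 0 n] by simp
  also have "\<dots> \<le> gw R \<gamma> k * wt R \<gamma> n"
    using False wt_pos[of n] by (intro mult_right_mono gw_mono) auto
  finally show ?thesis
    using False by simp
qed

lemma powr_le_wt: "(1 + real n) powr (- \<gamma>) \<le> wt R \<gamma> n"
proof -
  have "real n / R \<le> real n"
    using R by (simp add: divide_le_eq mult_le_cancel_left1)
  then show ?thesis
    unfolding wt_def using R g by (intro powr_mono2') (auto intro!: add_pos_nonneg)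
qed

lemma gw_le: "gw R \<gamma> k \<le> (1 + real k) powr \<gamma>"
proof -
  have "real k / R \<le> real k"
    using R by (simp add: divide_le_eq mult_le_cancel_left1)
  then show ?thesis
    unfolding gw_def using R g by (intro powr_mono2) auto
qed

end

text \<open>Here \<open>c j\<close> bounds the mass on which two chains with \<open>j\<close> equal
  blocks choose different ones, and \<open>\<eta>\<close> the mean growth of the weight in one step.
  The number \<open>\<beta> j\<close> is the fraction of the worst-case bound that remains when
  \<open>j\<close> blocks agree: equal choices lead on to \<open>\<beta> (Suc j)\<close>, unequal
  ones cost the full amount. That \<open>\<beta> 0 < 1\<close> is possible rests on the
  \<open>c j\<close> being summable and each below 1.\<close>

lemma contraction_profile:
  fixes \<theta> C :: real
  assumes "0 < \<theta>" "\<theta> < 1" "0 < C"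
  defines "c \<equiv> \<lambda>j. 1 - exp (- C * \<theta> ^ j)"
  obtains \<beta> :: "nat \<Rightarrow> real" and \<eta> :: real where
    "0 < \<eta>" "\<And>j. 0 \<le> \<beta> j" "\<And>j. \<beta> j \<le> 1" "\<beta> 0 < 1"
    "\<And>j. \<beta> (Suc j) * (1 - c j + \<eta>) + c j + 2 * c j * \<eta> \<le> \<beta> j"
proof -
  \<comment> \<open>From \<open>J\<close> on the profile is \<open>A * \<theta> ^ j\<close>, and
    \<open>A * (1 - \<theta>) = 4 * C\<close> makes one step release the
    \<open>2 * C * \<theta> ^ j\<close> that is to be paid. Below \<open>J\<close> the distance to 1
    is multiplied by \<open>\<rho>\<close> with each step down.\<close>
  define A where "A = 4 * C / (1 - \<theta>)"
  define \<rho> where "\<rho> = exp (- C) / 2"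
  have A: "0 < A" "A * (1 - \<theta>) = 4 * C"
    using assms by (auto simp: A_def)
  have \<rho>: "0 < \<rho>" "\<rho> \<le> 1"
    using assms by (auto simp: \<rho>_def intro: order_trans[of _ 1])
  obtain J where "\<theta> ^ J < 1 / (2 * A)"
    using real_arch_pow_inv[of "1 / (2 * A)" \<theta>] assms A(1) by auto
  then have J: "A * \<theta> ^ J \<le> 1 / 2"
    using A(1) by (simp add: field_simps)
  have J': "A * \<theta> ^ j \<le> 1 / 2" if "J \<le> j" for j
    using J power_decreasing[OF that, of \<theta>] assms A(1)
    by (smt (verit) mult_left_mono)
  define \<eta> where "\<eta> = min ((1 - \<theta>) / 2) (\<rho> ^ J / 6)"
  have \<eta>: "0 < \<eta>" "\<eta> \<le> 1 / 2" "\<eta> \<le> (1 - \<theta>) / 2" "\<eta> \<le> \<rho> ^ J / 6"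
    using assms \<rho> by (auto simp: \<eta>_def min_def)
  define \<beta> where "\<beta> = (\<lambda>j. if j < J then 1 - \<rho> ^ (J - j) / 2 else A * \<theta> ^ j)"
  have c: "0 \<le> c j" "c j \<le> 1" "c j \<le> C * \<theta> ^ j" for j
    using assms exp_ge_add_one_self[of "- C * \<theta> ^ j"] by (auto simp: c_def)
  have b: "0 \<le> \<beta> j \<and> \<beta> j \<le> 1" for j
    using assms A \<rho> J'[of j] power_le_one[of \<rho> "J - j"] zero_le_power[of \<rho> "J - j"]
    by (auto simp: \<beta>_def intro: order_trans)
  show thesis
  proof (rule that[of \<eta> \<beta>])
    show "0 < \<eta>" "\<And>j. 0 \<le> \<beta> j" "\<And>j. \<beta> j \<le> 1"
      using \<eta> b by auto
    show "\<beta> 0 < 1"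
      using J'[of 0] \<rho> by (cases "0 < J") (auto simp: \<beta>_def)
    fix j
    show "\<beta> (Suc j) * (1 - c j + \<eta>) + c j + 2 * c j * \<eta> \<le> \<beta> j"
    proof (cases "j < J")
      case True
      define b where "b = \<rho> ^ (J - Suc j) / 2"
      have bpos: "0 < b"
        using \<rho> by (simp add: b_def)
      have b1: "\<beta> (Suc j) \<le> 1 - b"
      proof (cases "Suc j < J")
        case False
        then have "J = Suc j"
          using True by simp
        then show ?thesis
          using J by (simp add: \<beta>_def b_def)
      qed (simp add: \<beta>_def b_def)
      have "\<rho> ^ J \<le> \<rho> ^ (J - j)"
        using \<rho> by (intro power_decreasing) auto
      moreover have "\<rho> ^ (J - j) = \<rho> * \<rho> ^ (J - Suc j)"
        using True by (simp flip: power_Suc add: Suc_diff_Suc)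
      ultimately have *: "3 * \<eta> \<le> \<rho> * b" "\<beta> j = 1 - \<rho> * b"
        using \<eta>(4) True by (auto simp: b_def \<beta>_def)
      \<comment> \<open>The gain \<open>(1 - c j) * b\<close> is at least
        \<open>2 * \<rho> * b\<close>. One half remains as the distance of \<open>\<beta> j\<close>
        from 1, the other half covers the \<open>\<eta>\<close> terms, which amount to at most
        \<open>3 * \<eta>\<close>.\<close>
      have "\<theta> ^ j \<le> 1"
        using assms by (intro power_le_one) auto
      then have "2 * \<rho> \<le> 1 - c j"
        using assms by (simp add: \<rho>_def c_def)
      then have **: "2 * \<rho> * b \<le> (1 - c j) * b"
        using bpos by (intro mult_right_mono) auto
      have "\<beta> (Suc j) * (1 - c j + \<eta>) \<le> (1 - b) * (1 - c j + \<eta>)"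
        using b1 c[of j] \<eta>(1) by (intro mult_right_mono) auto
      moreover have "c j * \<eta> \<le> \<eta>" "0 \<le> b * \<eta>"
        using c[of j] \<eta>(1) bpos by (auto intro: mult_left_le_one_le)
      ultimately show ?thesis
        using * ** by (simp add: algebra_simps)
    next
      case False
      have tp: "0 < \<theta> ^ j"
        using assms by simp
      have "c j * \<eta> \<le> c j * (1 / 2)"
        using c[of j] \<eta>(2) by (intro mult_left_mono) auto
      then have 1: "c j + 2 * c j * \<eta> \<le> 2 * C * \<theta> ^ j"
        using c(3)[of j] by simp
      have "\<theta> * \<eta> \<le> (1 - \<theta>) / 2"
        using \<eta>(1,3) assms mult_left_le_one_le[of \<eta> \<theta>] by linarith
      moreover have "\<theta> * (1 - c j + \<eta>) \<le> \<theta> * (1 + \<eta>)"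
        using assms(1) c(1)[of j] by (intro mult_left_mono) auto
      ultimately have "\<theta> * (1 - c j + \<eta>) \<le> (1 + \<theta>) / 2"
        by (simp add: field_simps)
      then have "A * \<theta> ^ j * (\<theta> * (1 - c j + \<eta>)) \<le> A * \<theta> ^ j * ((1 + \<theta>) / 2)"
        using A tp by (intro mult_left_mono) auto
      moreover have "A * \<theta> ^ j * ((1 + \<theta>) / 2) + 2 * C * \<theta> ^ j = A * \<theta> ^ j"
      proof -
        have "2 * C = A * (1 - \<theta>) / 2"
          using A by simp
        then show ?thesis
          by (simp only:) (simp add: field_simps)
      qed
      ultimately show ?thesis
        using 1 False by (simp add: \<beta>_def mult_ac)
    qed
  qed
qed

section \<open>Coupling for renewal chains\<close>

text \<open>The states of the chain are pairs of the sequence built so far and the number \<open>k\<close> of zeros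
  still to be prepended before a new block \<open>0\<^sup>m1\<close> is chosen.\<close>

primrec chain_op :: "(nat \<Rightarrow> seq \<Rightarrow> real) \<Rightarrow> (seq \<Rightarrow> complex) \<Rightarrow> nat \<Rightarrow> nat \<Rightarrow> seq \<Rightarrow> complex" where
  "chain_op p f 0 k y = f y"
| "chain_op p f (Suc n) k y =
     (case k of 0 \<Rightarrow> (\<Sum>m. p m y *\<^sub>R chain_op p f n m (conc [True] y))
      | Suc k' \<Rightarrow> chain_op p f n k' (conc [False] y))"

text \<open>The observables after normalisation. With \<open>1 + real L\<close> instead of
  \<open>L\<close> the case \<open>L = 0\<close> is included and gives the bound
  \<open>H\<close>.\<close>

definition unit_holder :: "real \<Rightarrow> real \<Rightarrow> (seq \<Rightarrow> complex) \<Rightarrow> bool" where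
  "unit_holder H \<gamma> f \<longleftrightarrow> (\<forall>y. cmod (f y) \<le> 1) \<and>
     (\<forall>x y L. (\<forall>i<L. x i = y i) \<longrightarrow> cmod (f x - f y) \<le> H * (1 + real L) powr (- \<gamma>))"

text \<open>Pending zeros are prepended deterministically, so either the next renewal is reached
  after \<open>k\<close> steps or the time runs out with \<open>n\<close> zeros in place.\<close>

lemma chain_op_eq:
  "chain_op p f n k y = (if k \<le> n then chain_op p f (n - k) 0 (zeros k y) else f (zeros n y))"
proof (induction n arbitrary: k y)
  case (Suc n)
  show ?case
    by (cases k) (auto simp: Suc.IH zeros_Suc)
qed auto

lemma norm_sums_le:
  fixes f :: "nat \<Rightarrow> 'a::banach"
  assumes "f sums a" "g sums b" "\<And>n. norm (f n) \<le> g n"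
  shows "norm a \<le> b"
  using norm_suminf_le[of f g] assms by (auto simp: sums_iff)

text \<open>Integrate \<open>a m - b n\<close> against the product coupling
  \<open>r m * s n / e\<close> of two laws of equal mass \<open>e\<close>. The sum over
  \<open>n\<close> is taken first with \<open>m\<close> fixed, and the division by \<open>e\<close>
  comes last. Since the cost \<open>A m + B n\<close> separates, no double series has to be
  handled.\<close>

lemma coupling_difference:
  fixes a b :: "nat \<Rightarrow> complex" and r s A B :: "nat \<Rightarrow> real"
  assumes r: "\<And>m. 0 \<le> r m" "r sums e" and s: "\<And>m. 0 \<le> s m" "s sums e"
    and ab: "\<And>m n. cmod (a m - b n) \<le> A m + B n"
    and sa: "summable (\<lambda>m. r m *\<^sub>R a m)" and sb: "summable (\<lambda>m. s m *\<^sub>R b m)"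
    and sA: "summable (\<lambda>m. r m * A m)" and sB: "summable (\<lambda>m. s m * B m)"
  shows "cmod ((\<Sum>m. r m *\<^sub>R a m) - (\<Sum>m. s m *\<^sub>R b m)) \<le> (\<Sum>m. r m * A m) + (\<Sum>m. s m * B m)"
proof (cases "e = 0")
  case True
  then have "r m = 0 \<and> s m = 0" for m
    using r s suminf_eq_zero_iff[of r] suminf_eq_zero_iff[of s] by (auto simp: sums_iff)
  then show ?thesis
    by simp
next
  case False
  then have e: "0 < e"
    using r suminf_nonneg[of r] by (auto simp: sums_iff)
  define Sb where "Sb = (\<Sum>m. s m *\<^sub>R b m)"
  define SB where "SB = (\<Sum>m. s m * B m)"
  have 1: "cmod (e *\<^sub>R a m - Sb) \<le> e * A m + SB" for m
  proof -
    have "(\<lambda>n. s n *\<^sub>R a m) sums (e *\<^sub>R a m)"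
      using s(2) by (rule sums_scaleR_left)
    moreover have "(\<lambda>n. s n *\<^sub>R b n) sums Sb"
      using sb by (simp add: Sb_def summable_sums)
    ultimately have L: "(\<lambda>n. s n *\<^sub>R a m - s n *\<^sub>R b n) sums (e *\<^sub>R a m - Sb)"
      by (rule sums_diff)
    have U: "(\<lambda>n. s n * A m + s n * B n) sums (e * A m + SB)"
      using s(2) sB by (intro sums_add sums_mult2) (auto simp: SB_def summable_sums)
    have "cmod (s n *\<^sub>R a m - s n *\<^sub>R b n) \<le> s n * A m + s n * B n" for n
      using mult_left_mono[OF ab s(1)] s(1)[of n]
      by (simp add: scaleR_diff_right[symmetric] distrib_left)
    then show ?thesis
      using norm_suminf_le[of "\<lambda>n. s n *\<^sub>R a m - s n *\<^sub>R b n" "\<lambda>n. s n * A m + s n * B n"] L U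
      by (simp add: sums_iff)
  qed
  have L: "(\<lambda>m. e *\<^sub>R (r m *\<^sub>R a m) - r m *\<^sub>R Sb) sums (e *\<^sub>R (\<Sum>m. r m *\<^sub>R a m) - e *\<^sub>R Sb)"
    using r sa by (intro sums_diff sums_scaleR_right sums_scaleR_left) (auto simp: summable_sums)
  have U: "(\<lambda>m. e * (r m * A m) + r m * SB) sums (e * (\<Sum>m. r m * A m) + e * SB)"
    using r sA by (intro sums_add sums_mult sums_mult2) (auto simp: summable_sums)
  have "cmod (e *\<^sub>R (r m *\<^sub>R a m) - r m *\<^sub>R Sb) \<le> e * (r m * A m) + r m * SB" for m
  proof -
    have "e *\<^sub>R (r m *\<^sub>R a m) - r m *\<^sub>R Sb = r m *\<^sub>R (e *\<^sub>R a m - Sb)"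
      by (simp add: scaleR_diff_right)
    then show ?thesis
      using mult_left_mono[OF 1[of m] r(1)[of m]] r(1)[of m] by (simp add: distrib_left mult_ac)
  qed
  then have "cmod (e *\<^sub>R (\<Sum>m. r m *\<^sub>R a m) - e *\<^sub>R Sb) \<le> e * (\<Sum>m. r m * A m) + e * SB"
    using norm_suminf_le[of "\<lambda>m. e *\<^sub>R (r m *\<^sub>R a m) - r m *\<^sub>R Sb" "\<lambda>m. e * (r m * A m) + r m * SB"] L U
    by (simp add: sums_iff)
  then have "e * cmod ((\<Sum>m. r m *\<^sub>R a m) - Sb) \<le> e * ((\<Sum>m. r m * A m) + SB)"
    using e by (simp add: scaleR_diff_right[symmetric] distrib_left)
  then show ?thesis
    using e by (simp add: Sb_def SB_def)
qed

definition ones :: seq where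
  "ones = (\<lambda>_. True)"

lemma ones_in_Omega_star [simp]: "ones \<in> Omega_star"
  by (simp add: ones_def Omega_star_def)

text \<open>The probability that a chain which is at a renewal in \<open>x\<close> has another one
  exactly \<open>s\<close> steps later, decomposed by the first block. That block takes
  \<open>m + 1\<close> steps and so leaves \<open>Suc s - (m + 1) = s - m\<close>.\<close>

fun renewal_prob :: "(nat \<Rightarrow> seq \<Rightarrow> real) \<Rightarrow> nat \<Rightarrow> seq \<Rightarrow> real" where
  "renewal_prob p 0 x = 1"
| "renewal_prob p (Suc s) x = (\<Sum>m\<le>s. p m x * renewal_prob p (s - m) (blk m x))"

text \<open>At \<open>j = 0\<close> the assumption \<open>p_dist\<close> makes the block laws for
  any two pasts comparable; for large \<open>j\<close> it says that a long common recent past makes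
  them nearly equal. \<open>P\<close> is a bound on the block law that is uniform in the
  past.\<close>

locale renewal_chain =
  fixes p :: "nat \<Rightarrow> seq \<Rightarrow> real" and \<theta> C \<gamma> :: real and P :: "nat \<Rightarrow> real"
  assumes theta: "0 < \<theta>" "\<theta> < 1" and C_pos: "0 < C" and gamma: "0 < \<gamma>"
    and p_pos: "\<And>x m. x \<in> Omega_star \<Longrightarrow> 0 < p m x"
    and p_sums: "\<And>x. x \<in> Omega_star \<Longrightarrow> (\<lambda>m. p m x) sums 1"
    and p_dist: "\<And>j x y m. x \<in> Omega_star \<Longrightarrow> y \<in> Omega_star \<Longrightarrow> agree j x y \<Longrightarrow>
      p m x * exp (- C * \<theta> ^ j) \<le> p m y"
    and p_le: "\<And>x m. x \<in> Omega_star \<Longrightarrow> p m x \<le> P m"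
    and P_summable: "summable (\<lambda>m. P m * real (Suc m) powr (1 + \<gamma>))"
begin

abbreviation N :: "(seq \<Rightarrow> complex) \<Rightarrow> nat \<Rightarrow> seq \<Rightarrow> complex" where
  "N f n x \<equiv> chain_op p f n 0 x"

lemma P_pos: "0 < P m"
  using p_pos[of ones m] p_le[of ones m] by simp

lemma P_summable_weight: "1 \<le> R \<Longrightarrow> summable (\<lambda>m. P m * real (Suc m) * gw R \<gamma> (Suc m))"
proof (rule summable_comparison_test'[where g = "\<lambda>m. 2 powr \<gamma> * (P m * real (Suc m) powr (1 + \<gamma>))" and N = 0])
  show "summable (\<lambda>m. 2 powr \<gamma> * (P m * real (Suc m) powr (1 + \<gamma>)))"
    using P_summable by (rule summable_mult)
  fix m :: nat
  assume R: "1 \<le> R"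
  have "gw R \<gamma> (Suc m) \<le> (2 * real (Suc m)) powr \<gamma>"
    using gw_le[OF R gamma, of "Suc m"] powr_mono2[of \<gamma> "1 + real (Suc m)" "2 * real (Suc m)"] gamma
    by simp
  also have "\<dots> = 2 powr \<gamma> * real (Suc m) powr \<gamma>"
    by (rule powr_mult) 
  finally have "P m * real (Suc m) * gw R \<gamma> (Suc m) \<le> P m * real (Suc m) * (2 powr \<gamma> * real (Suc m) powr \<gamma>)"
    using P_pos[of m] by (intro mult_left_mono) auto
  then show "norm (P m * real (Suc m) * gw R \<gamma> (Suc m)) \<le> 2 powr \<gamma> * (P m * real (Suc m) powr (1 + \<gamma>))"
    using P_pos[of m] gw_ge_1[OF R gamma, of "Suc m"] by (simp add: powr_add mult_ac)
qed

lemma summable_dom: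
  fixes t :: "nat \<Rightarrow> 'a::banach"
  assumes "1 \<le> R" "\<And>m. norm (t m) \<le> P m * (K * (real (Suc m) * gw R \<gamma> (Suc m)))"
  shows "summable t"
proof (rule summable_comparison_test'[where N = 0])
  show "summable (\<lambda>m. K * (P m * real (Suc m) * gw R \<gamma> (Suc m)))"
    by (intro summable_mult P_summable_weight assms)
qed (use assms(2) in \<open>simp add: mult_ac\<close>)

lemma weight_ge_1:
  assumes "1 \<le> R"
  shows "1 \<le> real (Suc m) * gw R \<gamma> (Suc m)" "gw R \<gamma> (Suc m) \<le> real (Suc m) * gw R \<gamma> (Suc m)"
proof -
  show *: "gw R \<gamma> (Suc m) \<le> real (Suc m) * gw R \<gamma> (Suc m)"
    using gw_ge_1[OF assms gamma, of "Suc m"] by (intro mult_le_cancel_right1[THEN iffD2]) auto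
  then show "1 \<le> real (Suc m) * gw R \<gamma> (Suc m)"
    using gw_ge_1[OF assms gamma, of "Suc m"] by linarith
qed

lemma P_summable1: "summable (\<lambda>m. P m * real (Suc m))"
proof (rule summable_dom[where R = 1 and K = 1])
  fix m
  show "norm (P m * real (Suc m)) \<le> P m * (1 * (real (Suc m) * gw 1 \<gamma> (Suc m)))"
    using P_pos[of m] gw_ge_1[of 1 \<gamma> "Suc m"] gamma
    by (simp add: mult_le_cancel_left1)
qed simp

lemma P_summable0: "summable P"
proof (rule summable_dom[where R = 1 and K = 1])
  fix m
  show "norm (P m) \<le> P m * (1 * (real (Suc m) * gw 1 \<gamma> (Suc m)))"
    using P_pos[of m] weight_ge_1(1)[of 1 m] by (simp add: mult_le_cancel_left1)
qed simp

text \<open>For a fixed block the factor \<open>gw R \<gamma> (Suc m)\<close> tends to 1 as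
  \<open>R\<close> grows, and \<open>gw 1 \<gamma>\<close> gives a summable bound, so the series
  tends to 0 by dominated convergence along integer \<open>R\<close>.\<close>

lemma weight_small:
  assumes "0 < \<eta>"
  obtains R where "1 \<le> R" "(\<Sum>m. P m * real (Suc m) * (gw R \<gamma> (Suc m) - 1)) \<le> \<eta>"
proof -
  define a where "a = (\<lambda>m n. P m * real (Suc m) * (gw (real (Suc n)) \<gamma> (Suc m) - 1))"
  have "(\<lambda>n. a m n) \<longlonglongrightarrow> 0" for m
  proof -
    have "(\<lambda>n. real (Suc m) / real (Suc n)) \<longlonglongrightarrow> 0"
      using LIMSEQ_Suc[OF tendsto_mult_right[OF lim_1_over_n, of "real (Suc m)"]] by simp
    then have "(\<lambda>n. P m * real (Suc m) * ((1 + real (Suc m) / real (Suc n)) powr \<gamma> - 1)) \<longlonglongrightarrow>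
      P m * real (Suc m) * ((1 + 0) powr \<gamma> - 1)"
      by (intro tendsto_intros) auto
    then show ?thesis
      by (simp add: a_def gw_def)
  qed
  moreover have "norm (a m n) \<le> P m * real (Suc m) * gw 1 \<gamma> (Suc m)" for m n
  proof -
    have "gw (real (Suc n)) \<gamma> (Suc m) \<le> gw 1 \<gamma> (Suc m)"
      using gw_le[of "real (Suc n)" \<gamma> "Suc m"] gamma by (simp add: gw_def)
    then show ?thesis
      using P_pos[of m] gw_ge_1[of "real (Suc n)" \<gamma> "Suc m"] gamma
      by (auto simp: a_def abs_mult intro!: mult_left_mono)
  qed
  moreover have "summable (\<lambda>m. P m * real (Suc m) * gw 1 \<gamma> (Suc m))"
    by (rule P_summable_weight) simp
  ultimately have "(\<lambda>n. suminf (\<lambda>m. a m n)) \<longlonglongrightarrow> suminf (\<lambda>m. 0)"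
    by (intro conjunct2[OF conjunct2[OF tannerys_theorem[where F = sequentially]]])
      (auto intro!: always_eventually simp del: of_nat_Suc)
  then have "eventually (\<lambda>n. suminf (\<lambda>m. a m n) < \<eta>) sequentially"
    using assms by (intro order_tendstoD(2)) auto
  then obtain n where "suminf (\<lambda>m. a m n) < \<eta>"
    by (auto simp: eventually_sequentially)
  with that[of "real (Suc n)"] show thesis
    by (simp add: a_def)
qed

section \<open>Lower bound for the renewal probabilities\<close>

abbreviation "u \<equiv> renewal_prob p"

lemma u_nonneg: "x \<in> Omega_star \<Longrightarrow> 0 \<le> u s x"
proof (induction s arbitrary: x rule: less_induct)
  case (less s)
  then show ?case
    by (cases s) (auto intro!: sum_nonneg mult_nonneg_nonneg simp: less_imp_le[OF p_pos])
qed

lemma sum_p_le_1: "x \<in> Omega_star \<Longrightarrow> (\<Sum>m\<in>A. p m x) \<le> 1" if "finite A"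
  using sum_le_suminf[of "\<lambda>m. p m x" A] p_sums[of x] p_pos[of x] that
  by (auto simp: sums_iff less_imp_le)

lemma u_le_1: "x \<in> Omega_star \<Longrightarrow> u s x \<le> 1"
proof (induction s arbitrary: x rule: less_induct)
  case (less s)
  show ?case
  proof (cases s)
    case (Suc t)
    have "u s x \<le> (\<Sum>m\<le>t. p m x * 1)"
      unfolding Suc renewal_prob.simps
      using less Suc by (intro sum_mono mult_left_mono) (auto simp: less_imp_le[OF p_pos])
    also have "\<dots> \<le> 1"
      using sum_p_le_1[of "{..t}" x] less.prems by simp
    finally show ?thesis .
  qed simp
qed

lemma p_0_ge: "x \<in> Omega_star \<Longrightarrow> p 0 ones * exp (- C) \<le> p 0 x"
  using p_dist[of ones x 0 0] by simp

text \<open>A renewal at time \<open>s\<close> may be followed by a block of length one, whose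
  probability is at least \<open>p 0 ones * exp (- C)\<close> whatever the past; \<open>ones\<close>
  is just a reference point. The induction is needed because the recursion for \<open>u\<close>
  unfolds the first block, not the last.\<close>

lemma u_Suc_ge: "x \<in> Omega_star \<Longrightarrow> p 0 ones * exp (- C) * u s x \<le> u (Suc s) x"
proof (induction s arbitrary: x rule: less_induct)
  case (less s)
  show ?case
  proof (cases s)
    case 0
    then show ?thesis
      using p_0_ge less by simp
  next
    case (Suc t)
    have "p 0 ones * exp (- C) * u (Suc t) x =
        (\<Sum>m\<le>t. p m x * (p 0 ones * exp (- C) * u (t - m) (blk m x)))"
      by (simp add: sum_distrib_left mult_ac)
    also have "\<dots> \<le> (\<Sum>m\<le>t. p m x * u (Suc (t - m)) (blk m x))"
      using less.IH[of "t - m" "blk m x" for m] less.prems Suc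
      by (intro sum_mono mult_left_mono) (auto simp: less_imp_le[OF p_pos])
    also have "\<dots> = (\<Sum>m\<le>t. p m x * u (Suc t - m) (blk m x))"
      by (intro sum.cong) (auto simp: Suc_diff_le)
    also have "\<dots> \<le> u (Suc (Suc t)) x"
      using p_pos[OF less.prems, of "Suc t"] by (subst renewal_prob.simps) (simp del: renewal_prob.simps(2))
    finally show ?thesis
      using Suc by simp
  qed
qed

lemma u_add_ge:
  assumes "x \<in> Omega_star"
  shows "(p 0 ones * exp (- C)) ^ i * u s x \<le> u (s + i) x"
proof (induction i)
  case (Suc i)
  have "0 \<le> p 0 ones * exp (- C)"
    using p_pos[of ones 0] by simp
  then have "p 0 ones * exp (- C) * ((p 0 ones * exp (- C)) ^ i * u s x) \<le> p 0 ones * exp (- C) * u (s + i) x"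
    using Suc by (rule mult_left_mono[rotated])
  then show ?case
    using u_Suc_ge[OF assms, of "s + i"] by simp
qed simp

text \<open>The uniform tail of the block law: it bounds the probability that a new block is longer
  than \<open>i\<close>. Its sum is finite because \<open>P\<close> has a finite mean.\<close>

definition F :: "nat \<Rightarrow> real" where
  "F i = (\<Sum>m. P (m + i))"

lemma summable_P_offset: "summable (\<lambda>m. P (m + i))"
  using P_summable0 by (simp add: summable_iff_shift)

lemma F_nonneg: "0 \<le> F i"
  unfolding F_def using P_pos by (intro suminf_nonneg summable_P_offset) (simp add: less_imp_le)

lemma F_eq: "F i = (\<Sum>m. if i \<le> m then P m else 0)"
  and summable_P_if: "summable (\<lambda>m. if i \<le> m then P m else 0)"
proof -
  have 1: "summable (\<lambda>m. if i \<le> m + i then P (m + i) else 0)"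
    using summable_P_offset by simp
  then show 2: "summable (\<lambda>m. if i \<le> m then P m else 0)"
    by (subst (asm) summable_iff_shift[of "\<lambda>m. if i \<le> m then P m else 0" i])
  show "F i = (\<Sum>m. if i \<le> m then P m else 0)"
    unfolding suminf_split_initial_segment[OF 2, of i] by (simp add: F_def)
qed

lemma summable_F: "summable F"
proof (rule bounded_imp_summable)
  fix n
  have "(\<Sum>i\<le>n. F i) = (\<Sum>m. \<Sum>i\<le>n. if i \<le> m then P m else 0)"
    unfolding F_eq by (rule suminf_sum[symmetric]) (rule summable_P_if)
  also have "\<dots> \<le> (\<Sum>m. P m * real (Suc m))"
  proof (rule suminf_le)
    fix m
    have "(\<Sum>i\<le>n. if i \<le> m then P m else 0) = (\<Sum>i\<in>{i\<in>{..n}. i \<le> m}. P m)"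
      by (rule sum.inter_filter[symmetric]) simp
    also have "\<dots> \<le> (\<Sum>i\<le>m. P m)"
      using P_pos[of m] by (intro sum_mono2) auto
    finally show "(\<Sum>i\<le>n. if i \<le> m then P m else 0) \<le> P m * real (Suc m)"
      by (simp add: mult.commute)
  qed (auto intro: summable_sum summable_P_if simp: P_summable1 simp del: of_nat_Suc)
  finally show "(\<Sum>i\<le>n. F i) \<le> (\<Sum>m. P m * real (Suc m))" .
qed (rule F_nonneg)

text \<open>Decompose according to the last renewal not after time \<open>s\<close>.\<close>

lemma last_renewal: "x \<in> Omega_star \<Longrightarrow> 1 \<le> (\<Sum>i\<le>s. F i * u (s - i) x)"
proof (induction s arbitrary: x rule: less_induct)
  case (less s)
  have tail: "1 \<le> F t + (\<Sum>m<t. p m x)" for t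
  proof -
    have "1 = (\<Sum>m. p (m + t) x) + (\<Sum>m<t. p m x)"
      using suminf_split_initial_segment[of "\<lambda>m. p m x" t] p_sums[OF less.prems] by (simp add: sums_iff)
    moreover have "(\<Sum>m. p (m + t) x) \<le> F t"
      unfolding F_def using p_le[OF less.prems] p_sums[OF less.prems]
      by (intro suminf_le summable_P_offset) (auto simp: sums_iff summable_iff_shift[of "\<lambda>m. p m x"])
    ultimately show ?thesis
      by linarith
  qed
  show ?case
  proof (cases s)
    case 0
    then show ?thesis
      using tail[of 0] by simp
  next
    case (Suc t)
    \<comment> \<open>The recursion for \<open>u\<close> conditions on the first block. Exchanging
      the sums lets the induction hypothesis act on the time \<open>t - m\<close> that is left after
      it. The remaining term \<open>i = s\<close>, with no completed block, is \<open>F s\<close>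
      and supplies the tail.\<close>
    have "(\<Sum>i\<le>t. F i * u (s - i) x) = (\<Sum>i\<le>t. F i * u (Suc (t - i)) x)"
      using Suc by (intro sum.cong) (auto simp: Suc_diff_le)
    also have "\<dots> = (\<Sum>i\<le>t. \<Sum>m\<in>{m\<in>{..t}. i + m \<le> t}. F i * (p m x * u (t - i - m) (blk m x)))"
      by (auto simp: sum_distrib_left intro!: sum.cong)
    also have "\<dots> = (\<Sum>m\<le>t. \<Sum>i\<in>{i\<in>{..t}. i + m \<le> t}. F i * (p m x * u (t - i - m) (blk m x)))"
      by (rule sum.swap_restrict) auto
    also have "\<dots> = (\<Sum>m\<le>t. p m x * (\<Sum>i\<le>t - m. F i * u (t - m - i) (blk m x)))"
    proof (rule sum.cong[OF refl])
      fix m assume "m \<in> {..t}"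
      then have "{i \<in> {..t}. i + m \<le> t} = {..t - m}"
        by auto
      then show "(\<Sum>i\<in>{i\<in>{..t}. i + m \<le> t}. F i * (p m x * u (t - i - m) (blk m x)))
          = p m x * (\<Sum>i\<le>t - m. F i * u (t - m - i) (blk m x))"
        by (simp add: sum_distrib_left mult_ac add.commute[of m])
    qed
    also have "\<dots> \<ge> (\<Sum>m\<le>t. p m x * 1)"
      using less.IH[of "t - m" "blk m x" for m] less.prems Suc
      by (intro sum_mono mult_left_mono) (auto simp: less_imp_le[OF p_pos] simp del: diff_diff_left)
    finally have "(\<Sum>m\<le>t. p m x) \<le> (\<Sum>i\<le>t. F i * u (s - i) x)"
      by simp
    then show ?thesis
      using tail[of s] Suc by (simp add: lessThan_Suc_atMost)
  qed
qed

text \<open>Last renewals at distance \<open>K\<close> or more from \<open>s\<close> contribute at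
  most 1/2, as \<open>F\<close> is summable. Any more recent renewal can be carried to time
  \<open>s\<close> by fewer than \<open>K\<close> blocks of length one, at the cost of at most a
  factor \<open>c ^ K\<close>. Blocks of length one thus take the place of an aperiodicity
  argument.\<close>

lemma u_lower_bound:
  obtains \<delta> where "0 < \<delta>" "\<And>s x. x \<in> Omega_star \<Longrightarrow> \<delta> \<le> u s x"
proof -
  define c where "c = p 0 ones * exp (- C)"
  have c: "0 < c" "c \<le> 1"
    using p_pos[of ones 0] C_pos sum_p_le_1[of "{0}" ones] by (auto simp: c_def intro!: mult_le_one)
  obtain K where K: "(\<Sum>i. F (i + K)) < 1 / 2"
    using suminf_exist_split[OF _ summable_F, of "1/2"] F_nonneg
    by (auto simp: suminf_nonneg summable_iff_shift summable_F)
  have sF: "0 < suminf F"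
    using summable_F F_nonneg P_pos
    by (intro suminf_pos2[of _ 0]) (auto simp: F_def intro!: suminf_pos P_summable0)
  show thesis
  proof (rule that[of "c ^ K / (2 * suminf F)"])
    show "0 < c ^ K / (2 * suminf F)"
      using c sF by simp
    fix s x assume x: "x \<in> Omega_star"
    have "F i * u (s - i) x \<le> F i * (u s x / c ^ K) + (if K \<le> i then F i else 0)" if "i \<le> s" for i
    proof (cases "K \<le> i")
      case True
      then have "F i * u (s - i) x \<le> F i"
        using u_le_1[OF x] F_nonneg[of i] by (simp add: mult_left_le)
      moreover have "0 \<le> F i * (u s x / c ^ K)"
        using u_nonneg[OF x] F_nonneg c by simp
      ultimately show ?thesis
        using True by simp
    next
      case False
      have "c ^ K * u (s - i) x \<le> c ^ i * u (s - i) x"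
        using False c u_nonneg[OF x] by (intro mult_right_mono power_decreasing) auto
      also have "\<dots> \<le> u s x"
        using u_add_ge[OF x, of i "s - i"] that by (simp add: c_def)
      finally have "u (s - i) x \<le> u s x / c ^ K"
        using c by (simp add: pos_le_divide_eq mult.commute)
      then show ?thesis
        using False mult_left_mono[OF _ F_nonneg[of i], of "u (s - i) x" "u s x / c ^ K"] by simp
    qed
    then have "(\<Sum>i\<le>s. F i * u (s - i) x) \<le> (\<Sum>i\<le>s. F i * (u s x / c ^ K) + (if K \<le> i then F i else 0))"
      by (intro sum_mono) auto
    also have "\<dots> = (\<Sum>i\<le>s. F i) * (u s x / c ^ K) + (\<Sum>i\<le>s. if K \<le> i then F i else 0)"
      by (simp add: sum.distrib sum_distrib_right sum_divide_distrib)
    also have "(\<Sum>i\<le>s. F i) * (u s x / c ^ K) \<le> suminf F * (u s x / c ^ K)"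
      using u_nonneg[OF x] c F_nonneg by (intro mult_right_mono sum_le_suminf summable_F) auto
    also have "(\<Sum>i\<le>s. if K \<le> i then F i else 0) \<le> (\<Sum>i. F (i + K))"
    proof -
      have 2: "summable (\<lambda>i. if K \<le> i then F i else 0)"
        by (subst summable_iff_shift[of _ K, symmetric]) (simp add: summable_iff_shift summable_F)
      have "(\<Sum>i\<le>s. if K \<le> i then F i else 0) \<le> (\<Sum>i. if K \<le> i then F i else 0)"
        using F_nonneg by (intro sum_le_suminf 2) auto
      also have "\<dots> = (\<Sum>i. F (i + K))"
        unfolding suminf_split_initial_segment[OF 2, of K] by simp
      finally show ?thesis .
    qed
    finally have "1 \<le> suminf F * (u s x / c ^ K) + 1 / 2"
      using last_renewal[OF x, of s] K by linarith
    then show "c ^ K / (2 * suminf F) \<le> u s x"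
      using c sF by (simp add: field_simps)
  qed
qed

section \<open>Bounds for the chain operator and the total excess of the weights\<close>

lemma summable_p:
  assumes "x \<in> Omega_star"
  shows "summable (\<lambda>m. p m x)" "(\<Sum>m. p m x) = 1"
  using p_sums[OF assms] by (auto simp: sums_iff)

lemma chain_op_norm:
  assumes f: "\<And>y. cmod (f y) \<le> 1"
  shows "y \<in> Omega_star \<Longrightarrow> cmod (chain_op p f n k y) \<le> 1"
proof (induction n arbitrary: k y)
  case (Suc n)
  show ?case
  proof (cases k)
    case 0
    have "norm (p m y *\<^sub>R chain_op p f n m (conc [True] y)) \<le> p m y" for m
      using Suc.IH[of "conc [True] y" m] Suc.prems p_pos[OF Suc.prems, of m] Omega_star_conc[of "[True]" y]
      by (simp add: mult_left_le)
    from norm_suminf_le[OF this summable_p(1)[OF Suc.prems]] show ?thesis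
      using 0 summable_p(2)[OF Suc.prems] by simp
  next
    case (Suc k')
    then show ?thesis
      using Suc.IH[of "conc [False] y" k'] Suc.prems by (simp add: Omega_star_conc)
  qed
qed (simp add: f)

lemma summable_p_scaleR:
  fixes a :: "nat \<Rightarrow> complex"
  assumes "x \<in> Omega_star" "\<And>m. cmod (a m) \<le> 1" "\<And>m. 0 \<le> q m" "\<And>m. q m \<le> p m x"
  shows "summable (\<lambda>m. q m *\<^sub>R a m)"
proof (rule summable_comparison_test'[OF summable_p(1)[OF assms(1)], where N = 0])
  fix m
  show "norm (q m *\<^sub>R a m) \<le> p m x"
    using assms(2-4)[of m] mult_mono[of "q m" "p m x" "cmod (a m)" 1] p_pos[OF assms(1), of m] by simp
qed

text \<open>A bound for the mean of \<open>gw R \<gamma> - 1\<close> at the overshoot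
  \<open>m - j\<close> of a block that is begun \<open>j + 1\<close> steps before the target
  time.\<close>

definition gap_excess :: "real \<Rightarrow> nat \<Rightarrow> real" where
  "gap_excess R j = (\<Sum>m. P m * (if j \<le> m then gw R \<gamma> (m - j) - 1 else 0))"

lemma summable_gap_excess:
  assumes "1 \<le> R"
  shows "summable (\<lambda>m. P m * (if j \<le> m then gw R \<gamma> (m - j) - 1 else 0))"
proof (rule summable_dom[OF assms, where K = 1])
  fix m
  have "gw R \<gamma> (m - j) \<le> gw R \<gamma> (Suc m)"
    by (rule gw_mono[OF assms gamma]) simp
  then have "\<bar>if j \<le> m then gw R \<gamma> (m - j) - 1 else 0\<bar> \<le> 1 * (real (Suc m) * gw R \<gamma> (Suc m))"
    using gw_ge_1[OF assms gamma, of "m - j"] weight_ge_1[OF assms, of m]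
    unfolding abs_le_iff mult_1 by (cases "j \<le> m") (simp_all only: if_True if_False, linarith+)
  then show "norm (P m * (if j \<le> m then gw R \<gamma> (m - j) - 1 else 0)) \<le> P m * (1 * (real (Suc m) * gw R \<gamma> (Suc m)))"
    unfolding real_norm_def abs_mult using P_pos[of m] by (simp add: mult_left_mono del: of_nat_Suc)
qed

lemma gap_excess_nonneg: "1 \<le> R \<Longrightarrow> 0 \<le> gap_excess R j"
  unfolding gap_excess_def using P_pos gw_ge_1[of R \<gamma>] gamma
  by (intro suminf_nonneg summable_gap_excess) (auto simp: less_imp_le)

lemma summable_excess:
  assumes "1 \<le> R"
  shows "summable (\<lambda>m. P m * real (Suc m) * (gw R \<gamma> (Suc m) - 1))"
proof (rule summable_dom[OF assms, where K = 1])
  fix m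
  show "norm (P m * real (Suc m) * (gw R \<gamma> (Suc m) - 1)) \<le> P m * (1 * (real (Suc m) * gw R \<gamma> (Suc m)))"
    using P_pos[of m] gw_ge_1[OF assms gamma, of "Suc m"]
    by (auto simp: abs_mult less_imp_le[OF P_pos] mult.assoc simp del: of_nat_Suc intro!: mult_left_mono)
qed

text \<open>After exchanging the sums, the block with index \<open>m\<close> occurs for at most
  \<open>m + 1\<close> values of \<open>j\<close>, each time with an overshoot of at most
  \<open>m\<close>. The resulting factor \<open>real (Suc m)\<close> is the extra power of the block
  length in the moment condition.\<close>

lemma sum_gap_excess_le:
  assumes "1 \<le> R"
  shows "(\<Sum>j<s. gap_excess R j) \<le> (\<Sum>m. P m * real (Suc m) * (gw R \<gamma> (Suc m) - 1))"
proof -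
  have "(\<Sum>j<s. gap_excess R j) = (\<Sum>m. \<Sum>j<s. P m * (if j \<le> m then gw R \<gamma> (m - j) - 1 else 0))"
    unfolding gap_excess_def by (rule suminf_sum[symmetric]) (rule summable_gap_excess[OF assms])
  also have "\<dots> \<le> (\<Sum>m. P m * real (Suc m) * (gw R \<gamma> (Suc m) - 1))"
  proof (rule suminf_le)
    fix m
    have "(\<Sum>j<s. P m * (if j \<le> m then gw R \<gamma> (m - j) - 1 else 0))
        \<le> (\<Sum>j<s. if j \<le> m then P m * (gw R \<gamma> (Suc m) - 1) else 0)"
      using P_pos[of m] by (intro sum_mono) (auto intro!: mult_left_mono gw_mono[OF assms gamma])
    also have "\<dots> = (\<Sum>j\<in>{j\<in>{..<s}. j \<le> m}. P m * (gw R \<gamma> (Suc m) - 1))"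
      by (rule sum.inter_filter[symmetric]) simp
    also have "\<dots> \<le> (\<Sum>j\<le>m. P m * (gw R \<gamma> (Suc m) - 1))"
      using P_pos[of m] gw_ge_1[OF assms gamma, of "Suc m"] by (intro sum_mono2) auto
    finally show "(\<Sum>j<s. P m * (if j \<le> m then gw R \<gamma> (m - j) - 1 else 0))
        \<le> P m * real (Suc m) * (gw R \<gamma> (Suc m) - 1)"
      by (simp add: mult_ac)
  qed (auto intro: summable_sum summable_gap_excess[OF assms] summable_excess[OF assms] simp del: of_nat_Suc)
  finally show ?thesis .
qed

lemma excess_le:
  assumes "1 \<le> R"
  shows "summable (\<lambda>m. P m * (gw R \<gamma> (Suc m) - 1))"
    and "(\<Sum>m. P m * (gw R \<gamma> (Suc m) - 1)) \<le> (\<Sum>m. P m * real (Suc m) * (gw R \<gamma> (Suc m) - 1))"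
proof -
  show 1: "summable (\<lambda>m. P m * (gw R \<gamma> (Suc m) - 1))"
  proof (rule summable_dom[OF assms, where K = 1])
    fix m
    have "gw R \<gamma> (Suc m) - 1 \<le> 1 * (real (Suc m) * gw R \<gamma> (Suc m))"
      using weight_ge_1(2)[OF assms, of m] by linarith
    then show "norm (P m * (gw R \<gamma> (Suc m) - 1)) \<le> P m * (1 * (real (Suc m) * gw R \<gamma> (Suc m)))"
      using P_pos[of m] gw_ge_1[OF assms gamma, of "Suc m"]
      by (simp add: abs_mult mult_left_mono del: of_nat_Suc)
  qed
  show "(\<Sum>m. P m * (gw R \<gamma> (Suc m) - 1)) \<le> (\<Sum>m. P m * real (Suc m) * (gw R \<gamma> (Suc m) - 1))"
  proof (rule suminf_le[OF _ 1 summable_excess[OF assms]])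
    fix m
    have "P m * 1 \<le> P m * real (Suc m)"
      using P_pos[of m] by (intro mult_left_mono) auto
    then show "P m * (gw R \<gamma> (Suc m) - 1) \<le> P m * real (Suc m) * (gw R \<gamma> (Suc m) - 1)"
      using gw_ge_1[OF assms gamma, of "Suc m"] by (intro mult_right_mono) auto
  qed
qed

text \<open>Each copy is looked at from the moment when its pending zeros are used up. The
  difference of the two moments is the lag \<open>s\<close> of the hypothesis, and the later one
  determines the remaining time. If the time runs out before it, the trivial bound 2 is at most
  \<open>K\<close>.\<close>

lemma general_pair:
  assumes R: "1 \<le> R" and f: "\<And>y. cmod (f y) \<le> 1" and K: "2 \<le> K"
    and IH: "\<And>r s x y. r \<le> n \<Longrightarrow> x \<in> Omega_star \<Longrightarrow> y \<in> Omega_star \<Longrightarrow>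
      cmod (N f (r + s) x - N f r y) \<le> K * wt R \<gamma> r"
    and xy: "x \<in> Omega_star" "y \<in> Omega_star"
  shows "cmod (chain_op p f n k x - chain_op p f n l y) \<le> K * wt R \<gamma> (n - max k l)"
proof (cases "max k l \<le> n")
  case True
  have *: "cmod (chain_op p f n k x - chain_op p f n l y) \<le> K * wt R \<gamma> (n - l)"
    if "k \<le> l" "l \<le> n" "x \<in> Omega_star" "y \<in> Omega_star" for k l x y
    using IH[of "n - l" "zeros k x" "zeros l y" "l - k"] that
    by (simp add: chain_op_eq[of p f n k] chain_op_eq[of p f n l])
  show ?thesis
    using *[of k l x y] *[of l k y x] True xy by (auto simp: max_def norm_minus_commute)
next
  case False
  have "cmod (chain_op p f n k x - chain_op p f n l y) \<le> 1 + 1"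
    using chain_op_norm[OF f xy(1)] chain_op_norm[OF f xy(2)]
    by (intro order_trans[OF norm_triangle_ineq4] add_mono) auto
  moreover have "n - max k l = 0"
    using False by (simp only: diff_is_0_eq not_le less_imp_le)
  ultimately show ?thesis
    using K wt_0[OF R gamma] by simp
qed

text \<open>Both copies are at a renewal, with \<open>j\<close> equal blocks and \<open>l\<close>
  equal coordinates behind them. The next block is chosen by the maximal coupling. On the common
  part \<open>q\<close> the copies stay aligned, and the inner induction applies with
  \<open>Suc j\<close> and \<open>Suc m + l\<close>. On the remainder, of mass at most
  \<open>1 - exp (- C * \<theta> ^ j)\<close>, the blocks are chosen independently and
  \<open>IH\<close> charges the full \<open>K\<close>. The \<open>H\<close> term stands for never
  separating: the final sequences then share \<open>n + l\<close> coordinates.\<close>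

lemma aligned:
  assumes R: "1 \<le> R" and f: "\<And>y. cmod (f y) \<le> 1" and K: "2 \<le> K" and H: "0 \<le> H"
    and fH: "\<And>x y L. (\<And>i. i < L \<Longrightarrow> x i = y i) \<Longrightarrow> cmod (f x - f y) \<le> H * (1 + real L) powr (- \<gamma>)"
    and \<beta>: "\<And>j. 0 \<le> \<beta> j" "\<And>j. \<beta> j \<le> 1"
      "\<And>j. \<beta> (Suc j) * (exp (- C * \<theta> ^ j) + \<eta>) + (1 - exp (- C * \<theta> ^ j))
        + 2 * (1 - exp (- C * \<theta> ^ j)) * \<eta> \<le> \<beta> j"
    and \<eta>: "(\<Sum>m. P m * real (Suc m) * (gw R \<gamma> (Suc m) - 1)) \<le> \<eta>"
    and IH: "\<And>r s x y. r < n \<Longrightarrow> x \<in> Omega_star \<Longrightarrow> y \<in> Omega_star \<Longrightarrow>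
      cmod (N f (r + s) x - N f r y) \<le> K * wt R \<gamma> r"
    and xy: "x \<in> Omega_star" "y \<in> Omega_star" "agree j x y" "\<And>i. i < l \<Longrightarrow> x i = y i"
  shows "cmod (N f n x - N f n y) \<le> \<beta> j * K * wt R \<gamma> n + H * wt R \<gamma> (n + l)"
  using IH xy
proof (induction n arbitrary: j l x y rule: less_induct)
  case (less n)
  note xy = less.prems(2-5)
  have fw: "cmod (f a - f b) \<le> H * wt R \<gamma> L" if "\<And>i. i < L \<Longrightarrow> a i = b i" for a b L
    using fH[OF that] powr_le_wt[OF R gamma, of L] H by (meson mult_left_mono order_trans)
  show ?case
  proof (cases n)
    case 0
    have "0 \<le> \<beta> j * K * wt R \<gamma> n"
      using \<beta> K wt_pos[OF R gamma, of n] by simp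
    then show ?thesis
      using fw[of l x y] xy(4) 0 by simp
  next
    case (Suc n')
    define c where "c = 1 - exp (- C * \<theta> ^ j)"
    have c: "0 \<le> c" "c \<le> 1"
      using C_pos theta by (auto simp: c_def)
    define W where "W = wt R \<gamma> n"
    define E where "E = wt R \<gamma> (n + l)"
    have W: "0 < W" and E: "0 < E"
      by (simp_all add: W_def E_def wt_pos[OF R gamma])
    define G where "G = (\<lambda>m. gw R \<gamma> (Suc m))"
    have G: "1 \<le> G m" for m
      by (simp add: G_def gw_ge_1[OF R gamma])
    define q where "q = (\<lambda>m. min (p m x) (p m y))"
    define r where "r = (\<lambda>m. p m x - q m)"
    define s where "s = (\<lambda>m. p m y - q m)"
    define a where "a = (\<lambda>m. chain_op p f n' m (conc [True] x))"
    define b where "b = (\<lambda>m. chain_op p f n' m (conc [True] y))"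
    have ab1: "cmod (a m) \<le> 1" "cmod (b m) \<le> 1" for m
      using chain_op_norm[OF f] xy by (auto simp: a_def b_def Omega_star_conc)
    have yx: "agree j y x"
      using xy(3) by (auto simp: agree_def)
    have q: "0 \<le> q m" "q m \<le> p m x" "q m \<le> p m y" "(1 - c) * p m x \<le> q m" "(1 - c) * p m y \<le> q m" for m
      using p_pos[OF xy(1), of m] p_pos[OF xy(2), of m] p_dist[OF xy(1-3), of m] p_dist[OF xy(2,1) yx, of m] c
      by (auto simp: q_def c_def min_def mult.commute intro: mult_right_le_one_le[OF less_imp_le] dest: less_imp_le)
    have rs: "0 \<le> r m" "0 \<le> s m" "r m \<le> c * P m" "s m \<le> c * P m" for m
      using q[of m] mult_left_mono[OF p_le[OF xy(1), of m] c(1)] mult_left_mono[OF p_le[OF xy(2), of m] c(1)]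
      by (auto simp: r_def s_def algebra_simps)
    have sq: "summable q"
      using q(1,2) summable_p(1)[OF xy(1)]
      by (intro summable_comparison_test'[where N = 0 and f = q]) auto
    define e where "e = 1 - suminf q"
    have rsum: "r sums e" and ssum: "s sums e"
      using sq p_sums[OF xy(1)] p_sums[OF xy(2)]
      unfolding r_def s_def e_def by (auto intro!: sums_diff summable_sums)
    have qsum: "q sums (1 - e)"
      using sq by (simp add: e_def summable_sums)
    have e: "0 \<le> e" "e \<le> c"
    proof -
      show "0 \<le> e"
        using rsum rs(1) suminf_nonneg[of r] by (auto simp: sums_iff)
      have 1: "(\<lambda>m. c * p m x) sums (c * 1)"
        by (intro sums_mult p_sums[OF xy(1)])
      have "r m \<le> c * p m x" for m
        using q(4)[of m] by (simp add: r_def algebra_simps)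
      from sums_le[OF this rsum 1] show "e \<le> c"
        by simp
    qed
    have sex: "summable (\<lambda>m. P m * (G m - 1))" "(\<Sum>m. P m * (G m - 1)) \<le> \<eta>"
      using excess_le[OF R] \<eta> by (auto simp: G_def simp del: of_nat_Suc)
    have excess: "summable (\<lambda>m. t m * (G m - 1))" "(\<Sum>m. t m * (G m - 1)) \<le> d * \<eta>"
      if t: "\<And>m. 0 \<le> t m" "\<And>m. t m \<le> d * P m" and d: "0 \<le> d" for t d
    proof -
      have le: "t m * (G m - 1) \<le> d * (P m * (G m - 1))" for m
        using mult_right_mono[OF t(2)[of m], of "G m - 1"] G[of m] by (simp add: mult_ac)
      show 1: "summable (\<lambda>m. t m * (G m - 1))"
        using le G t(1) by (intro summable_comparison_test'[OF summable_mult[OF sex(1), of d], where N = 0]) simp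
      have "(\<Sum>m. t m * (G m - 1)) \<le> (\<Sum>m. d * (P m * (G m - 1)))"
        by (rule suminf_le[OF le 1 summable_mult[OF sex(1)]])
      also have "\<dots> = d * (\<Sum>m. P m * (G m - 1))"
        by (rule suminf_mult[OF sex(1)])
      also have "\<dots> \<le> d * \<eta>"
        using sex(2) d by (rule mult_left_mono)
      finally show "(\<Sum>m. t m * (G m - 1)) \<le> d * \<eta>" .
    qed
    note er = excess[OF rs(1) rs(3) c(1)] and es = excess[OF rs(2) rs(4) c(1)]
    have eq: "summable (\<lambda>m. q m * (G m - 1))" "(\<Sum>m. q m * (G m - 1)) \<le> \<eta>"
      using excess[of q 1] q(1) order_trans[OF q(2) p_le[OF xy(1)]] by simp_all

    have abm: "cmod (a m - b m) \<le> \<beta> (Suc j) * K * (W * G m) + H * E" for m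
    proof (cases "m \<le> n'")
      case True
      have "cmod (N f (n' - m) (blk m x) - N f (n' - m) (blk m y))
          \<le> \<beta> (Suc j) * K * wt R \<gamma> (n' - m) + H * wt R \<gamma> (n' - m + (Suc m + l))"
      proof (rule less.IH)
        show "blk m x i = blk m y i" if "i < Suc m + l" for i
          using xy(4)[of "i - Suc m"] that by (auto simp: blk_nth)
      qed (use Suc xy in \<open>auto simp: agree_blk intro: less.prems(1)\<close>)
      then have "cmod (a m - b m) \<le> \<beta> (Suc j) * K * wt R \<gamma> (n' - m) + H * wt R \<gamma> (n' - m + (Suc m + l))"
        using True by (simp only: a_def b_def chain_op_eq[of p f n' m] blk_zeros[symmetric] if_True)
      also have "n' - m + (Suc m + l) = n + l"
        using True Suc by simp
      also have "\<beta> (Suc j) * K * wt R \<gamma> (n' - m) \<le> \<beta> (Suc j) * K * (W * G m)"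
        using wt_diff[OF R gamma, of n "Suc m"] Suc \<beta>(1) K
        by (intro mult_left_mono) (auto simp: W_def G_def mult.commute)
      finally show ?thesis
        by (simp add: E_def)
    next
      case False
      \<comment> \<open>The block outlasts the remaining time: the same zeros are put in front of
        the same \<open>1\<close>, so the arguments of \<open>f\<close> share \<open>n + l\<close>
        coordinates.\<close>
      have "cmod (a m - b m) \<le> H * wt R \<gamma> (n + l)"
        unfolding a_def b_def chain_op_eq[of p f n' m] using False Suc xy(4)
        by (auto simp: blk_zeros[symmetric] blk_nth intro!: fw)
      moreover have "0 \<le> \<beta> (Suc j) * K * (W * G m)"
        using \<beta>(1)[of "Suc j"] K W G[of m] by simp
      ultimately show ?thesis
        by (simp add: E_def)
    qed
    \<comment> \<open>By \<open>gw_max\<close> the cost of the later of the two renewals splits into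
      a function of \<open>m\<close> and one of \<open>k\<close>. The \<open>- 1\<close> goes to
      \<open>b\<close>, so the unmatched mass is charged once and not twice.\<close>
    have abmn: "cmod (a m - b k) \<le> K * W * G m + K * W * (G k - 1)" for m k
    proof -
      have "cmod (a m - b k) \<le> K * wt R \<gamma> (n' - max m k)"
        unfolding a_def b_def using xy less.prems(1) Suc
        by (intro general_pair[OF R f K]) (auto simp: Omega_star_conc)
      also have "\<dots> \<le> K * (gw R \<gamma> (Suc (max m k)) * W)"
        using wt_diff[OF R gamma, of n "Suc (max m k)"] Suc K by (simp add: W_def)
      also have "\<dots> \<le> K * ((G m + G k - 1) * W)"
        using gw_max[OF R gamma, of "Suc m" "Suc k"] K W
        by (intro mult_left_mono mult_right_mono) (auto simp: G_def)
      finally show ?thesis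
        by (simp add: algebra_simps)
    qed

    have qab: "cmod (\<Sum>m. q m *\<^sub>R (a m - b m)) \<le> \<beta> (Suc j) * K * W * (1 - e + \<eta>) + H * E * (1 - e)"
    proof -
      have s1: "(\<lambda>m. \<beta> (Suc j) * K * W * (q m * (G m - 1)) + (\<beta> (Suc j) * K * W + H * E) * q m) sums
          (\<beta> (Suc j) * K * W * (\<Sum>m. q m * (G m - 1)) + (\<beta> (Suc j) * K * W + H * E) * (1 - e))"
        using eq(1) qsum by (intro sums_add sums_mult summable_sums)
      have "norm (q m *\<^sub>R (a m - b m)) \<le>
          \<beta> (Suc j) * K * W * (q m * (G m - 1)) + (\<beta> (Suc j) * K * W + H * E) * q m" for m
      proof -
        have "norm (q m *\<^sub>R (a m - b m)) \<le> q m * (\<beta> (Suc j) * K * (W * G m) + H * E)"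
          using mult_left_mono[OF abm[of m] q(1)[of m]] q(1)[of m] by simp
        then show ?thesis
          by (simp add: algebra_simps)
      qed
      from norm_suminf_le[OF this sums_summable[OF s1]] have
        "cmod (\<Sum>m. q m *\<^sub>R (a m - b m)) \<le>
           \<beta> (Suc j) * K * W * (\<Sum>m. q m * (G m - 1)) + (\<beta> (Suc j) * K * W + H * E) * (1 - e)"
        by (simp only: sums_unique[OF s1, symmetric])
      moreover have "\<beta> (Suc j) * K * W * (\<Sum>m. q m * (G m - 1)) \<le> \<beta> (Suc j) * K * W * \<eta>"
        using eq(2) \<beta>(1) K W by (intro mult_left_mono) auto
      ultimately show ?thesis
        by (simp add: algebra_simps)
    qed
    have sr: "(\<lambda>m. r m * (K * W * G m)) sums (K * W * (\<Sum>m. r m * (G m - 1)) + K * W * e)"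
      using sums_add[OF sums_mult[OF summable_sums[OF er(1)], of "K * W"] sums_mult[OF rsum, of "K * W"]]
      by (simp add: algebra_simps)
    have ss: "(\<lambda>m. s m * (K * W * (G m - 1))) sums (K * W * (\<Sum>m. s m * (G m - 1)))"
      using sums_mult[OF summable_sums[OF es(1)], of "K * W"] by (simp add: mult_ac)
    have sra: "summable (\<lambda>m. r m *\<^sub>R a m)" "summable (\<lambda>m. s m *\<^sub>R b m)"
      "summable (\<lambda>m. q m *\<^sub>R a m)" "summable (\<lambda>m. q m *\<^sub>R b m)"
      using summable_p_scaleR[OF xy(1), of a r] summable_p_scaleR[OF xy(2), of b s]
        summable_p_scaleR[OF xy(1), of a q] summable_p_scaleR[OF xy(2), of b q] ab1 rs q
      by (auto simp: r_def s_def)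
    have rsab: "cmod ((\<Sum>m. r m *\<^sub>R a m) - (\<Sum>m. s m *\<^sub>R b m)) \<le> K * W * (e + 2 * c * \<eta>)"
    proof -
      have "cmod ((\<Sum>m. r m *\<^sub>R a m) - (\<Sum>m. s m *\<^sub>R b m))
          \<le> (\<Sum>m. r m * (K * W * G m)) + (\<Sum>m. s m * (K * W * (G m - 1)))"
        using sr ss rsum ssum rs abmn sra by (intro coupling_difference[where e = e]) (auto simp: sums_iff)
      also have "\<dots> = K * W * (e + (\<Sum>m. r m * (G m - 1)) + (\<Sum>m. s m * (G m - 1)))"
        using sr ss by (simp add: sums_iff algebra_simps)
      also have "\<dots> \<le> K * W * (e + 2 * c * \<eta>)"
        using er(2) es(2) K W by (intro mult_left_mono) auto
      finally show ?thesis .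
    qed
    have "N f n x - N f n y = (\<Sum>m. p m x *\<^sub>R a m) - (\<Sum>m. p m y *\<^sub>R b m)"
      by (simp add: Suc a_def b_def)
    also have "(\<Sum>m. p m x *\<^sub>R a m) = (\<Sum>m. r m *\<^sub>R a m) + (\<Sum>m. q m *\<^sub>R a m)"
      using sra by (simp add: suminf_add r_def scaleR_left_distrib[symmetric])
    also have "(\<Sum>m. p m y *\<^sub>R b m) = (\<Sum>m. s m *\<^sub>R b m) + (\<Sum>m. q m *\<^sub>R b m)"
      using sra by (simp add: suminf_add s_def scaleR_left_distrib[symmetric])
    also have "(\<Sum>m. r m *\<^sub>R a m) + (\<Sum>m. q m *\<^sub>R a m) - ((\<Sum>m. s m *\<^sub>R b m) + (\<Sum>m. q m *\<^sub>R b m))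
        = (\<Sum>m. q m *\<^sub>R (a m - b m)) + ((\<Sum>m. r m *\<^sub>R a m) - (\<Sum>m. s m *\<^sub>R b m))"
      using suminf_diff[OF sra(3,4)] by (simp add: scaleR_diff_right)
    also have "cmod \<dots> \<le> (\<beta> (Suc j) * K * W * (1 - e + \<eta>) + H * E * (1 - e)) + K * W * (e + 2 * c * \<eta>)"
      by (intro norm_triangle_mono qab rsab)
    also have "\<dots> \<le> K * W * (\<beta> (Suc j) * (1 - c + \<eta>) + c + 2 * c * \<eta>) + H * E"
    proof -
      \<comment> \<open>The true unmatched mass \<open>e\<close> may be replaced by its bound
        \<open>c\<close>: as \<open>\<beta> (Suc j) \<le> 1\<close>, moving mass from the matched to
        the unmatched part only increases the estimate.\<close>
      have "\<beta> (Suc j) * (1 - e + \<eta>) + e \<le> \<beta> (Suc j) * (1 - c + \<eta>) + c"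
        using mult_right_mono[OF \<beta>(2)[of "Suc j"], of "c - e"] e by (simp add: algebra_simps)
      then have "K * W * (\<beta> (Suc j) * (1 - e + \<eta>) + e + 2 * c * \<eta>)
          \<le> K * W * (\<beta> (Suc j) * (1 - c + \<eta>) + c + 2 * c * \<eta>)"
        using K W by (intro mult_left_mono) auto
      moreover have "H * E * (1 - e) \<le> H * E"
        using H E e by (simp add: mult_left_le)
      ultimately show ?thesis
        by (simp add: algebra_simps)
    qed
    also have "K * W * (\<beta> (Suc j) * (1 - c + \<eta>) + c + 2 * c * \<eta>) \<le> K * W * \<beta> j"
      using \<beta>(3)[of j] K W by (intro mult_left_mono) (auto simp: c_def)
    finally show ?thesis
      by (simp add: W_def E_def mult_ac)
  qed
qed

text \<open>The copy started in \<open>x\<close> runs alone for \<open>s\<close> steps. With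
  probability \<open>u s x\<close> it is then at a renewal, and \<open>al\<close> saves the amount
  \<open>(1 - b) * K\<close>. Otherwise a block overshoots by some \<open>m - t\<close>; the roles
  are exchanged, and \<open>IH\<close> at the smaller time \<open>r - (m - t)\<close> costs the
  factor \<open>gw R \<gamma> (m - t)\<close>. Induction over the first block collects these costs
  as the sum of the \<open>gap_excess R j\<close>.\<close>

lemma misaligned:
  assumes R: "1 \<le> R" and f: "\<And>y. cmod (f y) \<le> 1" and K: "2 \<le> K"
    and H0: "0 \<le> H" and b: "b \<le> 1"
    and IH: "\<And>r' s x y. r' < r \<Longrightarrow> x \<in> Omega_star \<Longrightarrow> y \<in> Omega_star \<Longrightarrow>
      cmod (N f (r' + s) x - N f r' y) \<le> K * wt R \<gamma> r'"
    and al: "\<And>x y. x \<in> Omega_star \<Longrightarrow> y \<in> Omega_star \<Longrightarrow>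
      cmod (N f r x - N f r y) \<le> (H + b * K) * wt R \<gamma> r"
  shows "x \<in> Omega_star \<Longrightarrow> y \<in> Omega_star \<Longrightarrow> cmod (N f (r + s) x - N f r y)
    \<le> wt R \<gamma> r * (H + K * (1 - (1 - b) * u s x + (\<Sum>j<s. gap_excess R j)))"
proof (induction s arbitrary: x y rule: less_induct)
  case (less s)
  show ?case
  proof (cases s)
    case 0
    then show ?thesis
      using al[OF less.prems] by (simp add: algebra_simps)
  next
    case (Suc t)
    define w where "w = wt R \<gamma> r"
    have w: "0 < w"
      by (simp add: w_def wt_pos[OF R gamma])
    define A where "A = H + K * (1 + (\<Sum>j<t. gap_excess R j))"
    define a where "a = (\<lambda>m. chain_op p f (r + t) m (conc [True] x))"
    define v where "v = (\<lambda>m. if m \<le> t then u (t - m) (blk m x) else 0)"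
    define g where "g = (\<lambda>m. if t \<le> m then gw R \<gamma> (m - t) - 1 else 0)"
    have g0: "0 \<le> g m" for m
      using gw_ge_1[OF R gamma] by (simp add: g_def)
    have a1: "cmod (a m) \<le> 1" for m
      using chain_op_norm[OF f] less.prems by (auto simp: a_def Omega_star_conc)
    have bound: "cmod (a m - N f r y) \<le> w * (A - K * (1 - b) * v m + K * g m)" for m
    proof (cases "m \<le> t")
      case True
      have "a m = N f (r + (t - m)) (blk m x)"
        using True by (simp add: a_def chain_op_eq[of p f "r + t" m] blk_zeros[symmetric])
      then have "cmod (a m - N f r y)
          \<le> w * (H + K * (1 - (1 - b) * u (t - m) (blk m x) + (\<Sum>j<t - m. gap_excess R j)))"
        using less.IH[of "t - m" "blk m x" y] less.prems Suc by (simp add: w_def)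
      also have "\<dots> \<le> w * (A - K * (1 - b) * v m + K * g m)"
      proof (rule mult_left_mono)
        have "(\<Sum>j<t - m. gap_excess R j) \<le> (\<Sum>j<t. gap_excess R j)"
          by (intro sum_mono2) (auto simp: gap_excess_nonneg[OF R])
        then have "K * (\<Sum>j<t - m. gap_excess R j) \<le> K * (\<Sum>j<t. gap_excess R j)"
          using K by (intro mult_left_mono) auto
        moreover have "0 \<le> K * g m"
          using K g0 by simp
        ultimately show "H + K * (1 - (1 - b) * u (t - m) (blk m x) + (\<Sum>j<t - m. gap_excess R j))
            \<le> A - K * (1 - b) * v m + K * g m"
          using True by (simp add: A_def v_def algebra_simps)
      qed (use w in simp)
      finally show ?thesis .
    next
      case False
      have "cmod (a m - N f r y) \<le> K * wt R \<gamma> (r - (m - t))"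
      proof (cases "m \<le> r + t")
        case True
        then have "a m = N f (r - (m - t)) (blk m x)"
          using False by (simp add: a_def chain_op_eq[of p f "r + t" m] blk_zeros[symmetric])
        then show ?thesis
          using IH[of "r - (m - t)" y "blk m x" "m - t"] True False less.prems
          by (simp add: norm_minus_commute)
      next
        case F: False
        have "cmod (a m - N f r y) \<le> 1 + 1"
          using a1[of m] chain_op_norm[OF f less.prems(2)]
          by (intro order_trans[OF norm_triangle_ineq4] add_mono) auto
        then show ?thesis
          using F K wt_0[OF R gamma] by simp
      qed
      also have "\<dots> \<le> K * (gw R \<gamma> (m - t) * w)"
        using wt_diff[OF R gamma, of r "m - t"] K by (simp add: w_def)
      also have "\<dots> \<le> w * (A - K * (1 - b) * v m + K * g m)"
      proof -
        have "0 \<le> K * (\<Sum>j<t. gap_excess R j)"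
          using K by (intro mult_nonneg_nonneg sum_nonneg) (auto simp: gap_excess_nonneg[OF R])
        then have "w * (K * gw R \<gamma> (m - t)) \<le> w * (A - K * (1 - b) * v m + K * g m)"
          using False w H0 by (intro mult_left_mono) (auto simp: A_def v_def g_def algebra_simps)
        then show ?thesis
          by (simp add: mult_ac)
      qed
      finally show ?thesis .
    qed
    have sg: "summable (\<lambda>m. P m * g m)" and ge: "gap_excess R t = (\<Sum>m. P m * g m)"
      using summable_gap_excess[OF R, of t] by (simp_all add: g_def gap_excess_def)
    have pg: "summable (\<lambda>m. p m x * g m)"
      using p_le[OF less.prems(1)] p_pos[OF less.prems(1)] g0
      by (intro summable_comparison_test'[OF sg, where N = 0]) (auto intro!: mult_right_mono simp: less_imp_le)
    have pge: "(\<Sum>m. p m x * g m) \<le> gap_excess R t"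
      unfolding ge using p_le[OF less.prems(1)] g0 by (intro suminf_le pg sg mult_right_mono) auto
    have pv: "(\<lambda>m. p m x * v m) sums u s x"
    proof -
      have "(\<lambda>m. p m x * v m) sums (\<Sum>m\<le>t. p m x * v m)"
        by (rule sums_finite) (auto simp: v_def)
      also have "(\<Sum>m\<le>t. p m x * v m) = u s x"
        by (simp add: Suc v_def)
      finally show ?thesis .
    qed
    have s1: "(\<lambda>m. w * (A * p m x - K * (1 - b) * (p m x * v m) + K * (p m x * g m))) sums
       (w * (A * 1 - K * (1 - b) * u s x + K * (\<Sum>m. p m x * g m)))"
      using pg by (intro sums_mult sums_add sums_diff p_sums less.prems pv summable_sums)
    have sa: "summable (\<lambda>m. p m x *\<^sub>R a m)"
      using summable_p_scaleR[OF less.prems(1), of a "\<lambda>m. p m x"] a1 p_pos[OF less.prems(1)]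
      by (simp add: less_imp_le)
    have s2: "(\<lambda>m. p m x *\<^sub>R a m - p m x *\<^sub>R N f r y) sums (N f (r + s) x - 1 *\<^sub>R N f r y)"
      using summable_sums[OF sa] Suc
      by (intro sums_diff sums_scaleR_left p_sums less.prems) (simp add: a_def)
    have "norm (p m x *\<^sub>R a m - p m x *\<^sub>R N f r y)
        \<le> w * (A * p m x - K * (1 - b) * (p m x * v m) + K * (p m x * g m))" for m
    proof -
      have "norm (p m x *\<^sub>R a m - p m x *\<^sub>R N f r y) = p m x * cmod (a m - N f r y)"
        using p_pos[OF less.prems(1), of m] by (simp flip: scaleR_diff_right)
      also have "\<dots> \<le> p m x * (w * (A - K * (1 - b) * v m + K * g m))"
        using bound p_pos[OF less.prems(1), of m] by (intro mult_left_mono) auto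
      finally show ?thesis
        by (simp add: algebra_simps)
    qed
    from norm_sums_le[OF s2 s1 this] have "cmod (N f (r + s) x - N f r y)
        \<le> w * (A * 1 - K * (1 - b) * u s x + K * (\<Sum>m. p m x * g m))"
      by simp
    also have "\<dots> \<le> w * (A * 1 - K * (1 - b) * u s x + K * gap_excess R t)"
      using pge w K by (intro mult_left_mono add_left_mono) auto
    finally show ?thesis
      using Suc by (simp add: A_def w_def algebra_simps)
  qed
qed

text \<open>One attempt to couple gains at least
  \<open>\<kappa> = (1 - \<beta> 0) * \<delta>\<close>, a number fixed by the chain.
  \<open>R\<close> keeps the excess of the weights below \<open>\<kappa> / 2\<close>, and
  \<open>K\<close> satisfies \<open>H \<le> K * (\<kappa> / 2)\<close>. Then
  \<open>H + K * (1 - \<kappa> / 2) \<le> K\<close>, which closes the induction over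
  \<open>r\<close>. \<open>K\<close> and \<open>R\<close> are the same for all \<open>f\<close> in
  the class.\<close>

theorem coupling_bound:
  assumes H: "0 \<le> H"
  obtains K R where "2 \<le> K" "1 \<le> R"
    "\<And>f r s x y. \<lbrakk>unit_holder H \<gamma> f; x \<in> Omega_star; y \<in> Omega_star\<rbrakk>
      \<Longrightarrow> cmod (N f (r + s) x - N f r y) \<le> K * wt R \<gamma> r"
proof -
  obtain \<beta> \<eta>0 where \<beta>: "0 < \<eta>0" "\<And>j. 0 \<le> \<beta> j" "\<And>j. \<beta> j \<le> 1" "\<beta> 0 < 1"
    "\<And>j. \<beta> (Suc j) * (1 - (1 - exp (- C * \<theta> ^ j)) + \<eta>0) + (1 - exp (- C * \<theta> ^ j))
      + 2 * (1 - exp (- C * \<theta> ^ j)) * \<eta>0 \<le> \<beta> j"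
    by (rule contraction_profile[OF theta C_pos]) (rule that; assumption)
  have \<beta>5: "\<beta> (Suc j) * (exp (- C * \<theta> ^ j) + \<eta>0) + (1 - exp (- C * \<theta> ^ j))
      + 2 * (1 - exp (- C * \<theta> ^ j)) * \<eta>0 \<le> \<beta> j" for j
    using \<beta>(5)[of j] by simp
  obtain \<delta> where \<delta>: "0 < \<delta>" "\<And>s x. x \<in> Omega_star \<Longrightarrow> \<delta> \<le> u s x"
    using u_lower_bound by blast
  define \<kappa> where "\<kappa> = (1 - \<beta> 0) * \<delta>"
  have \<kappa>: "0 < \<kappa>"
    using \<beta>(4) \<delta>(1) by (simp add: \<kappa>_def)
  obtain R where R: "1 \<le> R" "(\<Sum>m. P m * real (Suc m) * (gw R \<gamma> (Suc m) - 1)) \<le> min \<eta>0 (\<kappa> / 2)"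
    using weight_small[of "min \<eta>0 (\<kappa> / 2)"] \<beta>(1) \<kappa> by auto
  define K where "K = max 2 (2 * H / \<kappa>)"
  have K: "2 \<le> K" "H \<le> K * (\<kappa> / 2)"
    using \<kappa> by (auto simp: K_def field_simps max_def)
  have main: "cmod (N f (r + s) x - N f r y) \<le> K * wt R \<gamma> r"
    if f: "\<And>y. cmod (f y) \<le> 1"
    and fH: "\<And>x y L. (\<And>i. i < L \<Longrightarrow> x i = y i) \<Longrightarrow> cmod (f x - f y) \<le> H * (1 + real L) powr (- \<gamma>)"
    and xy: "x \<in> Omega_star" "y \<in> Omega_star" for f r s x y
    using xy
  proof (induction r arbitrary: s x y rule: less_induct)
    case (less r)
    have al: "cmod (N f r x - N f r y) \<le> (H + \<beta> 0 * K) * wt R \<gamma> r"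
      if "x \<in> Omega_star" "y \<in> Omega_star" for x y
    proof -
      have "cmod (N f r x - N f r y) \<le> \<beta> 0 * K * wt R \<gamma> r + H * wt R \<gamma> (r + 0)"
      proof (rule aligned[OF R(1) _ K(1) H _ \<beta>(2,3) \<beta>5])
        show "(\<Sum>m. P m * real (Suc m) * (gw R \<gamma> (Suc m) - 1)) \<le> \<eta>0"
          using R(2) by simp
        show "cmod (f y) \<le> 1" for y
          by (rule f)
        show "cmod (f x - f y) \<le> H * (1 + real L) powr (- \<gamma>)" if "\<And>i. i < L \<Longrightarrow> x i = y i" for x y L
          using that by (rule fH)
      qed (use less.IH that in auto)
      then show ?thesis
        by (simp add: algebra_simps)
    qed
    have "cmod (N f (r + s) x - N f r y)
        \<le> wt R \<gamma> r * (H + K * (1 - (1 - \<beta> 0) * u s x + (\<Sum>j<s. gap_excess R j)))"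
      using less.prems less.IH \<beta>(3) by (intro misaligned[OF R(1) f K(1) H _ _ al])
    also have "\<dots> \<le> wt R \<gamma> r * K"
    proof (rule mult_left_mono)
      have "\<kappa> \<le> (1 - \<beta> 0) * u s x"
        unfolding \<kappa>_def using \<beta>(4) \<delta>(2)[OF less.prems(1)] by (intro mult_left_mono) auto
      moreover have "(\<Sum>j<s. gap_excess R j) \<le> \<kappa> / 2"
        using sum_gap_excess_le[OF R(1), of s] R(2) by simp
      ultimately have "K * (1 - (1 - \<beta> 0) * u s x + (\<Sum>j<s. gap_excess R j)) \<le> K * (1 - \<kappa> / 2)"
        using K(1) by (intro mult_left_mono) auto
      then show "H + K * (1 - (1 - \<beta> 0) * u s x + (\<Sum>j<s. gap_excess R j)) \<le> K"
        using K(2) by (simp add: algebra_simps)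
    qed (simp add: less_imp_le[OF wt_pos[OF R(1) gamma]])
    finally show ?case
      by (simp add: mult.commute)
  qed
  show thesis
    by (rule that[OF K(1) R(1) main]) (auto simp: unit_holder_def)
qed

end

section \<open>Bounded continuous functions on \<open>\<Omega>\<^sub>*\<close>\<close>

lemma continuous_on_conc: "continuous_on A (conc w :: seq \<Rightarrow> seq)"
proof (rule continuous_on_coordinatewise_then_product)
  fix i
  have "continuous_on A (\<lambda>x::seq. x (i - length w))"
    by (rule continuous_on_subset[OF continuous_on_product_coordinates]) simp
  then show "continuous_on A (\<lambda>x. conc w x i)"
    by (cases "i < length w") (simp_all add: conc_def)
qed

lemma continuous_on_blk: "continuous_on A (blk m)"
  unfolding blk_def by (rule continuous_on_conc)

lemma continuous_on_suffix: "continuous_on A (suffix k :: seq \<Rightarrow> seq)"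
proof (rule continuous_on_coordinatewise_then_product)
  fix i
  show "continuous_on A (\<lambda>x::seq. suffix k x i)"
    unfolding suffix_def by (rule continuous_on_subset[OF continuous_on_product_coordinates]) simp
qed

lemma open_coordinate: "open {x::seq. x i = b}"
proof -
  have "open ((\<lambda>x::seq. x i) -` {b})"
    by (intro open_vimage open_discrete continuous_on_product_coordinates)
  then show ?thesis
    by (simp add: vimage_def)
qed

lemma open_cylinder: "open {y::seq. \<forall>i<l. y i = x i}"
proof -
  have "open (\<Inter>i\<in>{..<l}. {y::seq. y i = x i})"
    by (intro open_INT open_coordinate ballI finite_lessThan)
  also have "(\<Inter>i\<in>{..<l}. {y::seq. y i = x i}) = {y. \<forall>i<l. y i = x i}"
    by auto
  finally show ?thesis .
qed

lemma Omega_star_borel [measurable]: "Omega_star \<in> sets borel"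
proof -
  have "Omega_star = (\<Inter>n. \<Union>i\<in>{n..}. {x::seq. x i = True})"
    by (auto simp: Omega_star_def infinite_nat_iff_unbounded_le)
  also have "\<dots> \<in> sets borel"
    by (intro sets.countable_INT'' borel_open open_UN ballI open_coordinate) auto
  finally show ?thesis .
qed

lemma A_set_Suc: "A_set (Suc m) = range (blk m)"
proof
  show "range (blk m) \<subseteq> A_set (Suc m)"
    by (auto simp: A_set_def)
  show "A_set (Suc m) \<subseteq> range (blk m)"
  proof
    fix x assume "x \<in> A_set (Suc m)"
    then have "1 + (INF i\<in>{i. x i}. enat i) = 1 + enat m"
      by (simp add: A_set_def tau_def one_enat_def)
    then have inf: "(INF i\<in>{i. x i}. enat i) = enat m"
      by (simp add: plus_1_eSuc)
    have "{i. x i} \<noteq> {}"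
    proof
      assume e: "{i. x i} = {}"
      show False
        using inf unfolding e by (simp add: top_enat_def)
    qed
    then obtain i where i: "x i"
      by auto
    define k where "k = (LEAST i. x i)"
    have k: "x k" "\<And>i. i < k \<Longrightarrow> \<not> x i"
      using i LeastI not_less_Least unfolding k_def by metis+
    have "x = blk k (suffix (Suc k) x)"
      using k by (auto simp: fun_eq_iff blk_nth)
    moreover from this have "k = m"
      using \<open>x \<in> A_set (Suc m)\<close> tau_blk[of k "suffix (Suc k) x"] by (simp add: A_set_def)
    ultimately show "x \<in> range (blk m)"
      by blast
  qed
qed

lemma A_set_Suc_iff: "x \<in> A_set (Suc m) \<longleftrightarrow> (\<forall>i<m. x i = False) \<and> x m = True"
proof
  assume "(\<forall>i<m. x i = False) \<and> x m = True"
  then have "x = blk m (suffix (Suc m) x)"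
    by (auto simp: fun_eq_iff blk_nth)
  then show "x \<in> A_set (Suc m)"
    unfolding A_set_Suc by blast
qed (auto simp: A_set_Suc blk_nth)

lemma open_A_set: "open (A_set (Suc m))"
  and open_compl_A_set: "open (- A_set (Suc m))"
proof -
  have "A_set (Suc m) = (\<Inter>i\<in>{..<m}. {x. x i = False}) \<inter> {x. x m = True}"
    by (auto simp: A_set_Suc_iff)
  also have "open \<dots>"
    by (intro open_Int open_INT open_coordinate ballI finite_lessThan)
  finally show "open (A_set (Suc m))" .
  have "- A_set (Suc m) = (\<Union>i\<in>{..<m}. {x. x i = True}) \<union> {x. x m = False}"
    by (auto simp: A_set_Suc_iff)
  also have "open \<dots>"
    by (intro open_Un open_UN open_coordinate ballI)
  finally show "open (- A_set (Suc m))" .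
qed

text \<open>A small cylinder around \<open>x\<close> forces \<open>j\<close> equal blocks by
  \<open>cylinder_agree\<close>, so bounds in terms of blocks give continuity in the product
  topology at each point of \<open>Omega_star\<close>.\<close>

lemma continuous_on_agree:
  fixes f :: "seq \<Rightarrow> real"
  assumes f: "\<And>j x y. x \<in> Omega_star \<Longrightarrow> y \<in> Omega_star \<Longrightarrow> agree j x y \<Longrightarrow> \<bar>f x - f y\<bar> \<le> L * \<theta> ^ j"
    and \<theta>: "0 < \<theta>" "\<theta> < 1"
  shows "continuous_on Omega_star f"
  unfolding continuous_on_def
proof (intro ballI tendstoI)
  fix x and e :: real
  assume x: "x \<in> Omega_star" and e: "0 < e"
  obtain j where "\<theta> ^ j < e / (\<bar>L\<bar> + 1)"
    using real_arch_pow_inv[of "e / (\<bar>L\<bar> + 1)" \<theta>] \<theta> e by auto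
  then have "(\<bar>L\<bar> + 1) * \<theta> ^ j < e"
    by (simp add: field_simps)
  moreover have "L * \<theta> ^ j \<le> (\<bar>L\<bar> + 1) * \<theta> ^ j"
    using \<theta> by (intro mult_right_mono) auto
  ultimately have j: "L * \<theta> ^ j < e"
    by linarith
  obtain l where l: "\<forall>y\<in>Omega_star. (\<forall>i<l. y i = x i) \<longrightarrow> agree j y x"
    using cylinder_agree[OF x] by blast
  show "\<forall>\<^sub>F y in at x within Omega_star. dist (f y) (f x) < e"
    unfolding eventually_at_topological
  proof (intro exI conjI ballI impI)
    show "open {y. \<forall>i<l. y i = x i}"
      by (rule open_cylinder)
    fix y assume "y \<in> {y. \<forall>i<l. y i = x i}" "y \<in> Omega_star"
    then have "\<bar>f y - f x\<bar> \<le> L * \<theta> ^ j"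
      using l x by (intro f) auto
    then show "dist (f y) (f x) < e"
      using j by (simp add: dist_real_def)
  qed auto
qed

text \<open>A class large enough for the continuous functions on \<Omega> as well as for
  \<open>h\<close> and the block probabilities, stable under prepending words, and integrable for
  \<open>\<nu>\<close>. The invariance of \<open>\<nu>\<close> is extended to it from
  \<open>F_theta\<close>.\<close>

definition CB :: "(seq \<Rightarrow> 'a::real_normed_vector) \<Rightarrow> bool" where
  "CB f \<longleftrightarrow> continuous_on Omega_star f \<and> (\<exists>B. \<forall>x\<in>Omega_star. norm (f x) \<le> B)"

lemma CB_I: "continuous_on Omega_star f \<Longrightarrow> (\<And>x. x \<in> Omega_star \<Longrightarrow> norm (f x) \<le> B) \<Longrightarrow> CB f"
  by (auto simp: CB_def)

lemma CB_E:
  assumes "CB f"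
  obtains B where "0 \<le> B" "\<And>x. x \<in> Omega_star \<Longrightarrow> norm (f x) \<le> B"
  using assms unfolding CB_def
  by (metis norm_ge_zero order_trans ones_in_Omega_star)

lemma CB_const [intro]: "CB (\<lambda>_. c)"
  by (auto intro: CB_I[of _ "norm c"])

lemma CB_add [intro]: "CB f \<Longrightarrow> CB g \<Longrightarrow> CB (\<lambda>x. f x + g x)"
  unfolding CB_def by (auto intro!: continuous_on_add) (meson norm_triangle_mono)

lemma CB_scaleR [intro]:
  assumes "CB f" "CB g"
  shows "CB (\<lambda>x. f x *\<^sub>R g x)"
proof -
  obtain A B where "0 \<le> A" "\<And>x. x \<in> Omega_star \<Longrightarrow> norm (f x) \<le> A"
    "0 \<le> B" "\<And>x. x \<in> Omega_star \<Longrightarrow> norm (g x) \<le> B"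
    by (rule CB_E[OF assms(1)], rule CB_E[OF assms(2)]) (rule that; assumption)
  with assms show ?thesis
    by (intro CB_I[of _ "A * B"] continuous_on_scaleR) (auto simp: CB_def intro!: mult_mono)
qed

lemma CB_mult [intro]:
  fixes f g :: "seq \<Rightarrow> 'a::real_normed_algebra"
  assumes "CB f" "CB g"
  shows "CB (\<lambda>x. f x * g x)"
proof -
  obtain A B where "0 \<le> A" "\<And>x. x \<in> Omega_star \<Longrightarrow> norm (f x) \<le> A"
    "0 \<le> B" "\<And>x. x \<in> Omega_star \<Longrightarrow> norm (g x) \<le> B"
    by (rule CB_E[OF assms(1)], rule CB_E[OF assms(2)]) (rule that; assumption)
  with assms show ?thesis
    by (intro CB_I[of _ "A * B"] continuous_on_mult)
      (auto simp: CB_def intro!: order_trans[OF norm_mult_ineq] mult_mono)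
qed

lemma CB_of_real [intro]: "CB f \<Longrightarrow> CB (\<lambda>x. complex_of_real (f x))"
  by (auto simp: CB_def intro: continuous_on_of_real)

lemma CB_conc:
  assumes "CB f"
  shows "CB (\<lambda>x. f (conc w x))"
proof -
  obtain B where "0 \<le> B" "\<And>x. x \<in> Omega_star \<Longrightarrow> norm (f x) \<le> B"
    by (rule CB_E[OF assms]) (rule that; assumption)
  with assms show ?thesis
    by (intro CB_I[of _ B] continuous_on_compose2[OF _ continuous_on_conc, of Omega_star f])
      (auto simp: CB_def Omega_star_conc)
qed

lemma CB_blk: "CB f \<Longrightarrow> CB (\<lambda>x. f (blk m x))"
  unfolding blk_def by (rule CB_conc)

lemma CB_suminf:
  fixes f :: "nat \<Rightarrow> seq \<Rightarrow> 'a::banach"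
  assumes c: "\<And>m. continuous_on Omega_star (f m)"
    and b: "\<And>m x. x \<in> Omega_star \<Longrightarrow> norm (f m x) \<le> E m" and s: "summable E"
  shows "CB (\<lambda>x. \<Sum>m. f m x)"
proof (rule CB_I)
  have "uniform_limit Omega_star (\<lambda>n x. \<Sum>i<n. f i x) (\<lambda>x. \<Sum>i. f i x) sequentially"
    by (rule Weierstrass_m_test[OF b s])
  then show "continuous_on Omega_star (\<lambda>x. \<Sum>m. f m x)"
    by (rule uniform_limit_theorem[rotated]) (auto intro!: always_eventually continuous_on_sum c)
  show "norm (\<Sum>m. f m x) \<le> suminf E" if "x \<in> Omega_star" for x
    using b[OF that] s by (rule norm_suminf_le)
qed

lemma infsum_from_1_eq:
  fixes f :: "nat \<Rightarrow> complex"
  assumes "summable (\<lambda>m. norm (f m))"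
  shows "(\<Sum>\<^sub>\<infinity>n\<in>{1..}. f (n - 1)) = (\<Sum>m. f m)"
proof -
  have "(\<Sum>\<^sub>\<infinity>n\<in>{1..}. f (n - 1)) = (\<Sum>\<^sub>\<infinity>m\<in>UNIV. f m)"
    by (rule infsum_reindex_bij_witness[where i = Suc and j = "\<lambda>n. n - 1"]) auto
  also have "(f has_sum (\<Sum>m. f m)) UNIV"
    using assms by (intro norm_summable_imp_has_sum) (auto simp: summable_norm_cancel summable_sums)
  then have "(\<Sum>\<^sub>\<infinity>m\<in>UNIV. f m) = (\<Sum>m. f m)"
    by (rule infsumI)
  finally show ?thesis .
qed

section \<open>The induced system\<close>

locale induced_system =
  fixes V :: "seq \<Rightarrow> real" and \<theta> :: real and h :: "seq \<Rightarrow> real" and \<nu> :: "seq measure"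
  assumes adm: "admissible_potential V \<theta>" and eig: "induced_eigenpair V \<theta> h \<nu>"
begin

lemma V_cont: "continuous_on UNIV V"
  and V_le_0: "V x \<le> 0"
  and theta: "0 < \<theta>" "\<theta> < 1"
  using adm by (auto simp: admissible_potential_def)

lemma V_lower: obtains C1 where "0 < C1" "\<And>x. - C1 \<le> V x"
proof -
  have "\<exists>C1>0. \<forall>x. - C1 \<le> V x \<and> V x \<le> 0"
    using adm unfolding admissible_potential_def by (elim conjE)
  then show thesis
    using that by metis
qed

lemma CB_exp_V: "CB (\<lambda>x. exp (V x))"
  using continuous_on_subset[OF V_cont, of Omega_star]
  by (intro CB_I[of _ 1]) (auto intro!: continuous_intros simp: V_le_0)

definition psi :: "nat \<Rightarrow> seq \<Rightarrow> real" where
  "psi m x = exp (induced V (blk m x))"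

lemma induced_blk: "induced V (blk m x) = (\<Sum>i\<le>m. V (blk i x))"
proof -
  have "induced V (blk m x) = (\<Sum>i\<le>m. V (blk (m - i) x))"
    by (simp add: induced_def suffix_blk less_Suc_eq_le atMost_def)
  also have "\<dots> = (\<Sum>i\<le>m. V (blk i x))"
    by (rule sum.nat_diff_reindex[where n = "Suc m" and g = "\<lambda>i. V (blk i x)", unfolded lessThan_Suc_atMost, simplified])
  finally show ?thesis .
qed

lemma psi_0: "psi 0 x = exp (V (conc [True] x))"
  by (simp add: psi_def induced_blk conc_True_eq_blk)

lemma psi_Suc: "psi (Suc m) x = psi m x * exp (V (blk (Suc m) x))"
  by (simp add: psi_def induced_blk exp_add)

lemma psi_pos: "0 < psi m x"
  by (simp add: psi_def)

lemma psi_cont: "continuous_on A (psi m)"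
  unfolding psi_def induced_blk
  by (intro continuous_on_exp continuous_on_sum continuous_on_compose2[OF V_cont continuous_on_blk]) auto

definition psi_bd :: "nat \<Rightarrow> real" where
  "psi_bd m = exp (SUP \<omega>\<in>A_set (Suc m). induced V \<omega>)"

lemma psi_le: "psi m x \<le> psi_bd m"
proof -
  have "bdd_above (induced V ` A_set (Suc m))"
    by (intro bdd_aboveI[of _ 0]) (auto simp: induced_def intro: sum_nonpos V_le_0)
  then show ?thesis
    unfolding psi_def psi_bd_def by (auto simp: A_set_Suc intro!: cSUP_upper2)
qed

lemma summable_psi_bd: "summable psi_bd"
proof -
  obtain C2 :: real where "(\<Sum>n. ennreal (psi_bd n)) < ennreal C2"
    using adm unfolding admissible_potential_def psi_bd_def[symmetric] by (elim conjE exE)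
  then show ?thesis
    by (intro summable_suminf_not_top) (auto simp: psi_bd_def)
qed

lemma CB_psi: "CB (psi m)"
  using psi_le psi_cont by (intro CB_I[of _ "psi_bd m"]) (auto simp: less_imp_le[OF psi_pos])

text \<open>Prepending the same block raises the agreement from \<open>j\<close> to
  \<open>j + 1\<close>, so only \<open>Var n\<close> with \<open>n \<ge> 1\<close> enters. Pairs
  with identical passage times belong to no \<open>Var n\<close>, but on \<open>Omega_star\<close>
  such sequences are equal.\<close>

lemma psi_distortion:
  obtains C3 where "0 < C3"
    "\<And>j m x y. x \<in> Omega_star \<Longrightarrow> y \<in> Omega_star \<Longrightarrow> agree j x y \<Longrightarrow>
      psi m x \<le> psi m y * exp (C3 * \<theta> ^ Suc j)"
proof -
  have "\<exists>C3>0. \<forall>n\<ge>1. Var n (induced V) \<le> ennreal (C3 * \<theta> ^ n)"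
    using adm unfolding admissible_potential_def by (elim conjE)
  then obtain C3 where C3: "0 < C3" "\<And>n. 1 \<le> n \<Longrightarrow> Var n (induced V) \<le> ennreal (C3 * \<theta> ^ n)"
    by metis
  show thesis
  proof (rule that[OF C3(1)])
    fix j m x y
    assume xy: "x \<in> Omega_star" "y \<in> Omega_star" "agree j x y"
    have ag: "agree (Suc j) (blk m x) (blk m y)"
      using xy by (simp add: agree_blk)
    have "\<bar>induced V (blk m x) - induced V (blk m y)\<bar> \<le> C3 * \<theta> ^ Suc j"
    proof (cases "first_diff (passage (blk m x)) (passage (blk m y))")
      case (enat n)
      then have n: "Suc j \<le> n"
        using ag by (simp add: agree_iff)
      have "ennreal \<bar>induced V (blk m x) - induced V (blk m y)\<bar> \<le> Var n (induced V)"
        unfolding Var_def using enat xy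
        by (intro SUP_upper2[of "(blk m x, blk m y)"]) auto
      also have "\<dots> \<le> ennreal (C3 * \<theta> ^ n)"
        using n by (intro C3) auto
      finally have "\<bar>induced V (blk m x) - induced V (blk m y)\<bar> \<le> C3 * \<theta> ^ n"
        using C3(1) theta by (subst (asm) ennreal_le_iff) auto
      also have "\<dots> \<le> C3 * \<theta> ^ Suc j"
        using n C3(1) theta by (intro mult_left_mono power_decreasing) auto
      finally show ?thesis .
    next
      case infinity
      then have "blk m x = blk m y"
        using xy by (intro passage_inject) (auto simp: first_diff_eq_infinity_iff)
      then show ?thesis
        using C3(1) theta by simp
    qed
    then show "psi m x \<le> psi m y * exp (C3 * \<theta> ^ Suc j)"
      by (simp add: psi_def exp_add[symmetric] abs_le_iff)
  qed
qed

section \<open>The eigenfunction and the transition probabilities\<close>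

lemma h_pos: "x \<in> Omega_star \<Longrightarrow> 0 < h x"
  using eig by (simp add: induced_eigenpair_def)

lemma h_lipschitz:
  obtains L where "0 \<le> L"
    "\<And>j x y. x \<in> Omega_star \<Longrightarrow> y \<in> Omega_star \<Longrightarrow> agree j x y \<Longrightarrow> \<bar>h x - h y\<bar> \<le> L * \<theta> ^ j"
proof -
  obtain L where L: "\<And>x y. x \<in> Omega_star \<Longrightarrow> y \<in> Omega_star \<Longrightarrow>
      cmod (complex_of_real (h x) - complex_of_real (h y)) \<le> L * d_theta \<theta> x y"
    using eig by (auto simp: induced_eigenpair_def F_theta_def)
  show thesis
  proof (rule that[of "\<bar>L\<bar>"])
    fix j x y assume xy: "x \<in> Omega_star" "y \<in> Omega_star" "agree j x y"
    have "\<bar>h x - h y\<bar> \<le> L * d_theta \<theta> x y"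
      using L[OF xy(1,2)] by (simp flip: of_real_diff)
    also have "\<dots> \<le> \<bar>L\<bar> * \<theta> ^ j"
      using d_theta_le[OF theta xy(3)] d_theta_nonneg[of \<theta> x y] theta by (intro mult_mono) auto
    finally show "\<bar>h x - h y\<bar> \<le> \<bar>L\<bar> * \<theta> ^ j" .
  qed simp
qed

lemma CB_h: "CB h"
proof -
  obtain L where "\<And>j x y. x \<in> Omega_star \<Longrightarrow> y \<in> Omega_star \<Longrightarrow> agree j x y \<Longrightarrow> \<bar>h x - h y\<bar> \<le> L * \<theta> ^ j"
    by (rule h_lipschitz) (rule that; assumption)
  then have "continuous_on Omega_star h"
    using theta by (rule continuous_on_agree)
  moreover have "bounded ((\<lambda>x. complex_of_real (h x)) ` Omega_star)"
    using eig by (simp add: induced_eigenpair_def F_theta_def)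
  ultimately show ?thesis
    by (auto simp: CB_def bounded_iff)
qed

lemma summable_psi:
  fixes f :: "seq \<Rightarrow> 'a::banach"
  assumes "CB f" "x \<in> Omega_star"
  shows "summable (\<lambda>m. norm (psi m x *\<^sub>R f (blk m x)))" "summable (\<lambda>m. psi m x *\<^sub>R f (blk m x))"
proof -
  obtain B where B: "0 \<le> B" "\<And>x. x \<in> Omega_star \<Longrightarrow> norm (f x) \<le> B"
    using CB_E[OF assms(1)] by blast
  show "summable (\<lambda>m. norm (psi m x *\<^sub>R f (blk m x)))"
  proof (rule summable_comparison_test'[OF summable_mult2[OF summable_psi_bd, of B], where N = 0])
    fix m
    show "norm (norm (psi m x *\<^sub>R f (blk m x))) \<le> psi_bd m * B"
      using B assms psi_le[of m x] psi_pos[of m x] by (auto intro!: mult_mono)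
  qed
  then show "summable (\<lambda>m. psi m x *\<^sub>R f (blk m x))"
    by (rule summable_norm_cancel)
qed

lemma CB_transfer:
  fixes f :: "seq \<Rightarrow> 'a::banach"
  assumes "CB f"
  shows "CB (\<lambda>x. \<Sum>m. psi m x *\<^sub>R f (blk m x))"
proof -
  obtain B where B: "0 \<le> B" "\<And>x. x \<in> Omega_star \<Longrightarrow> norm (f x) \<le> B"
    using CB_E[OF assms] by blast
  show ?thesis
  proof (rule CB_suminf[where E = "\<lambda>m. psi_bd m * B"])
    show "summable (\<lambda>m. psi_bd m * B)"
      by (rule summable_mult2[OF summable_psi_bd])
    show "continuous_on Omega_star (\<lambda>x. psi m x *\<^sub>R f (blk m x))" for m
      using CB_scaleR[OF CB_psi CB_blk[OF assms]] by (simp add: CB_def)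
    show "norm (psi m x *\<^sub>R f (blk m x)) \<le> psi_bd m * B" if "x \<in> Omega_star" for m x
      using B that psi_le[of m x] psi_pos[of m x] by (auto intro!: mult_mono)
  qed
qed

lemma M_op_eq:
  assumes "CB f" "x \<in> Omega_star"
  shows "M_op V f x = (\<Sum>m. psi m x *\<^sub>R f (blk m x))"
proof -
  have "M_op V f x = (\<Sum>\<^sub>\<infinity>n\<in>{1..}. psi (n - 1) x *\<^sub>R f (blk (n - 1) x))"
    by (simp add: M_op_def psi_def blk_def Let_def scaleR_conv_of_real)
  also have "\<dots> = (\<Sum>m. psi m x *\<^sub>R f (blk m x))"
    using summable_psi(1)[OF assms] by (rule infsum_from_1_eq)
  finally show ?thesis .
qed

lemma h_eq:
  assumes "x \<in> Omega_star"
  shows "(\<lambda>m. psi m x * h (blk m x)) sums h x"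
proof -
  have "complex_of_real (h x) = M_op V (\<lambda>x. complex_of_real (h x)) x"
    using eig assms by (simp add: induced_eigenpair_def)
  also have "\<dots> = (\<Sum>m. complex_of_real (psi m x * h (blk m x)))"
    using M_op_eq[OF CB_of_real[OF CB_h] assms] by (simp add: scaleR_conv_of_real)
  also have "\<dots> = complex_of_real (\<Sum>m. psi m x * h (blk m x))"
    using summable_psi(2)[OF CB_h assms] by (intro suminf_of_real[symmetric]) simp
  finally have "h x = (\<Sum>m. psi m x * h (blk m x))"
    by (simp only: of_real_eq_iff)
  then show ?thesis
    using summable_psi(2)[OF CB_h assms] by (simp add: sums_iff)
qed

text \<open>Follow the branch of blocks of length one, on which \<open>h\<close> approaches its value at the fixed
  point \<open>1\<^sup>\<infinity>\<close>.\<close>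

lemma h_lower:
  obtains h0 where "0 < h0" "\<And>x. x \<in> Omega_star \<Longrightarrow> h0 \<le> h x"
proof -
  obtain C1 where C1: "0 < C1" "\<And>x. - C1 \<le> V x"
    using V_lower by blast
  obtain L where L: "0 \<le> L" "\<And>j x y. x \<in> Omega_star \<Longrightarrow> y \<in> Omega_star \<Longrightarrow> agree j x y \<Longrightarrow> \<bar>h x - h y\<bar> \<le> L * \<theta> ^ j"
    by (rule h_lipschitz) (rule that; assumption)
  have hp: "0 < h ones"
    by (simp add: h_pos)
  \<comment> \<open>After \<open>k\<close> common blocks \<open>h\<close> differs from
    \<open>h ones\<close> by at most half of \<open>h ones\<close>; this \<open>k\<close> is
    independent of the starting point.\<close>
  obtain k where "\<theta> ^ k < h ones / (2 * (L + 1))"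
    using real_arch_pow_inv[of "h ones / (2 * (L + 1))" \<theta>] theta L(1) hp by auto
  then have "(L + 1) * \<theta> ^ k < h ones / 2"
    using L(1) by (simp add: field_simps)
  then have k: "L * \<theta> ^ k \<le> h ones / 2"
    using theta by (simp add: distrib_right) (smt (verit) zero_less_power)
  have blk_ones: "blk 0 ones = ones"
    by (rule ext) (simp add: blk_nth ones_def)
  have step: "exp (- C1) * h (blk 0 x) \<le> h x" if x: "x \<in> Omega_star" for x
  proof -
    have "exp (- C1) * h (blk 0 x) \<le> psi 0 x * h (blk 0 x)"
      using C1 h_pos[of "blk 0 x"] x by (intro mult_right_mono) (auto simp: psi_0 less_imp_le)
    also have "\<dots> = (\<Sum>m\<in>{0}. psi m x * h (blk m x))"
      by simp
    also have "\<dots> \<le> h x"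
      using h_eq[OF x] h_pos x psi_pos
      by (subst sums_unique[OF h_eq[OF x]], intro sum_le_suminf) (auto simp: sums_iff less_imp_le)
    finally show ?thesis .
  qed
  have iter: "exp (- C1) ^ n * h ((blk 0 ^^ n) x) \<le> h x \<and> (blk 0 ^^ n) x \<in> Omega_star
      \<and> agree n ((blk 0 ^^ n) x) ones" if x: "x \<in> Omega_star" for n x
  proof (induction n)
    case (Suc n)
    have "exp (- C1) ^ n * (exp (- C1) * h (blk 0 ((blk 0 ^^ n) x))) \<le> exp (- C1) ^ n * h ((blk 0 ^^ n) x)"
      using Suc by (intro mult_left_mono step) simp_all
    also have "\<dots> \<le> h x"
      using Suc by simp
    finally have "exp (- C1) ^ Suc n * h ((blk 0 ^^ Suc n) x) \<le> h x"
      by (simp add: mult_ac)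
    moreover have "agree (Suc n) (blk 0 ((blk 0 ^^ n) x)) (blk 0 ones)"
      using Suc by (simp add: agree_blk)
    ultimately show ?case
      using Suc by (simp add: blk_ones mult_ac)
  qed (use x in simp)
  show thesis
  proof (rule that[of "exp (- C1) ^ k * (h ones / 2)"])
    show "0 < exp (- C1) ^ k * (h ones / 2)"
      using hp by simp
    fix x assume x: "x \<in> Omega_star"
    have "\<bar>h ((blk 0 ^^ k) x) - h ones\<bar> \<le> h ones / 2"
      using L(2)[of "(blk 0 ^^ k) x" ones k] iter[OF x, of k] k by auto
    then have "h ones / 2 \<le> h ((blk 0 ^^ k) x)"
      by linarith
    then have "exp (- C1) ^ k * (h ones / 2) \<le> exp (- C1) ^ k * h ((blk 0 ^^ k) x)"
      by (intro mult_left_mono) auto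
    also have "\<dots> \<le> h x"
      using iter[OF x, of k] by simp
    finally show "exp (- C1) ^ k * (h ones / 2) \<le> h x" .
  qed
qed

definition p :: "nat \<Rightarrow> seq \<Rightarrow> real" where
  "p m x = psi m x * h (blk m x) / h x"

lemma p_pos: "x \<in> Omega_star \<Longrightarrow> 0 < p m x"
  by (simp add: p_def psi_pos h_pos)

lemma p_sums: "x \<in> Omega_star \<Longrightarrow> (\<lambda>m. p m x) sums 1"
  using sums_divide[OF h_eq, of x "h x"] h_pos[of x] by (simp add: p_def)

lemma h_p: "x \<in> Omega_star \<Longrightarrow> h x * p m x = psi m x * h (blk m x)"
  using h_pos[of x] by (simp add: p_def)

text \<open>Three multiplicative errors are combined: those of \<open>psi m\<close> and of
  \<open>h (blk m _)\<close>, which have the exponent \<open>j + 1\<close>, and that of the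
  denominator \<open>h\<close>, with exponent \<open>j\<close>. The lower bound \<open>h0\<close>
  turns the Lipschitz bound for \<open>h\<close> into a multiplicative one with constant
  \<open>L / h0\<close>, whence \<open>C = C3 + 2 * (L / h0)\<close>.\<close>

lemma p_distortion:
  obtains C where "0 < C"
    "\<And>j m x y. x \<in> Omega_star \<Longrightarrow> y \<in> Omega_star \<Longrightarrow> agree j x y \<Longrightarrow> p m x * exp (- C * \<theta> ^ j) \<le> p m y"
proof -
  obtain C3 where C3: "0 < C3" "\<And>j m x y. x \<in> Omega_star \<Longrightarrow> y \<in> Omega_star \<Longrightarrow> agree j x y \<Longrightarrow>
      psi m x \<le> psi m y * exp (C3 * \<theta> ^ Suc j)"
    by (rule psi_distortion) (rule that; assumption)
  obtain L where L: "0 \<le> L" "\<And>j x y. x \<in> Omega_star \<Longrightarrow> y \<in> Omega_star \<Longrightarrow> agree j x y \<Longrightarrow> \<bar>h x - h y\<bar> \<le> L * \<theta> ^ j"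
    by (rule h_lipschitz) (rule that; assumption)
  obtain h0 where h0: "0 < h0" "\<And>x. x \<in> Omega_star \<Longrightarrow> h0 \<le> h x"
    by (rule h_lower) (rule that; assumption)
  have hr: "h x \<le> h y * exp (L / h0 * \<theta> ^ j)"
    if xy: "x \<in> Omega_star" "y \<in> Omega_star" "agree j x y" for j x y
  proof -
    have "L * \<theta> ^ j \<le> h y * (L / h0 * \<theta> ^ j)"
    proof -
      have "h0 * (L / h0 * \<theta> ^ j) \<le> h y * (L / h0 * \<theta> ^ j)"
        using h0 L(1) theta xy by (intro mult_right_mono) auto
      then show ?thesis
        using h0(1) by simp
    qed
    then have "h x \<le> h y * (1 + L / h0 * \<theta> ^ j)"
      using L(2)[OF xy] by (simp add: distrib_left)
    also have "\<dots> \<le> h y * exp (L / h0 * \<theta> ^ j)"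
      using h_pos[OF xy(2)] by (intro mult_left_mono exp_ge_add_one_self) auto
    finally show ?thesis .
  qed
  define C where "C = C3 + 2 * (L / h0)"
  show thesis
  proof (rule that[of C])
    show "0 < C"
      using C3(1) L(1) h0(1) by (simp add: C_def add_pos_nonneg)
    fix j m x y
    assume xy: "x \<in> Omega_star" "y \<in> Omega_star" "agree j x y"
    have yx: "agree j y x"
      using xy(3) by (simp add: agree_def)
    have 1: "psi m x \<le> psi m y * exp (C3 * \<theta> ^ Suc j)"
      using C3(2)[OF xy] .
    have 2: "h (blk m x) \<le> h (blk m y) * exp (L / h0 * \<theta> ^ Suc j)"
      using xy by (intro hr) (auto simp: agree_blk)
    have 3: "h y \<le> h x * exp (L / h0 * \<theta> ^ j)"
      by (rule hr[OF xy(2,1) yx])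
    have "psi m x * h (blk m x) * h y \<le>
      (psi m y * exp (C3 * \<theta> ^ Suc j)) * (h (blk m y) * exp (L / h0 * \<theta> ^ Suc j)) * (h x * exp (L / h0 * \<theta> ^ j))"
      using 1 2 3 psi_pos h_pos xy by (intro mult_mono) (auto simp: less_imp_le)
    also have "\<dots> = psi m y * h (blk m y) * h x *
        exp (C3 * \<theta> ^ Suc j + L / h0 * \<theta> ^ Suc j + L / h0 * \<theta> ^ j)"
      by (simp add: exp_add mult_ac)
    also have "\<dots> \<le> psi m y * h (blk m y) * h x * exp (C * \<theta> ^ j)"
    proof -
      have t: "\<theta> ^ Suc j \<le> \<theta> ^ j"
        using theta by (intro power_decreasing) auto
      have "C3 * \<theta> ^ Suc j \<le> C3 * \<theta> ^ j" "L / h0 * \<theta> ^ Suc j \<le> L / h0 * \<theta> ^ j"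
        using t C3(1) L(1) h0(1) by (intro mult_left_mono; simp)+
      moreover have "C * \<theta> ^ j = C3 * \<theta> ^ j + L / h0 * \<theta> ^ j + L / h0 * \<theta> ^ j"
        by (simp add: C_def distrib_right)
      ultimately have "C3 * \<theta> ^ Suc j + L / h0 * \<theta> ^ Suc j + L / h0 * \<theta> ^ j \<le> C * \<theta> ^ j"
        by linarith
      then show ?thesis
        using psi_pos[of m y] h_pos[of "blk m y"] h_pos[of x] xy
        by (intro mult_left_mono) auto
    qed
    finally have "p m x \<le> p m y * exp (C * \<theta> ^ j)"
      using h_pos[OF xy(1)] h_pos[OF xy(2)] by (simp add: p_def field_simps)
    then show "p m x * exp (- C * \<theta> ^ j) \<le> p m y"
      by (simp add: exp_minus field_simps)
  qed
qed

lemma CB_p: "CB (p m)"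
proof (rule CB_I[of _ 1])
  have "continuous_on Omega_star (\<lambda>x. psi m x * h (blk m x) / h x)"
    using CB_h CB_blk[OF CB_h, of m] CB_psi[of m]
    by (intro continuous_on_divide continuous_on_mult) (auto simp: CB_def dest: h_pos)
  then show "continuous_on Omega_star (p m)"
    by (simp add: p_def[abs_def])
  fix x assume x: "x \<in> Omega_star"
  have "(\<Sum>m\<in>{m}. p m x) \<le> (\<Sum>m. p m x)"
    using p_sums[OF x] p_pos[OF x] by (intro sum_le_suminf) (auto simp: sums_iff less_imp_le)
  then show "norm (p m x) \<le> 1"
    using p_sums[OF x] p_pos[OF x, of m] by (simp add: sums_iff)
qed

end

section \<open>Truncations, clopen sets and sums of tails\<close>

lemma conc_False_blk: "conc [False] (blk m x) = blk (Suc m) x"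
  by (rule ext) (auto simp: blk_nth conc_def)

lemma suffix_1_conc: "suffix (Suc 0) (conc [b] x) = x"
  by (rule ext) (simp add: conc_def)

text \<open>The implication fills all coordinates from \<open>n\<close> on with \<open>True\<close>;
  filling with zeros would leave \<open>Omega_star\<close>.\<close>

definition cut :: "nat \<Rightarrow> seq \<Rightarrow> seq" where
  "cut n x = (\<lambda>i. i < n \<longrightarrow> x i)"

lemma cut_in_Omega_star [simp]: "cut n x \<in> Omega_star"
proof -
  have "{i. \<not> cut n x i} \<subseteq> {..<n}"
    by (auto simp: cut_def)
  then have "finite {i. \<not> cut n x i}"
    using finite_subset by blast
  then have "infinite (UNIV - {i. \<not> cut n x i})"
    by (intro Diff_infinite_finite) auto
  also have "UNIV - {i. \<not> cut n x i} = {i. cut n x i}"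
    by auto
  finally show ?thesis
    by (simp add: Omega_star_def)
qed

lemma continuous_on_cut: "continuous_on A (cut n)"
proof (rule continuous_on_coordinatewise_then_product)
  fix i
  have "continuous_on A (\<lambda>x::seq. x i)"
    by (rule continuous_on_subset[OF continuous_on_product_coordinates]) simp
  then show "continuous_on A (\<lambda>x. cut n x i)"
    by (cases "i < n") (simp_all add: cut_def)
qed

lemma cut_tendsto: "(\<lambda>n. cut n x) \<longlonglongrightarrow> x"
proof -
  have "(\<lambda>n. cut n x i) \<longlonglongrightarrow> x i" for i
    by (rule tendsto_eventually) (auto simp: cut_def eventually_sequentially intro!: exI[of _ "Suc i"])
  then have "limitin (product_topology (\<lambda>i. euclidean) UNIV) (\<lambda>n. cut n x) x sequentially"
    by (simp add: limitin_componentwise)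
  then show ?thesis
    by (simp add: euclidean_product_topology)
qed

lemma CB_indicator:
  assumes "open A" "open (- A)"
  shows "CB (indicat_real A)"
proof (rule CB_I[of _ 1])
  have "continuous_on (A \<union> - A) (indicat_real A)"
  proof (rule continuous_on_open_Un[OF assms])
    show "continuous_on A (indicat_real A)"
      by (rule continuous_on_eq[of _ "\<lambda>_. 1"]) auto
    show "continuous_on (- A) (indicat_real A)"
      by (rule continuous_on_eq[of _ "\<lambda>_. 0"]) auto
  qed
  then show "continuous_on Omega_star (indicat_real A)"
    by (rule continuous_on_subset) auto
qed (auto simp: indicator_def)

lemma CB_suffix: "CB f \<Longrightarrow> CB (\<lambda>x. f (suffix k x))"
  unfolding CB_def
  by (auto intro!: continuous_on_compose2[OF _ continuous_on_suffix] simp: Omega_star_suffix)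
     (use Omega_star_suffix in blast)

lemma suminf_swap_ennreal:
  fixes f :: "nat \<Rightarrow> nat \<Rightarrow> ennreal"
  shows "(\<Sum>k. \<Sum>m. f k m) = (\<Sum>m. \<Sum>k. f k m)"
  using nn_integral_suminf[of "\<lambda>m k. f k m" "count_space UNIV"]
  by (simp add: nn_integral_count_space_nat)

text \<open>Summation over \<open>k \<le> m\<close> in the other order. The exchange is done in
  \<open>ennreal\<close>, where it is unconditional. For \<open>c = 1\<close> this is the mean as
  the sum of the tails.\<close>

lemma tail_sums:
  fixes c r :: "nat \<Rightarrow> real"
  assumes c: "\<And>k. 0 \<le> c k" and r: "\<And>m. 0 \<le> r m" and sr: "summable r"
    and s: "summable (\<lambda>m. r m * (\<Sum>k\<le>m. c k))"
  shows "(\<lambda>k. c k * (\<Sum>i. r (i + k))) sums (\<Sum>m. r m * (\<Sum>k\<le>m. c k))"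
proof -
  have tail: "(\<Sum>i. r (i + k)) = (\<Sum>m. if k \<le> m then r m else 0)"
    and st: "summable (\<lambda>m. if k \<le> m then r m else 0)" for k
  proof -
    have "summable (\<lambda>m. if k \<le> m + k then r (m + k) else 0)"
      using sr by (simp add: summable_iff_shift)
    then show st: "summable (\<lambda>m. if k \<le> m then r m else 0)"
      by (subst (asm) summable_iff_shift[of "\<lambda>m. if k \<le> m then r m else 0" k])
    show "(\<Sum>i. r (i + k)) = (\<Sum>m. if k \<le> m then r m else 0)"
      unfolding suminf_split_initial_segment[OF st, of k] by simp
  qed
  have nn: "0 \<le> (\<Sum>i. r (i + k))" for k
    using r sr by (intro suminf_nonneg) (auto simp: summable_iff_shift)
  have "(\<Sum>k. ennreal (c k * (\<Sum>i. r (i + k)))) = (\<Sum>k. \<Sum>m. ennreal (c k * (if k \<le> m then r m else 0)))"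
    unfolding tail using c r
    by (intro suminf_cong) (subst suminf_mult[OF st, symmetric], intro suminf_ennreal2[symmetric] summable_mult st, auto)
  also have "\<dots> = (\<Sum>m. \<Sum>k. ennreal (c k * (if k \<le> m then r m else 0)))"
    by (rule suminf_swap_ennreal)
  also have "\<dots> = (\<Sum>m. ennreal (r m * (\<Sum>k\<le>m. c k)))"
  proof (rule suminf_cong)
    fix m
    have "(\<Sum>k. ennreal (c k * (if k \<le> m then r m else 0))) = (\<Sum>k\<le>m. ennreal (c k * (if k \<le> m then r m else 0)))"
      by (rule suminf_finite) auto
    also have "\<dots> = ennreal (\<Sum>k\<le>m. c k * (if k \<le> m then r m else 0))"
      using c r by (intro sum_ennreal) auto
    also have "(\<Sum>k\<le>m. c k * (if k \<le> m then r m else 0)) = r m * (\<Sum>k\<le>m. c k)"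
      by (simp add: sum_distrib_left mult.commute)
    finally show "(\<Sum>k. ennreal (c k * (if k \<le> m then r m else 0))) = ennreal (r m * (\<Sum>k\<le>m. c k))" .
  qed
  also have "\<dots> = ennreal (\<Sum>m. r m * (\<Sum>k\<le>m. c k))"
    using c r by (intro suminf_ennreal2 s) (auto intro!: mult_nonneg_nonneg sum_nonneg)
  finally have e: "(\<Sum>k. ennreal (c k * (\<Sum>i. r (i + k)))) = ennreal (\<Sum>m. r m * (\<Sum>k\<le>m. c k))" .
  have pos: "0 \<le> c k * (\<Sum>i. r (i + k))" for k
    using c nn by simp
  have sm: "summable (\<lambda>k. c k * (\<Sum>i. r (i + k)))"
    using pos e by (intro summable_suminf_not_top) auto
  have "0 \<le> (\<Sum>m. r m * (\<Sum>k\<le>m. c k))"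
    using c r by (intro suminf_nonneg s) (auto intro!: mult_nonneg_nonneg sum_nonneg)
  then have "(\<Sum>k. c k * (\<Sum>i. r (i + k))) = (\<Sum>m. r m * (\<Sum>k\<le>m. c k))"
    using e suminf_ennreal2[OF pos sm] suminf_nonneg[OF sm pos] by simp
  with sm show ?thesis
    by (simp add: sums_iff)
qed

section \<open>Integration against the eigenmeasure\<close>

context induced_system
begin

lemma nu: "prob_space \<nu>" "sets \<nu> = sets borel" "Omega_star \<in> sets \<nu>"
  using eig by (auto simp: induced_eigenpair_def)

lemma CB_measurable:
  fixes f :: "seq \<Rightarrow> 'a::{banach, second_countable_topology}"
  assumes "CB f"
  shows "(\<lambda>x. indicator Omega_star x *\<^sub>R f x) \<in> borel_measurable \<nu>"
proof -
  have "(\<lambda>x. indicator Omega_star x *\<^sub>R f x) \<in> borel_measurable borel"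
    using assms by (intro borel_measurable_continuous_on_indicator Omega_star_borel) (simp add: CB_def)
  then show ?thesis
    by (simp cong: measurable_cong_sets add: nu(2))
qed

lemma CB_integrable:
  fixes f :: "seq \<Rightarrow> 'a::{banach, second_countable_topology}"
  assumes "CB f"
  shows "set_integrable \<nu> Omega_star f"
proof -
  interpret prob_space \<nu> by (rule nu)
  obtain B where B: "0 \<le> B" "\<And>x. x \<in> Omega_star \<Longrightarrow> norm (f x) \<le> B"
    using CB_E[OF assms] by blast
  show ?thesis
    unfolding set_integrable_def
    by (rule integrable_const_bound[of _ B]) (use B CB_measurable[OF assms] in \<open>auto simp: indicator_def\<close>)
qed

lemma set_integral_suminf:
  fixes f :: "nat \<Rightarrow> seq \<Rightarrow> 'a::{banach, second_countable_topology}"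
  assumes c: "\<And>m. CB (f m)" and b: "\<And>m x. x \<in> Omega_star \<Longrightarrow> norm (f m x) \<le> E m" and s: "summable E"
  shows "(LINT x:Omega_star|\<nu>. (\<Sum>m. f m x)) = (\<Sum>m. LINT x:Omega_star|\<nu>. f m x)"
    and "summable (\<lambda>m. LINT x:Omega_star|\<nu>. f m x)"
proof -
  interpret prob_space \<nu> by (rule nu)
  have E: "0 \<le> E m" for m
    using b[of ones m] norm_ge_zero order_trans ones_in_Omega_star by blast
  have ib: "norm (indicator Omega_star x *\<^sub>R f m x) \<le> E m" for m x
    using b[of x m] E[of m] by (auto simp: indicator_def)
  have int: "integrable \<nu> (\<lambda>x. indicator Omega_star x *\<^sub>R f m x)" for m
    using CB_integrable[OF c] by (simp add: set_integrable_def)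
  have sn: "AE x in \<nu>. summable (\<lambda>m. norm (indicator Omega_star x *\<^sub>R f m x))"
    using ib by (intro AE_I2 summable_comparison_test'[OF s, where N = 0]) (simp only: real_norm_def abs_norm_cancel)
  have si: "summable (\<lambda>m. \<integral>x. norm (indicator Omega_star x *\<^sub>R f m x) \<partial>\<nu>)"
  proof (rule summable_comparison_test'[OF s, where N = 0])
    fix m
    have "(\<integral>x. norm (indicator Omega_star x *\<^sub>R f m x) \<partial>\<nu>) \<le> (\<integral>x. E m \<partial>\<nu>)"
      using int ib by (intro integral_mono integrable_norm) auto
    then show "norm (\<integral>x. norm (indicator Omega_star x *\<^sub>R f m x) \<partial>\<nu>) \<le> E m"
      by (simp add: prob_space del: norm_scaleR)
  qed
  show "summable (\<lambda>m. LINT x:Omega_star|\<nu>. f m x)"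
    unfolding set_lebesgue_integral_def by (rule summable_integral[OF int sn si])
  have "(LINT x:Omega_star|\<nu>. (\<Sum>m. f m x)) = (\<integral>x. (\<Sum>m. indicator Omega_star x *\<^sub>R f m x) \<partial>\<nu>)"
    unfolding set_lebesgue_integral_def by (intro Bochner_Integration.integral_cong) (auto simp: indicator_def)
  also have "\<dots> = (\<Sum>m. LINT x:Omega_star|\<nu>. f m x)"
    unfolding set_lebesgue_integral_def by (rule integral_suminf[OF int sn si])
  finally show "(LINT x:Omega_star|\<nu>. (\<Sum>m. f m x)) = (\<Sum>m. LINT x:Omega_star|\<nu>. f m x)" .
qed

lemma set_integral_dominated:
  fixes f :: "nat \<Rightarrow> seq \<Rightarrow> complex"
  assumes c: "\<And>n. CB (f n)" "CB g" and b: "\<And>n x. x \<in> Omega_star \<Longrightarrow> cmod (f n x) \<le> B"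
    and l: "\<And>x. x \<in> Omega_star \<Longrightarrow> (\<lambda>n. f n x) \<longlonglongrightarrow> g x"
  shows "(\<lambda>n. LINT x:Omega_star|\<nu>. f n x) \<longlonglongrightarrow> (LINT x:Omega_star|\<nu>. g x)"
proof -
  interpret prob_space \<nu> by (rule nu)
  have B: "0 \<le> B"
    using b[of ones 0] norm_ge_zero order_trans ones_in_Omega_star by blast
  show ?thesis
    unfolding set_lebesgue_integral_def
  proof (rule integral_dominated_convergence[where w = "\<lambda>_. B"])
    show "AE x in \<nu>. (\<lambda>n. indicator Omega_star x *\<^sub>R f n x) \<longlonglongrightarrow> indicator Omega_star x *\<^sub>R g x"
      using l by (intro AE_I2) (auto simp: indicator_def)
    show "AE x in \<nu>. norm (indicator Omega_star x *\<^sub>R f n x) \<le> B" for n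
      using b B by (intro AE_I2) (auto simp: indicator_def)
  qed (auto intro: CB_measurable c)
qed

text \<open>If \<open>n\<close> blocks agree, so do the first \<open>n\<close> coordinates and the
  difference vanishes. Otherwise \<open>d_theta\<close> is at least \<open>\<theta> ^ n\<close>, and
  the constant \<open>2 * B / \<theta> ^ n\<close> covers the trivial bound.\<close>

lemma cut_in_F_theta:
  fixes f :: "seq \<Rightarrow> complex"
  assumes "CB f"
  shows "(\<lambda>x. f (cut n x)) \<in> F_theta \<theta>"
proof -
  obtain B where B: "0 \<le> B" "\<And>x. x \<in> Omega_star \<Longrightarrow> norm (f x) \<le> B"
    using CB_E[OF assms] by blast
  have "cmod (f (cut n x) - f (cut n y)) \<le> (2 * B / \<theta> ^ n) * d_theta \<theta> x y"
    if xy: "x \<in> Omega_star" "y \<in> Omega_star" for x y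
  proof (cases "agree n x y")
    case True
    then have "cut n x = cut n y"
      using agree_imp_eq[OF xy True] by (auto simp: cut_def)
    then show ?thesis
      using B(1) theta d_theta_nonneg[of \<theta> x y] by simp
  next
    case False
    have "cmod (f (cut n x) - f (cut n y)) \<le> B + B"
      using B(2)[of "cut n x"] B(2)[of "cut n y"]
      by (intro order_trans[OF norm_triangle_ineq4] add_mono) auto
    also have "\<dots> = (2 * B / \<theta> ^ n) * \<theta> ^ n"
      using theta by simp
    also have "\<dots> \<le> (2 * B / \<theta> ^ n) * d_theta \<theta> x y"
      using B(1) theta d_theta_ge[OF theta False] by (intro mult_left_mono) auto
    finally show ?thesis .
  qed
  moreover have "bounded ((\<lambda>x. f (cut n x)) ` Omega_star)"
    using B(2) by (auto simp: bounded_iff intro!: exI[of _ B])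
  ultimately show ?thesis
    unfolding F_theta_def by blast
qed

text \<open>Approximate \<open>f\<close> by functions of finitely many coordinates, which are Lipschitz, so that
  \<open>\<M>\<^sup>*\<nu> = \<nu>\<close> applies to them.\<close>

lemma integral_transfer:
  fixes f :: "seq \<Rightarrow> complex"
  assumes "CB f"
  shows "(LINT x:Omega_star|\<nu>. (\<Sum>m. psi m x *\<^sub>R f (blk m x))) = (LINT x:Omega_star|\<nu>. f x)"
proof -
  obtain B where B: "0 \<le> B" "\<And>x. x \<in> Omega_star \<Longrightarrow> norm (f x) \<le> B"
    using CB_E[OF assms] by blast
  define fn where "fn = (\<lambda>n x. f (cut n x))"
  have CBfn: "CB (fn n)" for n
    unfolding fn_def using assms B
    by (intro CB_I[of _ B] continuous_on_compose2[OF _ continuous_on_cut, of Omega_star f]) (auto simp: CB_def)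
  have lim: "(\<lambda>n. fn n x) \<longlonglongrightarrow> f x" if "x \<in> Omega_star" for x
    unfolding fn_def using assms that cut_tendsto
    by (intro continuous_on_tendsto_compose[of Omega_star f]) (auto simp: CB_def)
  have 1: "(LINT x:Omega_star|\<nu>. M_op V (fn n) x) = (LINT x:Omega_star|\<nu>. fn n x)" for n
    using eig cut_in_F_theta[OF assms, of n] unfolding induced_eigenpair_def fn_def by blast
  have 2: "(LINT x:Omega_star|\<nu>. M_op V (fn n) x)
      = (LINT x:Omega_star|\<nu>. (\<Sum>m. psi m x *\<^sub>R fn n (blk m x)))" for n
    using M_op_eq[OF CBfn] by (intro set_lebesgue_integral_cong nu) auto
  have 3: "(\<lambda>n. LINT x:Omega_star|\<nu>. fn n x) \<longlonglongrightarrow> (LINT x:Omega_star|\<nu>. f x)"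
    using B lim by (intro set_integral_dominated[of _ _ B] CBfn assms) (auto simp: fn_def)
  have 4: "(\<lambda>n. LINT x:Omega_star|\<nu>. (\<Sum>m. psi m x *\<^sub>R fn n (blk m x)))
      \<longlonglongrightarrow> (LINT x:Omega_star|\<nu>. (\<Sum>m. psi m x *\<^sub>R f (blk m x)))"
  proof (rule set_integral_dominated[where B = "\<Sum>m. psi_bd m * B"])
    have bd: "norm (psi m x *\<^sub>R fn n (blk m x)) \<le> psi_bd m * B" if "x \<in> Omega_star" for m n x
      using B that psi_le[of m x] psi_pos[of m x] by (auto simp: fn_def intro!: mult_mono)
    have sb: "summable (\<lambda>m. psi_bd m * B)"
      by (rule summable_mult2[OF summable_psi_bd])
    fix x assume x: "x \<in> Omega_star"
    show "cmod (\<Sum>m. psi m x *\<^sub>R fn n (blk m x)) \<le> (\<Sum>m. psi_bd m * B)" for n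
      by (rule norm_suminf_le[OF bd[OF x] sb])
    show "(\<lambda>n. \<Sum>m. psi m x *\<^sub>R fn n (blk m x)) \<longlonglongrightarrow> (\<Sum>m. psi m x *\<^sub>R f (blk m x))"
    proof (rule conjunct2[OF conjunct2[OF tannerys_theorem[where M = "\<lambda>m. psi_bd m * B"]]])
      show "(\<lambda>n. psi m x *\<^sub>R fn n (blk m x)) \<longlonglongrightarrow> psi m x *\<^sub>R f (blk m x)" for m
        using x by (intro tendsto_scaleR tendsto_const lim) simp
      show "\<forall>\<^sub>F (m, n) in sequentially \<times>\<^sub>F sequentially. norm (psi m x *\<^sub>R fn n (blk m x)) \<le> psi_bd m * B"
        using bd[OF x] by (intro always_eventually allI) (simp add: split_beta del: norm_scaleR)
    qed (use sb in simp_all)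
  qed (intro CB_transfer CBfn assms)+
  show ?thesis
    using LIMSEQ_unique[OF 4] 3 unfolding 1[symmetric] 2 by blast
qed

lemma integral_transfer_real:
  fixes f :: "seq \<Rightarrow> real"
  assumes "CB f"
  shows "(LINT x:Omega_star|\<nu>. (\<Sum>m. psi m x * f (blk m x))) = (LINT x:Omega_star|\<nu>. f x)"
proof -
  have "complex_of_real (LINT x:Omega_star|\<nu>. (\<Sum>m. psi m x * f (blk m x)))
      = (LINT x:Omega_star|\<nu>. (\<Sum>m. psi m x *\<^sub>R complex_of_real (f (blk m x))))"
    unfolding set_integral_complex_of_real[symmetric]
    using summable_psi(2)[OF assms]
    by (intro set_lebesgue_integral_cong nu) (auto simp: suminf_of_real scaleR_conv_of_real)
  also have "\<dots> = complex_of_real (LINT x:Omega_star|\<nu>. f x)"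
    using integral_transfer[OF CB_of_real[OF assms]] by (simp add: set_integral_complex_of_real)
  finally show ?thesis
    by (simp only: of_real_eq_iff)
qed

text \<open>Invariance of \<open>\<nu>\<close> under the transfer operator of the shift itself,
  recovered from the induced one. In the series for the induced operator the term
  \<open>m = 0\<close> gives \<open>k\<close>. By \<open>psi_Suc\<close> the other terms form the
  induced operator applied to \<open>g\<close>, whose integral is that of \<open>g\<close> by the
  same invariance.\<close>

lemma integral_conformal:
  fixes f :: "seq \<Rightarrow> complex"
  assumes "CB f"
  shows "(LINT x:Omega_star|\<nu>. f x) =
    (LINT x:Omega_star|\<nu>. exp (V (conc [False] x)) *\<^sub>R f (conc [False] x)) +
    (LINT x:Omega_star|\<nu>. exp (V (conc [True] x)) *\<^sub>R f (conc [True] x))"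
proof -
  define g where "g = (\<lambda>x. exp (V (conc [False] x)) *\<^sub>R f (conc [False] x))"
  define k where "k = (\<lambda>x. exp (V (conc [True] x)) *\<^sub>R f (conc [True] x))"
  have g: "CB g" and k: "CB k"
    unfolding g_def k_def by (intro CB_scaleR CB_conc[of "\<lambda>x. exp (V x)"] CB_conc[of f] CB_exp_V assms)+
  have "(LINT x:Omega_star|\<nu>. f x) = (LINT x:Omega_star|\<nu>. (\<Sum>m. psi m x *\<^sub>R f (blk m x)))"
    by (rule integral_transfer[OF assms, symmetric])
  also have "\<dots> = (LINT x:Omega_star|\<nu>. (\<Sum>m. psi m x *\<^sub>R g (blk m x)) + k x)"
  proof (intro set_lebesgue_integral_cong nu allI impI)
    fix x assume x: "x \<in> Omega_star"
    have "(\<Sum>m. psi m x *\<^sub>R f (blk m x)) = (\<Sum>m. psi (Suc m) x *\<^sub>R f (blk (Suc m) x)) + psi 0 x *\<^sub>R f (blk 0 x)"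
      using suminf_split_head[OF summable_psi(2)[OF assms x]] by simp
    then show "(\<Sum>m. psi m x *\<^sub>R f (blk m x)) = (\<Sum>m. psi m x *\<^sub>R g (blk m x)) + k x"
      by (simp add: g_def k_def psi_0 psi_Suc conc_False_blk conc_True_eq_blk)
  qed
  also have "\<dots> = (LINT x:Omega_star|\<nu>. (\<Sum>m. psi m x *\<^sub>R g (blk m x))) + (LINT x:Omega_star|\<nu>. k x)"
    by (intro set_integral_add CB_integrable CB_transfer g k)
  also have "(LINT x:Omega_star|\<nu>. (\<Sum>m. psi m x *\<^sub>R g (blk m x))) = (LINT x:Omega_star|\<nu>. g x)"
    by (rule integral_transfer[OF g])
  finally show ?thesis
    by (simp add: g_def k_def)
qed

text \<open>The summands of \<open>e_density\<close>. Relative to \<open>\<nu>\<close>,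
  \<open>w k\<close> is the density of those initial states of the chain in which \<open>k\<close>
  zeros are pending.\<close>

definition w :: "nat \<Rightarrow> seq \<Rightarrow> real" where
  "w k = (L0 V ^^ k) h"

lemma w_0: "w 0 = h"
  by (simp add: w_def)

lemma w_Suc: "w (Suc k) x = exp (V (conc [False] x)) * w k (conc [False] x)"
  by (simp add: w_def L0_def)

lemma CB_w: "CB (w k)"
proof (induction k)
  case (Suc k)
  have "CB (\<lambda>x. exp (V (conc [False] x)) * w k (conc [False] x))"
    by (intro CB_mult CB_conc[of "\<lambda>x. exp (V x)"] CB_conc[of "w k"] CB_exp_V Suc)
  then show ?case
    by (simp add: w_Suc[abs_def])
qed (simp add: w_0 CB_h)

lemma w_pos: "x \<in> Omega_star \<Longrightarrow> 0 < w k x"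
  by (induction k arbitrary: x) (auto simp: w_0 w_Suc h_pos Omega_star_conc)

text \<open>The \<open>k\<close> zeros prepended by \<open>L0\<close> lengthen a block with
  \<open>i\<close> zeros to one with \<open>i + k\<close>, and the exponential weights
  multiply.\<close>

lemma psi_w: "psi i x * w k (blk i x) = psi (i + k) x * h (blk (i + k) x)"
proof (induction k arbitrary: i)
  case (Suc k)
  have "psi i x * w (Suc k) (blk i x) = psi (Suc i) x * w k (blk (Suc i) x)"
    by (simp add: w_Suc psi_Suc conc_False_blk)
  with Suc[of "Suc i"] show ?case
    by simp
qed (simp add: w_0)

text \<open>This is the \<open>rho\<close>-mass of \<open>A_set (Suc m)\<close>, proved in
  \<open>emeasure_rho\<close>, in the form it takes after one application of the induced
  operator.\<close>

definition r :: "nat \<Rightarrow> real" where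
  "r m = (LINT x:Omega_star|\<nu>. psi m x * h (blk m x))"

lemma CB_psi_h: "CB (\<lambda>x. psi m x * h (blk m x))"
  by (intro CB_mult CB_psi CB_blk CB_h)

lemma psi_h_bound:
  obtains B where "0 \<le> B" "\<And>m x. x \<in> Omega_star \<Longrightarrow> \<bar>psi m x * h (blk m x)\<bar> \<le> psi_bd m * B"
proof -
  obtain B where B: "0 \<le> B" "\<And>x. x \<in> Omega_star \<Longrightarrow> norm (h x) \<le> B"
    using CB_E[OF CB_h] by blast
  show thesis
  proof (rule that[OF B(1)])
    fix m x assume "x \<in> Omega_star"
    then show "\<bar>psi m x * h (blk m x)\<bar> \<le> psi_bd m * B"
      using B psi_le[of m x] psi_pos[of m x] by (auto simp: abs_mult intro!: mult_mono)
  qed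
qed

lemma set_integral_nonneg_Omega_star:
  "(\<And>x. x \<in> Omega_star \<Longrightarrow> 0 \<le> f x) \<Longrightarrow> 0 \<le> (LINT x:Omega_star|\<nu>. f x :: real)"
  unfolding set_lebesgue_integral_def by (intro Bochner_Integration.integral_nonneg) (auto simp: indicator_def)

lemma r_nonneg: "0 \<le> r m"
  unfolding r_def using psi_pos h_pos
  by (intro set_integral_nonneg_Omega_star mult_nonneg_nonneg) (auto simp: less_imp_le)

lemma summable_r: "summable r"
proof -
  obtain B where B: "0 \<le> B" "\<And>m x. x \<in> Omega_star \<Longrightarrow> \<bar>psi m x * h (blk m x)\<bar> \<le> psi_bd m * B"
    using psi_h_bound by blast
  show ?thesis
    unfolding r_def[abs_def] using B
    by (intro set_integral_suminf(2)[OF CB_psi_h, where E = "\<lambda>m. psi_bd m * B"] summable_mult2 summable_psi_bd) auto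
qed

text \<open>One application of the induced operator turns \<open>w k\<close> into a series whose
  terms are identified by \<open>psi_w\<close>. The value is the \<open>rho\<close>-probability that
  \<open>tau\<close> exceeds \<open>k\<close>.\<close>

lemma integral_w: "(LINT x:Omega_star|\<nu>. w k x) = (\<Sum>i. r (i + k))"
proof -
  obtain B where B: "0 \<le> B" "\<And>m x. x \<in> Omega_star \<Longrightarrow> \<bar>psi m x * h (blk m x)\<bar> \<le> psi_bd m * B"
    using psi_h_bound by blast
  have "(LINT x:Omega_star|\<nu>. w k x) = (LINT x:Omega_star|\<nu>. (\<Sum>i. psi (i + k) x * h (blk (i + k) x)))"
    using integral_transfer_real[OF CB_w, of k] by (simp add: psi_w)
  also have "\<dots> = (\<Sum>i. r (i + k))"
    unfolding r_def using B summable_psi_bd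
    by (intro set_integral_suminf(1)[OF CB_psi_h, where E = "\<lambda>i. psi_bd (i + k) * B"] summable_mult2)
      (auto simp: summable_iff_shift)
  finally show ?thesis .
qed

lemma emeasure_rho: "emeasure (rho h \<nu>) (A_set (Suc m)) = ennreal (r m)"
proof -
  have CBi: "CB (\<lambda>x. h x * indicat_real (A_set (Suc m)) x)"
    by (intro CB_mult CB_h CB_indicator open_A_set open_compl_A_set)
  have meas: "(\<lambda>x. indicator Omega_star x * ennreal (h x)) \<in> borel_measurable \<nu>"
  proof -
    have "(\<lambda>x. ennreal (indicator Omega_star x *\<^sub>R h x)) \<in> borel_measurable \<nu>"
      using CB_measurable[OF CB_h] by simp
    also have "(\<lambda>x. ennreal (indicator Omega_star x *\<^sub>R h x)) = (\<lambda>x. indicator Omega_star x * ennreal (h x))"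
      by (auto simp: indicator_def)
    finally show ?thesis .
  qed
  have "A_set (Suc m) \<in> sets \<nu>"
    using open_A_set nu(2) by auto
  then have "emeasure (rho h \<nu>) (A_set (Suc m))
      = (\<integral>\<^sup>+x. indicator Omega_star x * ennreal (h x) * indicator (A_set (Suc m)) x \<partial>\<nu>)"
    unfolding rho_def using meas by (rule emeasure_density[rotated])
  also have "\<dots> = (\<integral>\<^sup>+x. ennreal (indicator Omega_star x *\<^sub>R (h x * indicat_real (A_set (Suc m)) x)) \<partial>\<nu>)"
    by (intro nn_integral_cong) (auto simp: indicator_def)
  also have "\<dots> = ennreal (LINT x:Omega_star|\<nu>. h x * indicat_real (A_set (Suc m)) x)"
    unfolding set_lebesgue_integral_def
    using CB_integrable[OF CBi] h_pos
    by (intro nn_integral_eq_integral) (auto simp: set_integrable_def indicator_def less_imp_le)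
  also have "(LINT x:Omega_star|\<nu>. h x * indicat_real (A_set (Suc m)) x) = r m"
  proof -
    have "(LINT x:Omega_star|\<nu>. h x * indicat_real (A_set (Suc m)) x) =
        (LINT x:Omega_star|\<nu>. (\<Sum>i. psi i x * (h (blk i x) * indicat_real (A_set (Suc m)) (blk i x))))"
      by (rule integral_transfer_real[OF CBi, symmetric])
    also have "\<dots> = r m"
      unfolding r_def
    proof (intro set_lebesgue_integral_cong nu allI impI)
      fix x
      have "(\<Sum>i. psi i x * (h (blk i x) * indicat_real (A_set (Suc m)) (blk i x))) =
          (\<Sum>i\<in>{m}. psi i x * (h (blk i x) * indicat_real (A_set (Suc m)) (blk i x)))"
        by (rule suminf_finite) (auto simp: A_set_def)
      then show "(\<Sum>i. psi i x * (h (blk i x) * indicat_real (A_set (Suc m)) (blk i x))) = psi m x * h (blk m x)"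
        by (simp add: A_set_def)
    qed
    finally show ?thesis .
  qed
  finally show ?thesis .
qed

lemma moment_rho: "moment (rho h \<nu>) \<gamma> = (\<Sum>k. ennreal (real (Suc k) powr \<gamma> * r k))"
  unfolding moment_def emeasure_rho by (simp add: ennreal_mult'' r_nonneg ennreal_mult)

text \<open>Averaging the comparison over \<open>y\<close> with respect to \<open>h\<close> times
  \<open>\<nu>\<close> replaces \<open>p m y\<close> by its mean \<open>r m\<close>. This is the
  origin of the dominating sequence: its moments are those of \<open>tau\<close> under
  \<open>rho\<close>, up to the factor \<open>exp C\<close>.\<close>

lemma p_le_r:
  assumes C: "\<And>m x y. x \<in> Omega_star \<Longrightarrow> y \<in> Omega_star \<Longrightarrow> p m x * exp (- C) \<le> p m y"
    and x: "x \<in> Omega_star"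
  shows "p m x \<le> exp C * r m"
proof -
  have "p m x * exp (- C) = (LINT y:Omega_star|\<nu>. p m x * exp (- C) * h y)"
    using eig by (simp add: induced_eigenpair_def)
  also have "\<dots> \<le> (LINT y:Omega_star|\<nu>. psi m y * h (blk m y))"
  proof (intro set_integral_mono CB_integrable CB_mult CB_const CB_h CB_psi_h)
    fix y assume y: "y \<in> Omega_star"
    have "p m x * exp (- C) * h y \<le> p m y * h y"
      using C[OF x y] h_pos[OF y] by (intro mult_right_mono) auto
    then show "p m x * exp (- C) * h y \<le> psi m y * h (blk m y)"
      using h_p[OF y, of m] by (simp add: mult.commute)
  qed (intro CB_psi CB_blk CB_h)+
  finally show ?thesis
    by (simp add: r_def exp_minus field_simps)
qed

end

section \<open>Functions of polynomial variation\<close>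

lemma compact_UNIV_seq: "compact (UNIV :: seq set)"
proof -
  have "compact (UNIV :: bool set)"
    by (rule finite_imp_compact) simp
  then have "compact_space (product_topology (\<lambda>i::nat. euclidean :: bool topology) UNIV)"
    unfolding compact_space_product_topology by (simp add: compact_space_def)
  then show ?thesis
    by (simp add: euclidean_product_topology compact_space_def)
qed

text \<open>The real suprema in \<open>var\<close> and \<open>H_norm\<close> have to be shown to be
  taken over nonempty bounded sets. Boundedness comes from the compactness of \<Omega> and, for the
  weighted variations, from the constant in \<open>H_space\<close>.\<close>

lemma H_space_bounds:
  assumes f: "f \<in> H_space a" and a: "0 \<le> a"
  shows "cmod (f x) \<le> H_norm a f"
    and "0 < L \<Longrightarrow> (\<And>i. i < L \<Longrightarrow> x i = y i) \<Longrightarrow> cmod (f x - f y) \<le> H_norm a f * real L powr (- a)"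
    and "0 \<le> H_norm a f"
proof -
  obtain C where cont: "continuous_on UNIV f" and C: "\<And>n. n > 0 \<Longrightarrow> var n f \<le> C * real n powr (- a)"
    using f by (auto simp: H_space_def)
  have "compact (range f)"
    using cont compact_UNIV_seq by (rule compact_continuous_image)
  then have "bounded (range f)"
    by (rule compact_imp_bounded)
  then have "\<exists>B. \<forall>x. cmod (f x) \<le> B"
    by (simp add: bounded_iff)
  then obtain B where B: "\<And>x. cmod (f x) \<le> B"
    by (elim exE) (rule that, erule spec)
  define S where "S = (SUP x. cmod (f x))"
  define T where "T = (SUP n\<in>{0<..}. real n powr a * var n f)"
  have HN: "H_norm a f = S + T"
    by (simp add: H_norm_def S_def T_def)
  have S: "cmod (f x) \<le> S" for x
    unfolding S_def using B by (intro cSUP_upper bdd_aboveI[of _ B]) auto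
  have var: "cmod (f x - f y) \<le> var n f" if "first_diff x y = enat n" for x y n
  proof -
    have "cmod (f x - f y) \<le> B + B" for x y
      by (intro order_trans[OF norm_triangle_ineq4] add_mono B)
    then have "bdd_above ((\<lambda>(x, y). cmod (f x - f y)) ` {(x, y). first_diff x y = enat n})"
      by (intro bdd_aboveI[of _ "B + B"]) auto
    then show ?thesis
      unfolding var_def using that by (intro cSUP_upper2[where x = "(x, y)"]) auto
  qed
  have T: "real n powr a * var n f \<le> T" if "n > 0" for n
    unfolding T_def
  proof (rule cSUP_upper)
    show "bdd_above ((\<lambda>n. real n powr a * var n f) ` {0<..})"
    proof (rule bdd_aboveI[of _ C])
      fix z assume "z \<in> (\<lambda>n. real n powr a * var n f) ` {0<..}"
      then obtain n where n: "n > 0" "z = real n powr a * var n f"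
        by auto
      have "z \<le> real n powr a * (C * real n powr (- a))"
        unfolding n(2) using C[OF n(1)] by (intro mult_left_mono) auto
      also have "\<dots> = C"
        using n(1) by (simp add: powr_minus)
      finally show "z \<le> C" .
    qed
  qed (use that in auto)
  have S0: "0 \<le> S"
    using S[of zero_seq] norm_ge_zero order_trans by blast
  have T0: "0 \<le> T"
  proof -
    \<comment> \<open>An explicit pair with first difference 1 makes the set behind
      \<open>var 1 f\<close> nonempty, so this supremum is non-negative.\<close>
    have "first_diff zero_seq (\<lambda>i. i = 1) = enat 1"
    proof (rule antisym)
      show "first_diff zero_seq (\<lambda>i. i = 1) \<le> enat 1"
        unfolding first_diff_def by (rule INF_lower2[of 1]) (auto simp: zero_seq_def)
      show "enat 1 \<le> first_diff zero_seq (\<lambda>i. i = 1)"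
        unfolding first_diff_ge_iff by (auto simp: zero_seq_def)
    qed
    from var[OF this] have "0 \<le> var 1 f"
      by (rule order_trans[OF norm_ge_zero])
    then show ?thesis
      using T[of 1] by simp
  qed
  show "cmod (f x) \<le> H_norm a f" "0 \<le> H_norm a f"
    using S[of x] S0 T0 by (auto simp: HN)
  show "cmod (f x - f y) \<le> H_norm a f * real L powr (- a)" if L: "0 < L" "\<And>i. i < L \<Longrightarrow> x i = y i"
  proof (cases "first_diff x y")
    case (enat n)
    have n: "L \<le> n"
      using L(2) enat first_diff_ge_iff[of L x y] by auto
    have T': "cmod (f x - f y) * real n powr a \<le> T"
      using order_trans[OF mult_left_mono[OF var[OF enat], of "real n powr a"] T[of n]] n L(1)
      by (simp add: mult.commute)
    have "cmod (f x - f y) * real L powr a \<le> cmod (f x - f y) * real n powr a"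
      using n a by (intro mult_left_mono powr_mono2) auto
    then have "cmod (f x - f y) * real L powr a \<le> H_norm a f"
      using T' S0 by (simp add: HN)
    then show ?thesis
      using L(1) by (simp add: powr_minus field_simps)
  next
    case infinity
    then have "x = y"
      by (simp add: first_diff_eq_infinity_iff)
    then show ?thesis
      using S0 T0 by (simp add: HN)
  qed
qed

section \<open>Duality\<close>

context induced_system
begin

lemma weighted_integral_bound:
  fixes Q :: "seq \<Rightarrow> complex"
  assumes Q: "CB Q" "\<And>x. x \<in> Omega_star \<Longrightarrow> cmod (Q x) \<le> B"
  shows "cmod (LINT x:Omega_star|\<nu>. w k x *\<^sub>R Q x) \<le> B * (LINT x:Omega_star|\<nu>. w k x)"
proof -
  have "cmod (LINT x:Omega_star|\<nu>. w k x *\<^sub>R Q x) \<le> (LINT x:Omega_star|\<nu>. cmod (w k x *\<^sub>R Q x))"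
    by (intro set_integral_norm_bound CB_integrable CB_scaleR CB_w Q)
  also have "\<dots> \<le> (LINT x:Omega_star|\<nu>. B * w k x)"
  proof (intro set_integral_mono set_integrable_norm CB_integrable CB_mult CB_const CB_w)
    show "CB (\<lambda>x. w k x *\<^sub>R Q x)"
      by (intro CB_scaleR CB_w Q)
    show "cmod (w k x *\<^sub>R Q x) \<le> B * w k x" if "x \<in> Omega_star" for x
      using mult_left_mono[OF Q(2)[OF that], of "w k x"] w_pos[OF that, of k] by (simp add: mult.commute)
  qed
  finally show ?thesis
    by simp
qed

text \<open>The unnormalised expectation over the initial state \<open>(k, x)\<close>; when
  \<open>Q\<close> does not depend on \<open>k\<close> this is integration against
  \<open>mu\<close>. The index \<open>k\<close> is kept because the chain depends on the number of
  pending zeros.\<close>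

definition Lam :: "(nat \<Rightarrow> seq \<Rightarrow> complex) \<Rightarrow> complex" where
  "Lam Q = (\<Sum>k. LINT x:Omega_star|\<nu>. w k x *\<^sub>R Q k x)"

lemma Lam_bound:
  assumes Q: "\<And>k. CB (Q k)" "\<And>k x. x \<in> Omega_star \<Longrightarrow> cmod (Q k x) \<le> B k"
    and s: "summable (\<lambda>k. B k * (LINT x:Omega_star|\<nu>. w k x))"
  shows "summable (\<lambda>k. LINT x:Omega_star|\<nu>. w k x *\<^sub>R Q k x)"
    and "cmod (Lam Q) \<le> (\<Sum>k. B k * (LINT x:Omega_star|\<nu>. w k x))"
proof -
  note b = weighted_integral_bound[OF Q]
  show "summable (\<lambda>k. LINT x:Omega_star|\<nu>. w k x *\<^sub>R Q k x)"
    using b by (intro summable_comparison_test'[OF s, where N = 0])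
  show "cmod (Lam Q) \<le> (\<Sum>k. B k * (LINT x:Omega_star|\<nu>. w k x))"
    unfolding Lam_def using b s by (rule norm_suminf_le)
qed

text \<open>Writing \<open>x\<close> as \<open>blk i y\<close>, the series is by
  \<open>psi_w\<close> a tail of the convergent series for \<open>h y\<close>, divided by
  \<open>psi i y\<close>. So \<open>e_density\<close> is finite on
  \<open>Omega_star\<close>.\<close>

lemma summable_w:
  assumes "x \<in> Omega_star"
  shows "summable (\<lambda>k. w k x)"
proof -
  obtain i y where x: "x = blk i y" "y \<in> Omega_star"
    using Omega_star_cases[OF assms] by blast
  have "summable (\<lambda>k. psi (k + i) y * h (blk (k + i) y) / psi i y)"
    using h_eq[OF x(2)] by (intro summable_divide) (auto simp: summable_iff_shift[of "\<lambda>k. psi k y * h (blk k y)"] sums_iff)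
  also have "(\<lambda>k. psi (k + i) y * h (blk (k + i) y) / psi i y) = (\<lambda>k. w k x)"
    using psi_w[of i y] psi_pos[of i y] by (auto simp: x add.commute field_simps)
  finally show ?thesis .
qed

lemma sum_r: "(\<Sum>m. r m) = 1"
  using integral_w[of 0] eig by (simp add: w_0 induced_eigenpair_def)

lemma integral_w_nonneg: "0 \<le> (LINT x:Omega_star|\<nu>. w k x)"
  by (intro set_integral_nonneg_Omega_star less_imp_le w_pos)

end

section \<open>The chain started from the invariant measure\<close>

locale finite_mean_system = induced_system V \<theta> h \<nu> + renewal_chain "induced_system.p V h" \<theta> C \<gamma> P
  for V \<theta> h \<nu> C \<gamma> P +
  assumes P_eq: "P = (\<lambda>m. exp C * induced_system.r V h \<nu> m)"
begin

abbreviation W :: "nat \<Rightarrow> real" where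
  "W k \<equiv> (LINT x:Omega_star|\<nu>. w k x)"

definition M1 :: real where
  "M1 = (\<Sum>m. r m * real (Suc m))"

lemma summable_r_mean: "summable (\<lambda>m. r m * real (Suc m))"
  using summable_mult[OF P_summable1, of "exp (- C)"]
  by (simp add: P_eq mult.assoc[symmetric] exp_minus_inverse exp_minus del: of_nat_Suc)

lemma W_sums: "W sums M1"
  using tail_sums[of "\<lambda>_. 1" r] summable_r_mean r_nonneg summable_r
  by (simp add: integral_w M1_def del: of_nat_Suc)

lemma M1_ge_1: "1 \<le> M1"
proof -
  have "r m \<le> r m * real (Suc m)" for m
    using mult_left_mono[OF _ r_nonneg, of 1 "real (Suc m)" m] by simp
  then have "(\<Sum>m. r m) \<le> M1"
    unfolding M1_def by (intro suminf_le summable_r summable_r_mean)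
  then show ?thesis
    by (simp add: sum_r)
qed

lemma moment_1: "moment (rho h \<nu>) 1 = ennreal M1"
  unfolding moment_rho M1_def using r_nonneg summable_r_mean
  by (subst suminf_ennreal2) (auto simp: mult.commute)

text \<open>By \<open>tail_sums\<close> the weights up to \<open>m\<close> are summed against
  \<open>r m\<close>, and they add up to at most \<open>(m + 1) * gw R \<gamma> (m + 1)\<close>. The
  number of pending zeros thus has one moment less than the block length.\<close>

lemma weighted_W_summable:
  assumes R: "1 \<le> R"
  shows "summable (\<lambda>k. gw R \<gamma> k * W k)"
proof -
  have s: "summable (\<lambda>m. r m * (\<Sum>k\<le>m. gw R \<gamma> k))"
  proof (rule summable_comparison_test'[OF summable_mult[OF P_summable_weight[OF R], of "exp (- C)"], where N = 0])
    fix m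
    have "(\<Sum>k\<le>m. gw R \<gamma> k) \<le> (\<Sum>k\<le>m. gw R \<gamma> (Suc m))"
      by (intro sum_mono gw_mono[OF R gamma]) auto
    then have "r m * (\<Sum>k\<le>m. gw R \<gamma> k) \<le> r m * (real (Suc m) * gw R \<gamma> (Suc m))"
      using r_nonneg by (intro mult_left_mono) auto
    also have "\<dots> = exp (- C) * (P m * real (Suc m) * gw R \<gamma> (Suc m))"
      by (simp add: P_eq exp_minus)
    finally show "norm (r m * (\<Sum>k\<le>m. gw R \<gamma> k)) \<le> exp (- C) * (P m * real (Suc m) * gw R \<gamma> (Suc m))"
      using r_nonneg[of m] sum_nonneg[of "{..m}" "gw R \<gamma>"] order_trans[OF zero_le_one gw_ge_1[OF R gamma]]
      by (simp add: abs_mult del: of_nat_Suc)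
  qed
  have "0 \<le> gw R \<gamma> k" for k
    using gw_ge_1[OF R gamma, of k] by simp
  from tail_sums[OF this r_nonneg summable_r s] show ?thesis
    by (simp add: integral_w sums_iff)
qed

lemma CB_chain_op:
  assumes f: "continuous_on UNIV f" "\<And>x. cmod (f x) \<le> 1"
  shows "CB (chain_op p f n k)"
proof (induction n arbitrary: k)
  case 0
  show ?case
    using f continuous_on_subset[OF f(1), of Omega_star] by (auto intro!: CB_I[of _ 1] simp: fun_eq_iff)
next
  case (Suc n)
  show ?case
  proof (cases k)
    case 0
    have "CB (\<lambda>y. \<Sum>m. p m y *\<^sub>R chain_op p f n m (conc [True] y))"
    proof (rule CB_suminf[OF _ _ P_summable0])
      fix m
      have "CB (\<lambda>y. p m y *\<^sub>R chain_op p f n m (conc [True] y))"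
        by (intro CB_scaleR CB_p CB_conc[of "chain_op p f n m"] Suc)
      then show "continuous_on Omega_star (\<lambda>y. p m y *\<^sub>R chain_op p f n m (conc [True] y))"
        by (simp add: CB_def)
      fix y assume y: "y \<in> Omega_star"
      have "p m y * cmod (chain_op p f n m (conc [True] y)) \<le> P m * 1"
        using p_le[OF y, of m] p_pos[OF y, of m] P_pos[of m] chain_op_norm[OF f(2), where n = n and k = m and y = "conc [True] y"] y
        by (intro mult_mono) (auto simp: Omega_star_conc)
      then show "norm (p m y *\<^sub>R chain_op p f n m (conc [True] y)) \<le> P m"
        using p_pos[OF y, of m] by simp
    qed
    then show ?thesis
      using 0 by simp
  next
    case (Suc k')
    have "CB (\<lambda>y. chain_op p f n k' (conc [False] y))"
      by (intro CB_conc[of "chain_op p f n k'"] Suc.IH)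
    then show ?thesis
      using Suc by simp
  qed
qed

text \<open>Apply \<open>integral_conformal\<close> to each summand; the shift inside
  \<open>g\<close> disappears. Prepending 0 turns \<open>w k\<close> into \<open>w (Suc k)\<close>
  and is the deterministic move from \<open>Suc k\<close> pending zeros to \<open>k\<close>, which
  gives \<open>L (Suc k)\<close>. Prepending 1 gives \<open>D k\<close> with the weight
  \<open>psi k x * h (blk k x) = h x * p k x\<close>, so the sum over \<open>k\<close> is the choice
  of a new block and equals \<open>L 0\<close>.\<close>

lemma duality_step:
  assumes f: "continuous_on UNIV f" "\<And>x. cmod (f x) \<le> 1" and g: "CB g"
  shows "Lam (\<lambda>k x. chain_op p f n k x * g (suffix (Suc 0) x)) = Lam (\<lambda>k x. chain_op p f (Suc n) k x * g x)"
proof -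
  define Q where "Q = chain_op p f n"
  define Q' where "Q' = chain_op p f (Suc n)"
  have Q: "CB (Q k)" and Q': "CB (Q' k)" for k
    unfolding Q_def Q'_def by (intro CB_chain_op f)+
  have Q1: "cmod (Q k x) \<le> 1" and Q1': "cmod (Q' k x) \<le> 1" if "x \<in> Omega_star" for k x
    unfolding Q_def Q'_def by (intro chain_op_norm f that)+
  obtain G where G: "0 \<le> G" "\<And>x. x \<in> Omega_star \<Longrightarrow> cmod (g x) \<le> G"
    using CB_E[OF g] by blast
  obtain B where B: "0 \<le> B" "\<And>m x. x \<in> Omega_star \<Longrightarrow> \<bar>psi m x * h (blk m x)\<bar> \<le> psi_bd m * B"
    using psi_h_bound by blast
  define L where "L = (\<lambda>k. LINT x:Omega_star|\<nu>. w k x *\<^sub>R (Q' k x * g x))"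
  define D where "D = (\<lambda>k. LINT x:Omega_star|\<nu>. (psi k x * h (blk k x)) *\<^sub>R (Q k (conc [True] x) * g x))"
  have sL: "summable L"
    unfolding L_def
  proof (rule Lam_bound(1)[where B = "\<lambda>_. G"])
    show "cmod (Q' k x * g x) \<le> G" if "x \<in> Omega_star" for k x
      using mult_mono[OF Q1'[OF that] G(2)[OF that]] by (simp add: norm_mult)
    show "summable (\<lambda>k. G * W k)"
      using W_sums by (intro summable_mult) (simp add: sums_iff)
  qed (intro CB_mult Q' g)
  have Db: "norm ((psi k x * h (blk k x)) *\<^sub>R (Q k (conc [True] x) * g x)) \<le> psi_bd k * B * G"
    if x: "x \<in> Omega_star" for k x
  proof -
    have "cmod (Q k (conc [True] x) * g x) \<le> 1 * G"
      unfolding norm_mult using Q1 G x by (intro mult_mono) (auto simp: Omega_star_conc)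
    then show ?thesis
      unfolding norm_scaleR using B(2)[OF x, of k] by (intro mult_mono) (auto intro: order_trans[OF abs_ge_zero])
  qed
  have CBD: "CB (\<lambda>x. (psi k x * h (blk k x)) *\<^sub>R (Q k (conc [True] x) * g x))" for k
    by (intro CB_scaleR CB_psi_h CB_mult[of "\<lambda>x. Q k (conc [True] x)"] CB_conc[of "Q k"] Q g)
  have sB: "summable (\<lambda>k. psi_bd k * B * G)"
    by (intro summable_mult2 summable_psi_bd)
  have sD: "summable D"
    unfolding D_def by (rule set_integral_suminf(2)[OF CBD Db sB])
  have "suminf D = (LINT x:Omega_star|\<nu>. (\<Sum>k. (psi k x * h (blk k x)) *\<^sub>R (Q k (conc [True] x) * g x)))"
    unfolding D_def by (rule set_integral_suminf(1)[OF CBD Db sB, symmetric])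
  also have "\<dots> = L 0"
    unfolding L_def
  proof (intro set_lebesgue_integral_cong nu allI impI)
    fix x assume x: "x \<in> Omega_star"
    have s: "summable (\<lambda>k. p k x *\<^sub>R Q k (conc [True] x))"
      using summable_p_scaleR[OF x, of "\<lambda>k. Q k (conc [True] x)" "\<lambda>k. p k x"] Q1 x p_pos[OF x]
      by (auto simp: Omega_star_conc less_imp_le)
    have "(\<Sum>k. (psi k x * h (blk k x)) *\<^sub>R (Q k (conc [True] x) * g x)) =
        (\<Sum>k. h x *\<^sub>R (p k x *\<^sub>R Q k (conc [True] x) * g x))"
      by (simp add: h_p[OF x, symmetric])
    also have "\<dots> = h x *\<^sub>R (\<Sum>k. p k x *\<^sub>R Q k (conc [True] x) * g x)"
      by (rule suminf_scaleR_right[symmetric]) (rule summable_mult2[OF s])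
    also have "(\<Sum>k. p k x *\<^sub>R Q k (conc [True] x) * g x) = Q' 0 x * g x"
      using suminf_mult2[OF s, of "g x"] by (simp add: Q'_def Q_def)
    finally show "(\<Sum>k. (psi k x * h (blk k x)) *\<^sub>R (Q k (conc [True] x) * g x)) = w 0 x *\<^sub>R (Q' 0 x * g x)"
      by (simp add: w_0)
  qed
  finally have D: "suminf D = L 0" .
  have "(LINT x:Omega_star|\<nu>. w k x *\<^sub>R (Q k x * g (suffix (Suc 0) x))) = L (Suc k) + D k" for k
  proof -
    have CBf: "CB (\<lambda>x. w k x *\<^sub>R (Q k x * g (suffix (Suc 0) x)))"
      by (intro CB_scaleR CB_w CB_mult[of "Q k"] Q CB_suffix g)
    show ?thesis
      unfolding integral_conformal[OF CBf] L_def D_def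
      by (intro arg_cong2[where f = "(+)"] set_lebesgue_integral_cong nu)
        (auto simp: suffix_1_conc w_Suc Q'_def Q_def psi_w[of 0 _ k, symmetric, simplified] psi_0 conc_True_eq_blk[symmetric])
  qed
  then have "Lam (\<lambda>k x. Q k x * g (suffix (Suc 0) x)) = (\<Sum>k. L (Suc k) + D k)"
    by (simp add: Lam_def)
  also have "\<dots> = (\<Sum>k. L (Suc k)) + suminf D"
    using sL sD by (intro suminf_add[symmetric]) (auto simp: summable_Suc_iff)
  also have "\<dots> = suminf L"
    using suminf_split_head[OF sL] D by simp
  finally show ?thesis
    by (simp add: Q_def Q'_def L_def Lam_def)
qed

lemma duality:
  assumes f: "continuous_on UNIV f" "\<And>x. cmod (f x) \<le> 1" and g: "CB g"
  shows "Lam (\<lambda>k x. f x * g (suffix n x)) = Lam (\<lambda>k x. chain_op p f n k x * g x)"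
proof -
  have "Lam (\<lambda>k x. chain_op p f i k x * g (suffix n x)) = Lam (\<lambda>k x. chain_op p f (i + n) k x * g x)" for i
  proof (induction n arbitrary: i)
    case (Suc n)
    have "Lam (\<lambda>k x. chain_op p f i k x * g (suffix n (suffix (Suc 0) x)))
        = Lam (\<lambda>k x. chain_op p f (Suc i) k x * g (suffix n x))"
      by (rule duality_step[OF f, where g = "\<lambda>x. g (suffix n x)"]) (rule CB_suffix[OF g])
    moreover have "suffix (Suc n) x = suffix n (suffix (Suc 0) x)" for x :: seq
      by simp
    ultimately show ?case
      using Suc[of "Suc i"] by (simp only: add_Suc add_Suc_right)
  qed simp
  from this[of 0] show ?thesis
    by simp
qed

text \<open>The extended-valued density becomes a real one, finite at every point by
  \<open>summable_w\<close>, as Bochner integration requires.\<close>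

lemma mu_hat_density:
  "mu_hat V h \<nu> = density \<nu> (\<lambda>x. ennreal ((\<Sum>k. indicator Omega_star x *\<^sub>R w k x) / M1))"
    and density_measurable: "(\<lambda>x. \<Sum>k. indicator Omega_star x *\<^sub>R w k x) \<in> borel_measurable \<nu>"
    and density_nonneg: "0 \<le> (\<Sum>k. indicator Omega_star x *\<^sub>R w k x)"
    and density_summable: "summable (\<lambda>k. indicator Omega_star x *\<^sub>R w k x)"
proof -
  define D where "D = (\<lambda>x. \<Sum>k. indicator Omega_star x *\<^sub>R w k x)"
  have s: "summable (\<lambda>k. indicator Omega_star x *\<^sub>R w k x)" for x
    using summable_w[of x] by (cases "x \<in> Omega_star") auto
  then show "summable (\<lambda>k. indicator Omega_star x *\<^sub>R w k x)" .
  have pos: "0 \<le> indicator Omega_star x *\<^sub>R w k x" for k x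
    using w_pos[of x k] by (auto simp: indicator_def)
  then have D0: "0 \<le> D x" for x
    unfolding D_def by (intro suminf_nonneg s)
  then show "0 \<le> (\<Sum>k. indicator Omega_star x *\<^sub>R w k x)"
    by (simp add: D_def)
  have meas: "D \<in> borel_measurable \<nu>"
    unfolding D_def by (intro borel_measurable_suminf CB_measurable CB_w)
  then show "(\<lambda>x. \<Sum>k. indicator Omega_star x *\<^sub>R w k x) \<in> borel_measurable \<nu>"
    by (simp add: D_def)
  have "indicator Omega_star x * e_density V h x = ennreal (D x)" for x
  proof -
    have "indicator Omega_star x * e_density V h x = (\<Sum>k. ennreal (indicator Omega_star x *\<^sub>R w k x))"
      by (cases "x \<in> Omega_star") (auto simp: e_density_def w_def)
    also have "\<dots> = ennreal (D x)"
      unfolding D_def by (intro suminf_ennreal2 pos s)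
    finally show ?thesis .
  qed
  then have mu: "mu V h \<nu> = density \<nu> (\<lambda>x. ennreal (D x))"
    by (simp add: mu_def)
  have M1: "0 < M1"
    using M1_ge_1 by simp
  have "mu_hat V h \<nu> = density \<nu> (\<lambda>x. ennreal (D x / M1))"
  proof (rule measure_eqI)
    fix A assume "A \<in> sets (mu_hat V h \<nu>)"
    then have A: "A \<in> sets \<nu>"
      by (simp add: mu_hat_def mu)
    have "emeasure (mu_hat V h \<nu>) A = inverse (ennreal M1) * (\<integral>\<^sup>+x. ennreal (D x) * indicator A x \<partial>\<nu>)"
      using A meas by (simp add: mu_hat_def moment_1 mu emeasure_density)
    also have "\<dots> = (\<integral>\<^sup>+x. inverse (ennreal M1) * (ennreal (D x) * indicator A x) \<partial>\<nu>)"
      using A meas by (intro nn_integral_cmult[symmetric]) auto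
    also have "\<dots> = (\<integral>\<^sup>+x. ennreal (D x / M1) * indicator A x \<partial>\<nu>)"
      using M1 D0 by (intro nn_integral_cong)
        (simp add: inverse_ennreal mult.assoc[symmetric] ennreal_mult[symmetric] divide_inverse mult.commute)
    also have "\<dots> = emeasure (density \<nu> (\<lambda>x. ennreal (D x / M1))) A"
      using A meas by (subst emeasure_density) auto
    finally show "emeasure (mu_hat V h \<nu>) A = emeasure (density \<nu> (\<lambda>x. ennreal (D x / M1))) A" .
  qed (simp add: mu_hat_def mu)
  then show "mu_hat V h \<nu> = density \<nu> (\<lambda>x. ennreal ((\<Sum>k. indicator Omega_star x *\<^sub>R w k x) / M1))"
    by (simp add: D_def)
qed

lemma integral_mu_hat:
  fixes F :: "seq \<Rightarrow> complex"
  assumes F: "continuous_on UNIV F" and B: "\<And>x. cmod (F x) \<le> B"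
  shows "(LINT x|mu_hat V h \<nu>. F x) = Lam (\<lambda>k. F) / M1"
proof -
  have CBF: "CB F"
    using B continuous_on_subset[OF F, of Omega_star] by (intro CB_I) auto
  have M1: "0 < M1"
    using M1_ge_1 by simp
  have Fm: "F \<in> borel_measurable \<nu>"
    using borel_measurable_continuous_onI[OF F] by (simp cong: measurable_cong_sets add: nu(2))
  define T where "T = (\<lambda>k x. indicator Omega_star x *\<^sub>R (w k x *\<^sub>R F x))"
  have CBT: "CB (\<lambda>x. w k x *\<^sub>R F x)" for k
    by (intro CB_scaleR CB_w CBF)
  have int: "integrable \<nu> (T k)" for k
    using CB_integrable[OF CBT, of k] by (simp add: T_def set_integrable_def)
  have sn: "AE x in \<nu>. summable (\<lambda>k. norm (T k x))"
  proof (rule AE_I2, rule summable_comparison_test'[OF summable_mult2[OF density_summable, of _ B], where N = 0])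
    fix x k
    show "norm (norm (T k x)) \<le> indicator Omega_star x *\<^sub>R w k x * B"
      using w_pos[of x k] B[of x] by (auto simp: T_def indicator_def intro!: mult_left_mono)
  qed
  have si: "summable (\<lambda>k. \<integral>x. norm (T k x) \<partial>\<nu>)"
  proof (rule summable_comparison_test'[OF summable_mult[OF sums_summable[OF W_sums], of B], where N = 0])
    fix k
    have "(\<integral>x. norm (T k x) \<partial>\<nu>) = (LINT x:Omega_star|\<nu>. cmod (w k x *\<^sub>R F x))"
      unfolding set_lebesgue_integral_def T_def
      by (intro Bochner_Integration.integral_cong) (auto simp: indicator_def)
    also have "\<dots> \<le> (LINT x:Omega_star|\<nu>. B * w k x)"
      using w_pos B by (intro set_integral_mono set_integrable_norm CB_integrable CBT CB_mult CB_const CB_w)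
        (auto simp: mult.commute less_imp_le intro!: mult_mono)
    finally have "(\<integral>x. norm (T k x) \<partial>\<nu>) \<le> B * W k"
      by simp
    moreover have "0 \<le> (\<integral>x. norm (T k x) \<partial>\<nu>)"
      by (intro Bochner_Integration.integral_nonneg) auto
    ultimately show "norm (\<integral>x. norm (T k x) \<partial>\<nu>) \<le> B * W k"
      by simp
  qed
  have "(LINT x|mu_hat V h \<nu>. F x) = (\<integral>x. ((\<Sum>k. indicator Omega_star x *\<^sub>R w k x) / M1) *\<^sub>R F x \<partial>\<nu>)"
    unfolding mu_hat_density using M1 density_nonneg
    by (intro integral_density Fm borel_measurable_divide density_measurable AE_I2) auto
  also have "\<dots> = (\<integral>x. (1 / M1) *\<^sub>R (\<Sum>k. T k x) \<partial>\<nu>)"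
  proof (intro Bochner_Integration.integral_cong refl)
    fix x
    have "(\<Sum>k. T k x) = (\<Sum>k. indicator Omega_star x *\<^sub>R w k x) *\<^sub>R F x"
      using suminf_scaleR_left[OF density_summable[of x], of "F x"] by (simp add: T_def)
    then show "((\<Sum>k. indicator Omega_star x *\<^sub>R w k x) / M1) *\<^sub>R F x = (1 / M1) *\<^sub>R (\<Sum>k. T k x)"
      by simp
  qed
  also have "\<dots> = (1 / M1) *\<^sub>R (\<Sum>k. integral\<^sup>L \<nu> (T k))"
    by (simp add: integral_suminf[OF int sn si])
  also have "(\<Sum>k. integral\<^sup>L \<nu> (T k)) = Lam (\<lambda>k. F)"
    by (simp add: Lam_def T_def set_lebesgue_integral_def)
  finally show ?thesis
    by (simp add: scaleR_conv_of_real)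
qed

end

section \<open>Decay of correlations\<close>

context finite_mean_system
begin

lemma Lam_centred:
  assumes Q: "\<And>k. CB (Q k)" "\<And>k x. x \<in> Omega_star \<Longrightarrow> cmod (Q k x) \<le> 1"
    and g: "CB g" "\<And>x. cmod (g x) \<le> 1"
  shows "Lam (\<lambda>k x. Q k x * g x) - c * Lam (\<lambda>k. g) = Lam (\<lambda>k x. (Q k x - c) * g x)"
proof -
  have sW: "summable (\<lambda>k. 1 * W k)"
    using W_sums by (simp add: sums_iff)
  have s1: "summable (\<lambda>k. LINT x:Omega_star|\<nu>. w k x *\<^sub>R (Q k x * g x))"
  proof (rule Lam_bound(1)[OF _ _ sW])
    show "cmod (Q k x * g x) \<le> 1" if "x \<in> Omega_star" for k x
      using mult_mono[OF Q(2)[OF that] g(2)] by (simp add: norm_mult)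
  qed (intro CB_mult Q g)
  have s2: "summable (\<lambda>k. LINT x:Omega_star|\<nu>. w k x *\<^sub>R g x)"
    using g by (intro Lam_bound(1)[OF _ _ sW])
  have "Lam (\<lambda>k x. (Q k x - c) * g x) =
      (\<Sum>k. (LINT x:Omega_star|\<nu>. w k x *\<^sub>R (Q k x * g x)) - c * (LINT x:Omega_star|\<nu>. w k x *\<^sub>R g x))"
    unfolding Lam_def
  proof (rule suminf_cong)
    fix k
    have "(LINT x:Omega_star|\<nu>. w k x *\<^sub>R ((Q k x - c) * g x))
        = (LINT x:Omega_star|\<nu>. w k x *\<^sub>R (Q k x * g x) - c * (w k x *\<^sub>R g x))"
      by (intro set_lebesgue_integral_cong nu) (auto simp: algebra_simps)
    also have "\<dots> = (LINT x:Omega_star|\<nu>. w k x *\<^sub>R (Q k x * g x)) - (LINT x:Omega_star|\<nu>. c * (w k x *\<^sub>R g x))"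
      by (intro set_integral_diff CB_integrable CB_scaleR CB_w CB_mult[of "Q k"] CB_mult[of "\<lambda>_. c"] CB_const Q g)
    finally show "(LINT x:Omega_star|\<nu>. w k x *\<^sub>R ((Q k x - c) * g x))
        = (LINT x:Omega_star|\<nu>. w k x *\<^sub>R (Q k x * g x)) - c * (LINT x:Omega_star|\<nu>. w k x *\<^sub>R g x)"
      by (simp only: set_integral_mult_right)
  qed
  also have "\<dots> = Lam (\<lambda>k x. Q k x * g x) - c * Lam (\<lambda>k. g)"
    unfolding Lam_def using s1 s2
    by (subst suminf_diff[symmetric]) (auto simp: suminf_mult summable_mult)
  finally show ?thesis ..
qed

text \<open>By \<open>duality\<close> the integrals of \<open>f\<close> and of
  \<open>f * g \<circ> T^n\<close> both become integrals of the chain values \<open>S k x\<close>,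
  which are close to one constant \<open>c\<close>. The two contributions of \<open>c\<close> cancel
  and leave the errors \<open>X\<close> and \<open>Y\<close>. Duality with the constant 1 in place
  of \<open>g\<close> handles the integral of \<open>f\<close> alone.\<close>

lemma correlation_bound:
  assumes H: "0 \<le> H"
  obtains D where "0 < D"
    "\<And>f g n. \<lbrakk>continuous_on UNIV f; continuous_on UNIV g; unit_holder H \<gamma> f;
        \<forall>y. cmod (g y) \<le> 1; 0 < n\<rbrakk>
      \<Longrightarrow> cmod ((LINT \<omega>|mu_hat V h \<nu>. f \<omega> * g (suffix n \<omega>))
            - (LINT \<omega>|mu_hat V h \<nu>. f \<omega>) * (LINT \<omega>|mu_hat V h \<nu>. g \<omega>))
          \<le> D * real n powr (- \<gamma>)"
proof -
  obtain K R where K: "2 \<le> K" and R: "1 \<le> R"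
    and KR: "\<And>f r s x y. \<lbrakk>unit_holder H \<gamma> f; x \<in> Omega_star; y \<in> Omega_star\<rbrakk>
      \<Longrightarrow> cmod (chain_op p f (r + s) 0 x - chain_op p f r 0 y) \<le> K * wt R \<gamma> r"
    by (rule coupling_bound[OF H]) (rule that; assumption)
  define T where "T = K * (\<Sum>k. gw R \<gamma> k * W k)"
  note sg = weighted_W_summable[OF R]
  have T: "0 \<le> T"
    unfolding T_def using K gw_ge_1[OF R gamma] integral_w_nonneg
    by (intro mult_nonneg_nonneg suminf_nonneg sg) (auto intro: order_trans[OF zero_le_one])
  have M1: "1 \<le> M1"
    by (rule M1_ge_1)
  \<comment> \<open>The factor \<open>R powr \<gamma>\<close> comes from comparing
    \<open>wt R \<gamma> n\<close> with \<open>n powr (- \<gamma>)\<close>; the summand 1 only makes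
    \<open>D\<close> positive.\<close>
  define D where "D = 2 * T * R powr \<gamma> + 1"
  have D: "0 < D"
    using T by (simp add: D_def add_nonneg_pos)
  have main: "cmod ((LINT \<omega>|mu_hat V h \<nu>. f \<omega> * g (suffix n \<omega>))
            - (LINT \<omega>|mu_hat V h \<nu>. f \<omega>) * (LINT \<omega>|mu_hat V h \<nu>. g \<omega>)) \<le> D * real n powr (- \<gamma>)"
    if fc: "continuous_on UNIV f" and gc: "continuous_on UNIV g"
      and fH: "unit_holder H \<gamma> f" and g1: "\<And>y. cmod (g y) \<le> 1"
      and n: "0 < n" for f g n
  proof -
    have f1: "cmod (f y) \<le> 1" for y
      using fH by (simp add: unit_holder_def)
    define S where "S = chain_op p f n"
    define c where "c = S 0 ones"
    have S: "CB (S k)" for k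
      unfolding S_def by (rule CB_chain_op[OF fc f1])
    have S1: "cmod (S k x) \<le> 1" if "x \<in> Omega_star" for k x
      unfolding S_def by (rule chain_op_norm[OF f1 that])
    have CBg: "CB g"
      using g1 continuous_on_subset[OF gc, of Omega_star] by (intro CB_I[of _ 1]) auto
    have Sc: "cmod (S k x - c) \<le> K * (gw R \<gamma> k * wt R \<gamma> n)" if x: "x \<in> Omega_star" for k x
    proof -
      have "cmod (S k x - c) \<le> K * wt R \<gamma> (n - k)"
      proof (cases "k \<le> n")
        case True
        then have "S k x = chain_op p f (n - k) 0 (zeros k x)"
          by (simp add: S_def chain_op_eq[of p f n k])
        then show ?thesis
          using KR[OF fH, of ones "zeros k x" "n - k" k] x True
          by (simp add: c_def S_def norm_minus_commute)
      next
        case False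
        have "cmod (S k x - c) \<le> 1 + 1"
          unfolding c_def using S1[OF x] S1[of ones]
          by (intro order_trans[OF norm_triangle_ineq4] add_mono) auto
        then show ?thesis
          using False K by (simp add: wt_0[OF R gamma])
      qed
      also have "\<dots> \<le> K * (gw R \<gamma> k * wt R \<gamma> n)"
        using wt_diff[OF R gamma] K by (intro mult_left_mono) auto
      finally show ?thesis .
    qed
    have bound: "cmod (Lam (\<lambda>k x. (S k x - c) * q x)) \<le> T * wt R \<gamma> n"
      if q: "CB q" "\<And>x. cmod (q x) \<le> 1" for q
    proof -
      have eq: "K * (gw R \<gamma> k * wt R \<gamma> n) * W k = (K * wt R \<gamma> n) * (gw R \<gamma> k * W k)" for k
        by (simp add: mult_ac)
      have "cmod (Lam (\<lambda>k x. (S k x - c) * q x)) \<le> (\<Sum>k. K * (gw R \<gamma> k * wt R \<gamma> n) * W k)"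
      proof (rule Lam_bound(2))
        show "CB (\<lambda>x. (S k x - c) * q x)" for k
          using CB_mult[OF CB_add[OF S CB_const[of "- c"]] q(1)] by simp
        show "cmod ((S k x - c) * q x) \<le> K * (gw R \<gamma> k * wt R \<gamma> n)" if "x \<in> Omega_star" for k x
          using mult_mono[OF Sc[OF that, of k] q(2)[of x]] order_trans[OF norm_ge_zero Sc[OF that, of k]]
          by (simp add: norm_mult)
        show "summable (\<lambda>k. K * (gw R \<gamma> k * wt R \<gamma> n) * W k)"
          unfolding eq by (intro summable_mult sg)
      qed
      also have "\<dots> = T * wt R \<gamma> n"
        unfolding eq suminf_mult[OF sg] T_def by (simp add: mult_ac)
      finally show ?thesis .
    qed
    define X where "X = Lam (\<lambda>k x. (S k x - c) * g x)"
    define Y where "Y = Lam (\<lambda>k x. (S k x - c) * 1)"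
    have X: "cmod X \<le> T * wt R \<gamma> n" and Y: "cmod Y \<le> T * wt R \<gamma> n"
      unfolding X_def Y_def by (intro bound CBg g1 CB_const; simp)+
    have L1: "Lam (\<lambda>k x. 1) = M1"
      using W_sums by (simp add: Lam_def scaleR_conv_of_real set_integral_complex_of_real sums_iff flip: suminf_of_real)
    have Lg: "cmod (Lam (\<lambda>k. g)) \<le> M1"
      using Lam_bound(2)[of "\<lambda>k. g" "\<lambda>_. 1"] CBg g1 W_sums by (simp add: sums_iff)
    have Lf: "Lam (\<lambda>k. f) = Y + c * M1"
      using duality[OF fc f1 CB_const[of 1], of n] Lam_centred[of S "\<lambda>_. 1" c] S S1 L1
      by (simp add: Y_def S_def[symmetric] CB_const algebra_simps)
    have Lfg: "Lam (\<lambda>k x. f x * g (suffix n x)) = X + c * Lam (\<lambda>k. g)"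
      using duality[OF fc f1 CBg, of n] Lam_centred[of S g c] S S1 CBg g1
      by (simp add: X_def S_def[symmetric] algebra_simps)
    have If: "(LINT \<omega>|mu_hat V h \<nu>. f \<omega>) = Lam (\<lambda>k. f) / M1"
      by (rule integral_mu_hat[OF fc f1])
    have Ig: "(LINT \<omega>|mu_hat V h \<nu>. g \<omega>) = Lam (\<lambda>k. g) / M1"
      by (rule integral_mu_hat[OF gc g1])
    have Ifg: "(LINT \<omega>|mu_hat V h \<nu>. f \<omega> * g (suffix n \<omega>)) = Lam (\<lambda>k x. f x * g (suffix n x)) / M1"
    proof (rule integral_mu_hat[where B = 1])
      show "continuous_on UNIV (\<lambda>x. f x * g (suffix n x))"
        by (intro continuous_on_mult fc continuous_on_compose2[OF gc continuous_on_suffix]) auto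
      show "cmod (f x * g (suffix n x)) \<le> 1" for x
        using mult_mono[OF f1[of x] g1[of "suffix n x"]] by (simp add: norm_mult)
    qed
    have "(LINT \<omega>|mu_hat V h \<nu>. f \<omega> * g (suffix n \<omega>))
            - (LINT \<omega>|mu_hat V h \<nu>. f \<omega>) * (LINT \<omega>|mu_hat V h \<nu>. g \<omega>)
        = X / M1 - Y * (Lam (\<lambda>k. g) / M1) / M1"
      using M1 unfolding If Ig Ifg Lf Lfg by (simp add: field_simps power2_eq_square)
    also have "cmod \<dots> \<le> cmod X / M1 + cmod Y * (cmod (Lam (\<lambda>k. g)) / M1) / M1"
      using M1 by (intro order_trans[OF norm_triangle_ineq4]) (simp add: norm_divide norm_mult)
    also have "\<dots> \<le> cmod X + cmod Y"
    proof (rule add_mono)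
      show "cmod X / M1 \<le> cmod X"
        using M1 by (simp add: divide_le_eq mult_le_cancel_left1)
      have "cmod (Lam (\<lambda>k. g)) / M1 / M1 \<le> 1"
        using M1 Lg by (simp add: divide_le_eq) (smt (verit) mult_le_cancel_right1)
      then have "cmod Y * (cmod (Lam (\<lambda>k. g)) / M1 / M1) \<le> cmod Y * 1"
        by (intro mult_left_mono) auto
      then show "cmod Y * (cmod (Lam (\<lambda>k. g)) / M1) / M1 \<le> cmod Y"
        by simp
    qed
    also have "\<dots> \<le> 2 * T * wt R \<gamma> n"
      using X Y by simp
    also have "\<dots> \<le> 2 * T * (R powr \<gamma> * real n powr (- \<gamma>))"
    proof (rule mult_left_mono)
      have "wt R \<gamma> n \<le> (real n / R) powr (- \<gamma>)"
        unfolding wt_def using n R gamma by (intro powr_mono2') auto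
      also have "\<dots> = R powr \<gamma> * real n powr (- \<gamma>)"
        using n R by (simp add: powr_divide powr_minus field_simps)
      finally show "wt R \<gamma> n \<le> R powr \<gamma> * real n powr (- \<gamma>)" .
    qed (use T in simp)
    also have "\<dots> \<le> D * real n powr (- \<gamma>)"
      by (simp add: D_def algebra_simps)
    finally show ?thesis .
  qed
  show thesis
    by (rule that[OF D main]) auto
qed

end

theorem theorem6:
  fixes V :: "seq \<Rightarrow> real" and h :: "seq \<Rightarrow> real" and \<nu> :: "seq measure"
    and \<theta> d a :: real
  assumes "admissible_potential V \<theta>"
    and "induced_eigenpair V \<theta> h \<nu>"
    and "has_ergodic_degree (rho h \<nu>) d"
    and "d > 0"
    and "a \<ge> d"
  shows "\<forall>\<epsilon>>0. \<exists>D>0. \<forall>n>0. \<forall>f\<in>H_space a. \<forall>g\<in>H_space a.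
    cmod ((LINT \<omega>|mu_hat V h \<nu>. f \<omega> * g (suffix n \<omega>))
          - (LINT \<omega>|mu_hat V h \<nu>. f \<omega>) * (LINT \<omega>|mu_hat V h \<nu>. g \<omega>))
      \<le> D * H_norm a f * H_norm a g * real n powr (- (d - \<epsilon>))"
proof (intro allI impI)
  fix \<epsilon> :: real
  assume \<epsilon>: "0 < \<epsilon>"
  interpret sys: induced_system V \<theta> h \<nu>
    by unfold_locales fact+
  \<comment> \<open>The minimum with \<open>d / 2\<close> keeps \<open>\<gamma>\<close> positive
    when \<open>\<epsilon>\<close> is large. As \<open>\<gamma> < d\<close>, the moment of order
    \<open>1 + \<gamma>\<close> is finite. The constant \<open>D\<close> depends on
    \<open>\<epsilon>\<close> through \<open>\<gamma>\<close>.\<close>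
  define \<gamma> where "\<gamma> = d - min \<epsilon> (d / 2)"
  have \<gamma>: "0 < \<gamma>" "\<gamma> < d" "d - \<epsilon> \<le> \<gamma>"
    using \<open>0 < d\<close> \<epsilon> by (auto simp: \<gamma>_def min_def)
  obtain C where C: "0 < C" "\<And>j m x y. x \<in> Omega_star \<Longrightarrow> y \<in> Omega_star \<Longrightarrow> agree j x y \<Longrightarrow>
      sys.p m x * exp (- C * \<theta> ^ j) \<le> sys.p m y"
    by (rule sys.p_distortion) (rule that; assumption)
  have "\<forall>\<epsilon>>0. moment (rho h \<nu>) (d + 1 - \<epsilon>) < \<infinity>"
    using assms(3) unfolding has_ergodic_degree_def by (elim conjE)
  from this[rule_format, of "d - \<gamma>"] have "moment (rho h \<nu>) (1 + \<gamma>) < \<infinity>"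
    using \<gamma>(2) by (simp add: add.commute)
  then have "(\<Sum>k. ennreal (real (Suc k) powr (1 + \<gamma>) * sys.r k)) < \<infinity>"
    by (simp add: sys.moment_rho add.commute del: of_nat_Suc)
  then have "summable (\<lambda>k. real (Suc k) powr (1 + \<gamma>) * sys.r k)"
    by (intro summable_suminf_not_top) (auto simp: sys.r_nonneg simp del: of_nat_Suc)
  from summable_mult[OF this, of "exp C"]
  have mom: "summable (\<lambda>m. exp C * sys.r m * real (Suc m) powr (1 + \<gamma>))"
    by (simp add: mult_ac del: of_nat_Suc)
  have "sys.p m x \<le> exp C * sys.r m" if "x \<in> Omega_star" for m x
    using C(2)[where j = 0] that by (intro sys.p_le_r) auto
  then interpret finite_mean_system V \<theta> h \<nu> C \<gamma> "\<lambda>m. exp C * sys.r m"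
    using C \<gamma> mom sys.theta sys.p_pos sys.p_sums by unfold_locales auto
  \<comment> \<open>The factor 2 covers \<open>L = 0\<close>, where only the sup bound is available;
    \<open>2 powr \<gamma>\<close> pays for replacing \<open>L\<close> by \<open>(1 + L) / 2\<close>
    when \<open>L \<ge> 1\<close>.\<close>
  define H :: real where "H = 2 * 2 powr \<gamma>"
  have H: "0 \<le> H"
    by (simp add: H_def)
  obtain D where D: "0 < D"
    and bound: "\<And>f g n. \<lbrakk>continuous_on UNIV f; continuous_on UNIV g; unit_holder H \<gamma> f;
        \<forall>y. cmod (g y) \<le> 1; 0 < n\<rbrakk>
      \<Longrightarrow> cmod ((LINT \<omega>|mu_hat V h \<nu>. f \<omega> * g (suffix n \<omega>))
            - (LINT \<omega>|mu_hat V h \<nu>. f \<omega>) * (LINT \<omega>|mu_hat V h \<nu>. g \<omega>))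
          \<le> D * real n powr (- \<gamma>)"
    by (rule correlation_bound[OF H]) (rule that; assumption)
  have a: "0 \<le> a" "\<gamma> \<le> a"
    using assms(4,5) \<gamma> by auto
  have main: "cmod ((LINT \<omega>|mu_hat V h \<nu>. f \<omega> * g (suffix n \<omega>))
          - (LINT \<omega>|mu_hat V h \<nu>. f \<omega>) * (LINT \<omega>|mu_hat V h \<nu>. g \<omega>))
      \<le> D * H_norm a f * H_norm a g * real n powr (- (d - \<epsilon>))"
    if n: "0 < n" and f: "f \<in> H_space a" and g: "g \<in> H_space a" for n f g
  \<comment> \<open>A zero norm cannot be divided out, but it forces the function to vanish
    identically.\<close>
  proof (cases "H_norm a f = 0 \<or> H_norm a g = 0")
    case True
    then have "(\<forall>x. f x = 0) \<or> (\<forall>x. g x = 0)"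
      using H_space_bounds(1)[OF f a(1)] H_space_bounds(1)[OF g a(1)] by auto
    then show ?thesis
      using True by auto
  next
    case False
    define A where "A = H_norm a f"
    define B where "B = H_norm a g"
    have AB: "0 < A" "0 < B"
      using False H_space_bounds(3)[OF f a(1)] H_space_bounds(3)[OF g a(1)] by (auto simp: A_def B_def)
    define f' where "f' = (\<lambda>x. f x / complex_of_real A)"
    define g' where "g' = (\<lambda>x. g x / complex_of_real B)"
    have fg: "f x = complex_of_real A * f' x" "g x = complex_of_real B * g' x" for x
      using AB by (auto simp: f'_def g'_def)
    have fc: "continuous_on UNIV f'" and gc: "continuous_on UNIV g'"
      using f g AB unfolding f'_def g'_def H_space_def by (auto intro!: continuous_on_divide)
    have f1: "cmod (f' y) \<le> 1" and g1: "cmod (g' y) \<le> 1" for y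
      using H_space_bounds(1)[OF f a(1), of y] H_space_bounds(1)[OF g a(1), of y] AB
      by (auto simp: f'_def g'_def norm_divide A_def B_def)
    have f3: "cmod (f' x - f' y) \<le> H * (1 + real L) powr (- \<gamma>)" if eq: "\<And>i. i < L \<Longrightarrow> x i = y i" for x y L
    proof (cases "L = 0")
      case True
      have "cmod (f' x - f' y) \<le> 1 + 1"
        by (intro order_trans[OF norm_triangle_ineq4] add_mono f1)
      also have "\<dots> \<le> H"
        using \<gamma>(1) ge_one_powr_ge_zero[of 2 \<gamma>] by (simp add: H_def)
      finally show ?thesis
        using True by simp
    next
      case False
      then have L: "0 < L"
        by simp
      have "cmod (f' x - f' y) = cmod (f x - f y) / A"
        using AB by (simp add: f'_def diff_divide_distrib[symmetric] norm_divide)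
      also have "\<dots> \<le> real L powr (- a)"
        using H_space_bounds(2)[OF f a(1) L eq] AB by (simp add: A_def divide_le_eq mult.commute)
      also have "\<dots> \<le> real L powr (- \<gamma>)"
        using L a by (intro powr_mono) auto
      also have "\<dots> \<le> ((1 + real L) / 2) powr (- \<gamma>)"
        using L \<gamma> by (intro powr_mono2') auto
      also have "\<dots> = 2 powr \<gamma> * (1 + real L) powr (- \<gamma>)"
        by (simp add: powr_divide powr_minus field_simps)
      also have "\<dots> \<le> H * (1 + real L) powr (- \<gamma>)"
        by (simp add: H_def)
      finally show ?thesis .
    qed
    then have f2: "unit_holder H \<gamma> f'"
      using f1 by (auto simp: unit_holder_def)
    let ?I = "\<lambda>f. LINT \<omega>|mu_hat V h \<nu>. f \<omega> :: complex"
    have "?I (\<lambda>\<omega>. f \<omega> * g (suffix n \<omega>)) - ?I f * ?I g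
        = complex_of_real (A * B) * (?I (\<lambda>\<omega>. f' \<omega> * g' (suffix n \<omega>)) - ?I f' * ?I g')"
    proof -
      have "?I (\<lambda>\<omega>. f \<omega> * g (suffix n \<omega>)) = ?I (\<lambda>\<omega>. complex_of_real (A * B) * (f' \<omega> * g' (suffix n \<omega>)))"
        unfolding fg by (simp add: mult_ac)
      moreover have "?I f = complex_of_real A * ?I f'" "?I g = complex_of_real B * ?I g'"
        unfolding fg by simp_all
      ultimately show ?thesis
        by (simp add: algebra_simps)
    qed
    then have "cmod (?I (\<lambda>\<omega>. f \<omega> * g (suffix n \<omega>)) - ?I f * ?I g)
        = A * B * cmod (?I (\<lambda>\<omega>. f' \<omega> * g' (suffix n \<omega>)) - ?I f' * ?I g')"
      using AB by (simp add: norm_mult)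
    also have "\<dots> \<le> A * B * (D * real n powr (- \<gamma>))"
      using AB g1 by (intro mult_left_mono bound fc gc f2 n) auto
    also have "\<dots> \<le> A * B * (D * real n powr (- (d - \<epsilon>)))"
      using AB D n \<gamma> by (intro mult_left_mono powr_mono) auto
    finally show ?thesis
      by (simp add: A_def B_def mult_ac)
  qed
  show "\<exists>D>0. \<forall>n>0. \<forall>f\<in>H_space a. \<forall>g\<in>H_space a.
    cmod ((LINT \<omega>|mu_hat V h \<nu>. f \<omega> * g (suffix n \<omega>))
          - (LINT \<omega>|mu_hat V h \<nu>. f \<omega>) * (LINT \<omega>|mu_hat V h \<nu>. g \<omega>))
      \<le> D * H_norm a f * H_norm a g * real n powr (- (d - \<epsilon>))"
    using D main by blast
qed

end
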